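(* Assume [H0], [H1], [H2] and [$\widetilde{\mathrm H}$3] (as listed in the context). Then the value function $v$ of the infinite horizon optimal control problem is a bounded discontinuous viscosity solution of (HJ) in $\mathcal S$; that is, $v$ is bounded, its upper semicontinuous envelope $v^\star$ is a viscosity subsolution of (HJ) in $\mathcal S$, and its lower semicontinuous envelope $v_\star$ is a viscosity supersolution of (HJ) in $\mathcal S$.
   Context: **Geometry.** In $\mathbb R^3$ with Euclidean scalar product $x\cdot y$ and norm $|x|$, let $N>1$ and let $e_0,e_1,\dots,e_N$ be distinct unit vectors with $e_i\cdot e_0=0$ for $i=1,\dots,N$. Write $\mathbb R e_0\times\mathbb R e_i$ for the plane spanned by $e_0,e_i$. Let $\mathcal P_i=\{x_0e_0+x_ie_i: x_0\in\mathbb R,\ x_i\ge 0\}$ (closed half-plane), $\Gamma=\mathbb R e_0$, $\mathcal S=\bigcup_{i=1}^N\mathcal P_i$. **Assumptions.** $A$ is a metric space and $\lambda>0$. [H0] For $i=1,\dots,N$, $A_i\subset A$ is non-empty and compact, the $A_i$ are pairwise disjoint, $f_i:\mathcal P_i\times A_i\to\mathbb R e_0\times\mathbb R e_i$ is continuous and bounded, and there is $L_f>0$ with $|f_i(x,a)-f_i(y,a)|\le L_f|x-y|$ for all $i$, $x,y\in\mathcal P_i$, $a\in A_i$. [H1] For $i=1,\dots,N$, $\ell_i:\mathcal P_i\times A_i\to\mathbb R$ is continuous and bounded, and there is a modulus of continuity $\omega_\ell$ with $|\ell_i(x,a)-\ell_i(y,a)|\le\omega_\ell(|x-y|)$ for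 all $i$, $x,y\in\mathcal P_i$, $a\in A_i$. [H2] For all $i$ and $x\in\mathcal P_i$, the set $\mathrm{FL}_i(x)=\{(f_i(x,a),\ell_i(x,a)):a\in A_i\}$ is convex (it is non-empty and closed). [$\widetilde{\mathrm H}$3] (normal controllability) There is $\delta>0$ such that for all $i$ and $x\in\Gamma$, $[-\delta,\delta]\subset\{f_i(x,a)\cdot e_i:a\in A_i\}$. **Control problem.** $M=\{(x,a): x\in\mathcal S,\ a\in A_i\text{ if }x\in\mathcal P_i\setminus\Gamma,\ a\in\bigcup_{i=1}^NA_i\text{ if }x\in\Gamma\}$. On $M$ define $f(x,a)=f_i(x,a)$ and $\ell(x,a)=\ell_i(x,a)$ if $x\in\mathcal P_i\setminus\Gamma$, or if $x\in\Gamma$ and $a\in A_i$. For $x\in\mathcal S$, $\mathcal T_x$ is the set of $(y_x,\alpha)\in L^\infty_{\rm loc}(\mathbb R^+;M)$ such that $y_x:\mathbb R^+\to\mathcal S$ is Lipschitz and $y_x(t)=x+\int_0^tf(y_x(s),\alpha(s))\,ds$ for all $t\ge0$. The value function is $v(x)=\inf_{(y_x,\alpha)\in\mathcal T_x}\int_0^\infty\ell(y_x(t),\alpha(t))e^{-\lambda t}\,dt$. **Envelopes.** For bounded $u:\mathcal S\to\mathbb R$, $u_\star(x)=\liminf_{z\to x}u(z)$ and $u^\star(x)=\limsup_{z\to x}u(z)$ (with $z\in\mathcal S$, $z=x$ allowed). **Viscosity sub/supersolutions.** $\mathcal R(\mathcal S)$ is the set of continuous $\varphi:\mathcal S\to\mathbb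 R$ with $\varphi|_{\mathcal P_j}\in C^1(\mathcal P_j)$ (up to the boundary $\Gamma$) for every $j$; $D(\varphi|_{\mathcal P_j})(x)\in\mathbb R e_0\times\mathbb R e_j$ is the gradient (for $x\in\Gamma$, the limit of gradients from $\mathcal P_j\setminus\Gamma$). Let $H_i(x,p)=\max_{a\in A_i}(-p\cdot f_i(x,a)-\ell_i(x,a))$ for $x\in\mathcal P_i$, $p\in\mathbb R e_0\times\mathbb R e_i$; for $x\in\Gamma$, $H_i^+(x,p)=\max_{a\in A_i,\ f_i(x,a)\cdot e_i\ge0}(-p\cdot f_i(x,a)-\ell_i(x,a))$ and $H_\Gamma(x,p_1,\dots,p_N)=\max_iH_i^+(x,p_i)$. (HJ) denotes the equation $\lambda u+H_i(x,Du)=0$ in $\mathcal P_i\setminus\Gamma$ ($i=1,\dots,N$), $\lambda u+H_\Gamma(x,D(u|_{\mathcal P_1}),\dots,D(u|_{\mathcal P_N}))=0$ on $\Gamma$, in the following sense. An upper semicontinuous $u:\mathcal S\to\mathbb R$ is a viscosity subsolution if, for every $x\in\mathcal S$ and $\varphi\in\mathcal R(\mathcal S)$ such that $u-\varphi$ has a local maximum (on $\mathcal S$) at $x$: $\lambda u(x)+H_i(x,D(\varphi|_{\mathcal P_i})(x))\le0$ if $x\in\mathcal P_i\setminus\Gamma$, and $\lambda u(x)+H_\Gamma(x,D(\varphi|_{\mathcal P_1})(x),\dots,D(\varphi|_{\mathcal P_N})(x))\le0$ if $x\in\Gamma$. A lower semicontinuous $u$ is a viscosity supersolution if the reverse inequalities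 ($\ge0$) hold whenever $u-\varphi$ has a local minimum at $x$. *)

theory Defs
  imports "HOL-Analysis.Analysis"
begin

section \<open>Geometry of the junction\<close>

text \<open>Throughout, the unit vectors are \<open>e 0, \<dots>, e N\<close>, the last \<open>N\<close> of them indexing the half-planes.
  The metric space of controls is the universe of a type of class \<^class>\<open>metric_space\<close>.\<close>

type_synonym pt = "real ^ 3"

definition plane :: "(nat \<Rightarrow> pt) \<Rightarrow> nat \<Rightarrow> pt set" where
  "plane e i = span {e 0, e i}"

definition half_plane :: "(nat \<Rightarrow> pt) \<Rightarrow> nat \<Rightarrow> pt set" where
  "half_plane e i = {x0 *\<^sub>R e 0 + xi *\<^sub>R e i |x0 xi. xi \<ge> 0}"

definition Gam :: "(nat \<Rightarrow> pt) \<Rightarrow> pt set" where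
  "Gam e = range (\<lambda>x0. x0 *\<^sub>R e 0)"

definition junction :: "(nat \<Rightarrow> pt) \<Rightarrow> nat \<Rightarrow> pt set" where
  "junction e N = (\<Union>i\<in>{1..N}. half_plane e i)"

section \<open>Assumptions on the data\<close>

definition modulus_of_continuity :: "(real \<Rightarrow> real) \<Rightarrow> bool" where
  "modulus_of_continuity \<omega> \<longleftrightarrow>
     mono_on {0..} \<omega> \<and> \<omega> 0 = 0 \<and> (\<omega> \<longlongrightarrow> 0) (at_right 0)"

definition H0 :: "(nat \<Rightarrow> pt) \<Rightarrow> nat \<Rightarrow> (nat \<Rightarrow> 'a::metric_space set) \<Rightarrow> (nat \<Rightarrow> pt \<Rightarrow> 'a \<Rightarrow> pt) \<Rightarrow> bool" where
  "H0 e N A f \<longleftrightarrow>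
     (\<forall>i\<in>{1..N}. A i \<noteq> {} \<and> compact (A i)) \<and>
     (\<forall>i\<in>{1..N}. \<forall>j\<in>{1..N}. i \<noteq> j \<longrightarrow> A i \<inter> A j = {}) \<and>
     (\<forall>i\<in>{1..N}.
        (\<forall>x\<in>half_plane e i. \<forall>a\<in>A i. f i x a \<in> plane e i) \<and>
        continuous_on (half_plane e i \<times> A i) (\<lambda>(x, a). f i x a) \<and>
        bounded ((\<lambda>(x, a). f i x a) ` (half_plane e i \<times> A i))) \<and>
     (\<exists>L>0. \<forall>i\<in>{1..N}. \<forall>x\<in>half_plane e i. \<forall>y\<in>half_plane e i. \<forall>a\<in>A i.
        norm (f i x a - f i y a) \<le> L * norm (x - y))"

definition H1 :: "(nat \<Rightarrow> pt) \<Rightarrow> nat \<Rightarrow> (nat \<Rightarrow> 'a::metric_space set) \<Rightarrow> (nat \<Rightarrow> pt \<Rightarrow> 'a \<Rightarrow> real) \<Rightarrow> bool" where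
  "H1 e N A l \<longleftrightarrow>
     (\<forall>i\<in>{1..N}.
        continuous_on (half_plane e i \<times> A i) (\<lambda>(x, a). l i x a) \<and>
        bounded ((\<lambda>(x, a). l i x a) ` (half_plane e i \<times> A i))) \<and>
     (\<exists>\<omega>. modulus_of_continuity \<omega> \<and>
        (\<forall>i\<in>{1..N}. \<forall>x\<in>half_plane e i. \<forall>y\<in>half_plane e i. \<forall>a\<in>A i.
           \<bar>l i x a - l i y a\<bar> \<le> \<omega> (norm (x - y))))"

definition FL :: "(nat \<Rightarrow> 'a set) \<Rightarrow> (nat \<Rightarrow> pt \<Rightarrow> 'a \<Rightarrow> pt) \<Rightarrow> (nat \<Rightarrow> pt \<Rightarrow> 'a \<Rightarrow> real) \<Rightarrow>
    nat \<Rightarrow> pt \<Rightarrow> (pt \<times> real) set" where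
  "FL A f l i x = (\<lambda>a. (f i x a, l i x a)) ` A i"

definition H2 :: "(nat \<Rightarrow> pt) \<Rightarrow> nat \<Rightarrow> (nat \<Rightarrow> 'a set) \<Rightarrow> (nat \<Rightarrow> pt \<Rightarrow> 'a \<Rightarrow> pt) \<Rightarrow>
    (nat \<Rightarrow> pt \<Rightarrow> 'a \<Rightarrow> real) \<Rightarrow> bool" where
  "H2 e N A f l \<longleftrightarrow> (\<forall>i\<in>{1..N}. \<forall>x\<in>half_plane e i. convex (FL A f l i x))"

definition H3_normal :: "(nat \<Rightarrow> pt) \<Rightarrow> nat \<Rightarrow> (nat \<Rightarrow> 'a set) \<Rightarrow> (nat \<Rightarrow> pt \<Rightarrow> 'a \<Rightarrow> pt) \<Rightarrow> bool" where
  "H3_normal e N A f \<longleftrightarrow>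
     (\<exists>\<delta>>0. \<forall>i\<in>{1..N}. \<forall>x\<in>Gam e. {-\<delta>..\<delta>} \<subseteq> (\<lambda>a. f i x a \<bullet> e i) ` A i)"

section \<open>The control problem\<close>

definition ctrl_set :: "(nat \<Rightarrow> pt) \<Rightarrow> nat \<Rightarrow> (nat \<Rightarrow> 'a set) \<Rightarrow> (pt \<times> 'a) set" where
  "ctrl_set e N A = {(x, a). x \<in> junction e N \<and>
     (\<forall>i\<in>{1..N}. x \<in> half_plane e i - Gam e \<longrightarrow> a \<in> A i) \<and>
     (x \<in> Gam e \<longrightarrow> a \<in> (\<Union>i\<in>{1..N}. A i))}"

text \<open>The function on \<open>ctrl_set e N A\<close> obtained from the branchwise data \<open>g i\<close> (either \<open>f i\<close> or \<open>l i\<close>).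
  On that set exactly one index qualifies, because the open half-planes are pairwise disjoint
  and so are the control sets.\<close>

definition glue :: "(nat \<Rightarrow> pt) \<Rightarrow> nat \<Rightarrow> (nat \<Rightarrow> 'a set) \<Rightarrow> (nat \<Rightarrow> pt \<Rightarrow> 'a \<Rightarrow> 'b) \<Rightarrow> pt \<Rightarrow> 'a \<Rightarrow> 'b" where
  "glue e N A g x a =
     g (THE i. i \<in> {1..N} \<and> (x \<in> half_plane e i - Gam e \<or> x \<in> Gam e \<and> a \<in> A i)) x a"

definition Linf_loc :: "'b::metric_space set \<Rightarrow> (real \<Rightarrow> 'b) \<Rightarrow> bool" where
  "Linf_loc E g \<longleftrightarrow>
     g \<in> borel_measurable (lebesgue_on {0..}) \<and>
     (AE t in lebesgue_on {0..}. g t \<in> E) \<and>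
     (\<forall>T>0. \<exists>c r. AE t in lebesgue_on {0..T}. dist c (g t) \<le> r)"

definition trajectories :: "(nat \<Rightarrow> pt) \<Rightarrow> nat \<Rightarrow> (nat \<Rightarrow> 'a::metric_space set) \<Rightarrow> (nat \<Rightarrow> pt \<Rightarrow> 'a \<Rightarrow> pt) \<Rightarrow>
    pt \<Rightarrow> ((real \<Rightarrow> pt) \<times> (real \<Rightarrow> 'a)) set" where
  "trajectories e N A f x = {(y, \<alpha>).
     Linf_loc (ctrl_set e N A) (\<lambda>t. (y t, \<alpha> t)) \<and>
     y ` {0..} \<subseteq> junction e N \<and> (\<exists>L. L-lipschitz_on {0..} y) \<and>
     (\<forall>t\<ge>0. y t = x + (LINT s|lebesgue_on {0..t}. glue e N A f (y s) (\<alpha> s)))}"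

definition cost :: "(nat \<Rightarrow> pt) \<Rightarrow> nat \<Rightarrow> (nat \<Rightarrow> 'a set) \<Rightarrow> (nat \<Rightarrow> pt \<Rightarrow> 'a \<Rightarrow> real) \<Rightarrow> real \<Rightarrow>
    (real \<Rightarrow> pt) \<times> (real \<Rightarrow> 'a) \<Rightarrow> real" where
  "cost e N A l lam = (\<lambda>(y, \<alpha>).
     LINT t|lebesgue_on {0..}. glue e N A l (y t) (\<alpha> t) * exp (- lam * t))"

text \<open>The infimum is taken in \<^typ>\<open>ereal\<close>, so that finiteness of the value function (in particular the
  existence of an admissible trajectory from every point) is not built into the definition.\<close>

definition value_function :: "(nat \<Rightarrow> pt) \<Rightarrow> nat \<Rightarrow> (nat \<Rightarrow> 'a::metric_space set) \<Rightarrow> (nat \<Rightarrow> pt \<Rightarrow> 'a \<Rightarrow> pt) \<Rightarrow>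
    (nat \<Rightarrow> pt \<Rightarrow> 'a \<Rightarrow> real) \<Rightarrow> real \<Rightarrow> pt \<Rightarrow> ereal" where
  "value_function e N A f l lam x =
     (INF ya\<in>trajectories e N A f x. ereal (cost e N A l lam ya))"

section \<open>Semicontinuity and envelopes\<close>

definition usc_on :: "pt set \<Rightarrow> (pt \<Rightarrow> real) \<Rightarrow> bool" where
  "usc_on S u \<longleftrightarrow> (\<forall>x\<in>S. \<forall>c. u x < c \<longrightarrow> (\<forall>\<^sub>F z in at x within S. u z < c))"

definition lsc_on :: "pt set \<Rightarrow> (pt \<Rightarrow> real) \<Rightarrow> bool" where
  "lsc_on S u \<longleftrightarrow> (\<forall>x\<in>S. \<forall>c. c < u x \<longrightarrow> (\<forall>\<^sub>F z in at x within S. c < u z))"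

text \<open>The filter below is that of the neighbourhoods of \<open>x\<close> in \<open>S\<close>; unlike \<open>at x within S\<close> it does not
  exclude \<open>x\<close> itself. The envelopes of a bounded function on \<open>S\<close> are finite, so passing to
  \<^typ>\<open>real\<close> loses nothing.\<close>

definition upper_envelope :: "pt set \<Rightarrow> (pt \<Rightarrow> ereal) \<Rightarrow> pt \<Rightarrow> real" where
  "upper_envelope S u x = real_of_ereal (Limsup (inf (nhds x) (principal S)) u)"

definition lower_envelope :: "pt set \<Rightarrow> (pt \<Rightarrow> ereal) \<Rightarrow> pt \<Rightarrow> real" where
  "lower_envelope S u x = real_of_ereal (Liminf (inf (nhds x) (principal S)) u)"

section \<open>Test functions\<close>

text \<open>Gradient of \<open>\<phi>\<close> restricted to the half-plane \<open>i\<close>, as a vector of \<open>plane e i\<close>;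
  on \<open>Gam e\<close> it is the limit of the gradients from inside the half-plane.\<close>

definition inner_grad :: "(nat \<Rightarrow> pt) \<Rightarrow> nat \<Rightarrow> (pt \<Rightarrow> real) \<Rightarrow> pt \<Rightarrow> pt" where
  "inner_grad e i \<phi> x =
     (THE p. p \<in> plane e i \<and> (\<phi> has_derivative (\<lambda>h. p \<bullet> h)) (at x within half_plane e i))"

definition grad :: "(nat \<Rightarrow> pt) \<Rightarrow> nat \<Rightarrow> (pt \<Rightarrow> real) \<Rightarrow> pt \<Rightarrow> pt" where
  "grad e i \<phi> x =
     (if x \<in> Gam e then Lim (at x within (half_plane e i - Gam e)) (inner_grad e i \<phi>)
      else inner_grad e i \<phi> x)"

text \<open>Continuity of \<^const>\<open>grad\<close> on the closed half-plane forces the limits defining it on \<open>Gam e\<close> to exist.\<close>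

definition test_functions :: "(nat \<Rightarrow> pt) \<Rightarrow> nat \<Rightarrow> (pt \<Rightarrow> real) set" where
  "test_functions e N = {\<phi>. continuous_on (junction e N) \<phi> \<and>
     (\<forall>i\<in>{1..N}.
        (\<forall>x\<in>half_plane e i - Gam e. \<phi> differentiable (at x within half_plane e i)) \<and>
        continuous_on (half_plane e i) (grad e i \<phi>))}"

section \<open>Hamiltonians and viscosity solutions\<close>

text \<open>Under the standing assumptions the suprema over controls are attained maxima.\<close>

definition Ham :: "(nat \<Rightarrow> 'a set) \<Rightarrow> (nat \<Rightarrow> pt \<Rightarrow> 'a \<Rightarrow> pt) \<Rightarrow> (nat \<Rightarrow> pt \<Rightarrow> 'a \<Rightarrow> real) \<Rightarrow>
    nat \<Rightarrow> pt \<Rightarrow> pt \<Rightarrow> real" where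
  "Ham A f l i x p = (SUP a\<in>A i. - (p \<bullet> f i x a) - l i x a)"

definition Ham_plus :: "(nat \<Rightarrow> pt) \<Rightarrow> (nat \<Rightarrow> 'a set) \<Rightarrow> (nat \<Rightarrow> pt \<Rightarrow> 'a \<Rightarrow> pt) \<Rightarrow> (nat \<Rightarrow> pt \<Rightarrow> 'a \<Rightarrow> real) \<Rightarrow>
    nat \<Rightarrow> pt \<Rightarrow> pt \<Rightarrow> real" where
  "Ham_plus e A f l i x p = (SUP a\<in>{a \<in> A i. f i x a \<bullet> e i \<ge> 0}. - (p \<bullet> f i x a) - l i x a)"

definition Ham_Gam :: "(nat \<Rightarrow> pt) \<Rightarrow> nat \<Rightarrow> (nat \<Rightarrow> 'a set) \<Rightarrow> (nat \<Rightarrow> pt \<Rightarrow> 'a \<Rightarrow> pt) \<Rightarrow>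
    (nat \<Rightarrow> pt \<Rightarrow> 'a \<Rightarrow> real) \<Rightarrow> pt \<Rightarrow> (nat \<Rightarrow> pt) \<Rightarrow> real" where
  "Ham_Gam e N A f l x p = Max ((\<lambda>i. Ham_plus e A f l i x (p i)) ` {1..N})"

definition viscosity_subsolution :: "(nat \<Rightarrow> pt) \<Rightarrow> nat \<Rightarrow> (nat \<Rightarrow> 'a set) \<Rightarrow> (nat \<Rightarrow> pt \<Rightarrow> 'a \<Rightarrow> pt) \<Rightarrow>
    (nat \<Rightarrow> pt \<Rightarrow> 'a \<Rightarrow> real) \<Rightarrow> real \<Rightarrow> (pt \<Rightarrow> real) \<Rightarrow> bool" where
  "viscosity_subsolution e N A f l lam u \<longleftrightarrow>
     usc_on (junction e N) u \<and>
     (\<forall>x\<in>junction e N. \<forall>\<phi>\<in>test_functions e N.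
        (\<forall>\<^sub>F z in at x within junction e N. u z - \<phi> z \<le> u x - \<phi> x) \<longrightarrow>
        (\<forall>i\<in>{1..N}. x \<in> half_plane e i - Gam e \<longrightarrow>
            lam * u x + Ham A f l i x (grad e i \<phi> x) \<le> 0) \<and>
        (x \<in> Gam e \<longrightarrow> lam * u x + Ham_Gam e N A f l x (\<lambda>i. grad e i \<phi> x) \<le> 0))"

definition viscosity_supersolution :: "(nat \<Rightarrow> pt) \<Rightarrow> nat \<Rightarrow> (nat \<Rightarrow> 'a set) \<Rightarrow> (nat \<Rightarrow> pt \<Rightarrow> 'a \<Rightarrow> pt) \<Rightarrow>
    (nat \<Rightarrow> pt \<Rightarrow> 'a \<Rightarrow> real) \<Rightarrow> real \<Rightarrow> (pt \<Rightarrow> real) \<Rightarrow> bool" where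
  "viscosity_supersolution e N A f l lam u \<longleftrightarrow>
     lsc_on (junction e N) u \<and>
     (\<forall>x\<in>junction e N. \<forall>\<phi>\<in>test_functions e N.
        (\<forall>\<^sub>F z in at x within junction e N. u z - \<phi> z \<ge> u x - \<phi> x) \<longrightarrow>
        (\<forall>i\<in>{1..N}. x \<in> half_plane e i - Gam e \<longrightarrow>
            lam * u x + Ham A f l i x (grad e i \<phi> x) \<ge> 0) \<and>
        (x \<in> Gam e \<longrightarrow> lam * u x + Ham_Gam e N A f l x (\<lambda>i. grad e i \<phi> x) \<ge> 0))"

end

theory Submission
  imports Defs
begin

text \<open>Both inequalities come from dynamic programming on a short time interval. For the upper envelope
  constant controls suffice: on \<open>\<Gamma>\<close> one first moves the approximating points to \<open>\<Gamma>\<close> by normal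
  controllability and then, by convexity, replaces a control with \<open>f i x a \<bullet> e i \<ge> 0\<close> by nearby ones with strict
  inequality, which keep the trajectory in the half-plane. For the lower envelope near-optimal
  trajectories may oscillate between the half-planes, but a function that is linear on each half-plane obeys
  the chain rule along them. On \<open>\<Gamma>\<close> the normal slopes of the test function are first lowered by
  Lagrange multipliers for the constraints \<open>f i x a \<bullet> e i \<ge> 0\<close>, after which the required bound
  holds for all controls and the oscillations do no harm.\<close>

section \<open>Real analysis\<close>

text \<open>All estimates are quadratic in the time span t. The approximating point is taken within
  t^2 of x, in distance and in value, and near-optimality costs another t^2; the remaining errors
  are O(t^2) or t times an arbitrarily small factor, so dividing by t gives the inequality. Test
  functions enter only through their expansion at x, linear on each half-plane up to an error
  \<epsilon> |z - x|, which along a trajectory of speed at most M amounts to \<epsilon> M t up to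
  O(t^2). This reduces the chain rule to piecewise linear functions. The obstacle at \<Gamma> is
  that the points realising an envelope at x may lie in any half-plane. A control of branch i can be
  run only from \<open>P i\<close>, so for the subsolution these points are first brought to
  \<Gamma>, which lies in every half-plane. For the supersolution they may stay, but near \<Gamma>
  their trajectories may use controls with \<open>f i x a \<bullet> e i < 0\<close>, which
  \<open>Ham_Gam\<close> does not see; a bound over the controls in \<open>Ham_Gam\<close> alone
  cannot be integrated along them.\<close>

lemma ae_has_vector_derivative_of_integral:
  fixes f Y :: "real \<Rightarrow> 'b::euclidean_space"
  assumes Y: "\<And>s t. 0 \<le> s \<Longrightarrow> s \<le> t \<Longrightarrow> (f has_integral (Y t - Y s)) {s..t}"
  obtains Z where "negligible Z"
    and "\<And>x. x \<notin> Z \<Longrightarrow> 0 < x \<Longrightarrow> (Y has_vector_derivative f x) (at x)"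
proof -
  \<comment> \<open>The velocity is integrable on nonnegative times only; extended by zero it is
    integrable on every interval, as the differentiation theorem requires.\<close>
  define f0 where "f0 = (\<lambda>t. if t \<in> {0..} then f t else 0)"
  have int0: "f0 integrable_on {a..b}" for a b :: real
  proof -
    have "f integrable_on ({0..} \<inter> {a..b})"
    proof (cases "max 0 a \<le> b")
      case True
      then have "f integrable_on {max 0 a..b}"
        using Y[of "max 0 a" b] by (auto simp: integrable_on_def)
      moreover have "{0..} \<inter> {a..b} = {max 0 a..b}" by auto
      ultimately show ?thesis by simp
    next
      case False
      then have "{0..} \<inter> {a..b} = {}" by auto
      then show ?thesis by (metis integrable_on_empty)
    qed
    then show ?thesis
      unfolding f0_def integrable_restrict_Int by (simp add: Int_commute)
  qed
  \<comment> \<open>The differentiation theorem averages over intervals to the right of the point.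
    Applied to the reflected function it yields the left derivative.\<close>
  have int1: "(\<lambda>t. f0 (- t)) integrable_on {a..b}" for a b :: real
    using Henstock_Kurzweil_Integration.integrable_reflect_real[where f = f0 and a = "- b" and b = "- a"] int0 by simp
  obtain Z1 where Z1: "negligible Z1"
    "\<And>x e. x \<notin> Z1 \<Longrightarrow> 0 < e \<Longrightarrow> \<exists>d>0. \<forall>h. 0 < h \<and> h < d \<longrightarrow>
        norm (integral (cbox x (x + h *\<^sub>R One)) f0 /\<^sub>R h ^ DIM(real) - f0 x) < e"
    using integrable_ccontinuous_explicit[of f0] int0 by (metis box_real(2))
  obtain Z2 where Z2: "negligible Z2"
    "\<And>x e. x \<notin> Z2 \<Longrightarrow> 0 < e \<Longrightarrow> \<exists>d>0. \<forall>h. 0 < h \<and> h < d \<longrightarrow>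
        norm (integral (cbox x (x + h *\<^sub>R One)) (\<lambda>t. f0 (- t)) /\<^sub>R h ^ DIM(real) - f0 (- x)) < e"
    using integrable_ccontinuous_explicit[of "\<lambda>t. f0 (- t)"] int1 by (metis box_real(2))
  show ?thesis
  proof (rule that)
    show "negligible (Z1 \<union> uminus ` Z2)"
      using Z1(1) Z2(1)
      by (intro negligible_Un negligible_differentiable_image_negligible) (auto intro!: derivative_intros)
    fix x :: real
    assume x: "x \<notin> Z1 \<union> uminus ` Z2" and "0 < x"
    then have xs: "x \<notin> Z1" "- x \<notin> Z2" by (auto simp: image_iff)
    have f0x: "f0 x = f x" using \<open>0 < x\<close> by (simp add: f0_def)
    have diff: "integral {s..t} f0 = Y t - Y s" if "0 \<le> s" "s \<le> t" for s t
    proof (rule integral_unique, rule has_integral_spike[of "{}"])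
      show "(f has_integral (Y t - Y s)) {s..t}" using Y that by blast
    qed (use that in \<open>auto simp: f0_def\<close>)
    show "(Y has_vector_derivative f x) (at x)"
      unfolding has_vector_derivative_def has_derivative_at_alt
    proof (intro conjI allI impI)
      show "bounded_linear (\<lambda>h. h *\<^sub>R f x)" by (rule bounded_linear_scaleR_left)
      fix e :: real assume e: "0 < e"
      obtain d1 where d1: "d1 > 0" "\<And>h. 0 < h \<Longrightarrow> h < d1 \<Longrightarrow>
          norm (integral {x..x + h} f0 /\<^sub>R h - f0 x) < e"
        using Z1(2)[OF xs(1) e] by auto
      obtain d2 where d2: "d2 > 0" "\<And>h. 0 < h \<Longrightarrow> h < d2 \<Longrightarrow>
          norm (integral {- x..- x + h} (\<lambda>t. f0 (- t)) /\<^sub>R h - f0 x) < e"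
        using Z2(2)[OF xs(2) e] by auto
      have key: "norm (v - h *\<^sub>R w) \<le> e * h" if "norm (v /\<^sub>R h - w) < e" "0 < h" for v w :: 'b and h
      proof -
        have "v - h *\<^sub>R w = h *\<^sub>R (v /\<^sub>R h - w)" using that by (simp add: algebra_simps)
        then have "norm (v - h *\<^sub>R w) = h * norm (v /\<^sub>R h - w)" using that by simp
        also have "\<dots> \<le> h * e" using that by (intro mult_left_mono) auto
        finally show ?thesis by (simp add: mult.commute)
      qed
      show "\<exists>d>0. \<forall>z. norm (z - x) < d \<longrightarrow> norm (Y z - Y x - (z - x) *\<^sub>R f x) \<le> e * norm (z - x)"
      proof (intro exI conjI allI impI)
        show "min x (min d1 d2) > 0" using \<open>0 < x\<close> d1 d2 by simp
        fix z :: real assume z: "norm (z - x) < min x (min d1 d2)"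
        consider "z = x" | "x < z" | "z < x" by linarith
        then show "norm (Y z - Y x - (z - x) *\<^sub>R f x) \<le> e * norm (z - x)"
        proof cases
          case 2
          then show ?thesis
            using key[OF d1(2)[of "z - x"]] z diff[of x z] \<open>0 < x\<close> f0x by simp
        next
          case 3
          have eq: "integral {- x..- z} (\<lambda>t. f0 (- t)) = Y x - Y z"
            using diff[of z x] 3 z Henstock_Kurzweil_Integration.integral_reflect_real[where f = f0 and a = z and b = x] by simp
          have "norm (integral {- x..- x + (x - z)} (\<lambda>t. f0 (- t)) /\<^sub>R (x - z) - f0 x) < e"
            using 3 z by (intro d2(2)) auto
          then have "norm ((Y x - Y z) /\<^sub>R (x - z) - f x) < e" using eq f0x by simp
          then have "norm ((Y x - Y z) - (x - z) *\<^sub>R f x) \<le> e * (x - z)"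
            using 3 by (intro key) auto
          moreover have "Y z - Y x - (z - x) *\<^sub>R f x = - ((Y x - Y z) - (x - z) *\<^sub>R f x)"
            by (simp add: algebra_simps)
          ultimately show ?thesis using 3 by (simp only: norm_minus_cancel) simp
        qed simp
      qed
    qed
  qed
qed

text \<open>A basic open set isolating x meets \<open>Z\<close> in x alone, so the isolated points
  inject into a countable basis. In \<open>chain_rule\<close> this makes the isolated times on
  \<Gamma> negligible.\<close>

lemma countable_isolated_points:
  fixes Z :: "'b::second_countable_topology set"
  shows "countable {x \<in> Z. \<not> x islimpt Z}"
proof -
  define I where "I = {x \<in> Z. \<not> x islimpt Z}"
  obtain B :: "'b set set" where B: "countable B" "topological_basis B"
    using ex_countable_basis by blast
  have "\<exists>b\<in>B. b \<inter> Z = {x}" if x: "x \<in> Z" "\<not> x islimpt Z" for x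
  proof -
    obtain T where T: "x \<in> T" "open T" "\<And>z. z \<in> Z \<Longrightarrow> z \<in> T \<Longrightarrow> z = x"
      using x(2) unfolding islimpt_def by blast
    obtain b where "b \<in> B" "x \<in> b" "b \<subseteq> T" using B(2) T topological_basisE by blast
    then show ?thesis using T x(1) by blast
  qed
  then have "\<forall>x\<in>I. \<exists>b. b \<in> B \<and> b \<inter> Z = {x}" by (auto simp: I_def)
  from bchoice[OF this] obtain b where b: "\<And>x. x \<in> I \<Longrightarrow> b x \<in> B" "\<And>x. x \<in> I \<Longrightarrow> b x \<inter> Z = {x}"
    by auto
  have "inj_on b I"
  proof (rule inj_onI)
    fix u v assume "u \<in> I" "v \<in> I" "b u = b v"
    then have "{u} = {v}" using b(2) by metis
    then show "u = v" by simp
  qed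
  moreover have "countable (b ` I)" using b(1) by (intro countable_subset[OF _ B(1)]) auto
  ultimately show ?thesis unfolding I_def[symmetric] by (rule countable_image_inj_on[rotated])
qed

text \<open>The image of the interval is negligible: by Sard's theorem where the derivative vanishes, by the
  Lipschitz bound on the exceptional set. A negligible interval is a point.\<close>

lemma lipschitz_ae_zero_derivative_constant:
  fixes h :: "real \<Rightarrow> real"
  assumes lip: "L-lipschitz_on {a..b} h" and "negligible Z"
    and der: "\<And>x. x \<in> {a..b} - Z \<Longrightarrow> (h has_vector_derivative 0) (at x within {a..b})"
    and ab: "a \<le> b"
  shows "h b = h a"
proof (rule ccontr)
  assume neq: "h b \<noteq> h a"
  \<comment> \<open>\<open>baby_Sard\<close> speaks of maps between Cartesian spaces, so the
    function is transported to dimension one; the coordinate map, being Lipschitz, carries the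
    negligible image back to the reals.\<close>
  define h1 :: "real^1 \<Rightarrow> real^1" where "h1 x = vec (h (x $ 1))" for x
  have "negligible (h1 ` {x. x $ 1 \<in> {a..b} - Z})"
  proof (rule baby_Sard)
    fix x :: "real^1" assume "x \<in> {x. x $ 1 \<in> {a..b} - Z}"
    then have x: "x $ 1 \<in> {a..b} - Z" by simp
    have "(h has_derivative (\<lambda>t. 0)) (at (x $ 1) within {a..b})"
      using der[OF x] by (simp add: has_vector_derivative_def)
    then have "(h has_derivative (\<lambda>t. 0)) (at (x $ 1) within (\<lambda>x. x $ 1) ` {x. x $ 1 \<in> {a..b} - Z})"
      by (rule has_derivative_subset) auto
    moreover have "((\<lambda>x::real^1. x $ 1) has_derivative (\<lambda>x. x $ 1)) (at x within {x. x $ 1 \<in> {a..b} - Z})"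
      by (intro bounded_linear_imp_has_derivative bounded_linear_vec_nth)
    ultimately have 1: "((\<lambda>x. h (x $ 1)) has_derivative (\<lambda>t. 0)) (at x within {x. x $ 1 \<in> {a..b} - Z})"
      using has_derivative_in_compose[of "\<lambda>x. x $ 1" "\<lambda>x. x $ 1" x "{x. x $ 1 \<in> {a..b} - Z}" h "\<lambda>t. 0"] by simp
    have "bounded_linear (vec :: real \<Rightarrow> real^1)"
      by (intro linear_conv_bounded_linear[THEN iffD1] linearI) (auto simp: vec_eq_iff)
    from bounded_linear.has_derivative[OF this 1]
    show "(h1 has_derivative (\<lambda>t. 0)) (at x within {x. x $ 1 \<in> {a..b} - Z})"
      unfolding h1_def by (simp add: vec_eq_iff zero_vec_def vec_def)
    show "rank (matrix (\<lambda>t::real^1. 0::real^1)) < CARD(1)"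
      by (simp add: matrix_def rank_eq_0 zero_vec_def)
  qed simp
  then have "negligible ((\<lambda>x. x $ 1) ` h1 ` {x. x $ 1 \<in> {a..b} - Z})"
  proof (rule negligible_locally_Lipschitz_image[rotated])
    fix x assume "x \<in> h1 ` {x. x $ 1 \<in> {a..b} - Z}"
    have "norm (y $ 1 - x $ 1) \<le> 1 * norm (y - x)" for y :: "real^1"
      by (simp add: norm_vec_def L2_set_def)
    then show "\<exists>T B. open T \<and> x \<in> T \<and> (\<forall>y\<in>h1 ` {x. x $ 1 \<in> {a..b} - Z} \<inter> T. norm (y $ 1 - x $ 1) \<le> B * norm (y - x))"
      by blast
  qed simp
  moreover have "(\<lambda>x. x $ 1) ` h1 ` {x. x $ 1 \<in> {a..b} - Z} = h ` ({a..b} - Z)"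
  proof -
    have "h t \<in> (\<lambda>x. x $ 1) ` h1 ` {x. x $ 1 \<in> {a..b} - Z}" if "t \<in> {a..b} - Z" for t
      using that by (intro image_eqI[of _ _ "h1 (vec t)"] image_eqI[of _ _ "vec t"]) (auto simp: h1_def)
    then show ?thesis by (auto simp: h1_def)
  qed
  ultimately have 1: "negligible (h ` ({a..b} - Z))" by simp
  have "negligible (h ` ({a..b} \<inter> Z))"
  proof (rule negligible_locally_Lipschitz_image)
    show "negligible ({a..b} \<inter> Z)" using assms(2) by (simp add: negligible_Int)
    fix x assume "x \<in> {a..b} \<inter> Z"
    then show "\<exists>T B. open T \<and> x \<in> T \<and> (\<forall>y\<in>{a..b} \<inter> Z \<inter> T. norm (h y - h x) \<le> B * norm (y - x))"
      using lip by (intro exI[of _ UNIV] exI[of _ L]) (auto simp: lipschitz_on_def dist_norm)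
  qed simp
  with 1 have "negligible (h ` ({a..b} - Z) \<union> h ` ({a..b} \<inter> Z))" by (rule negligible_Un)
  moreover have "h ` ({a..b} - Z) \<union> h ` ({a..b} \<inter> Z) = h ` {a..b}" by blast
  ultimately have neg: "negligible (h ` {a..b})" by simp
  have "connected (h ` {a..b})"
    using lipschitz_on_continuous_on[OF lip] by (intro connected_continuous_image) auto
  then have "{min (h a) (h b)..max (h a) (h b)} \<subseteq> h ` {a..b}"
    using ab by (intro connected_contains_Icc) (auto simp: min_def max_def)
  then have "{min (h a) (h b)<..<max (h a) (h b)} \<subseteq> h ` {a..b}"
    by (rule subset_trans[rotated]) auto
  then have "negligible {min (h a) (h b)<..<max (h a) (h b)}"
    using neg negligible_subset by blast
  then show False
    using neq open_not_negligible[of "{min (h a) (h b)<..<max (h a) (h b)}"]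
    by (auto simp: not_less min_def max_def split: if_splits)
qed

text \<open>\<open>h\<close> and the indefinite integral of \<open>g\<close> are both Lipschitz and
  have the same derivative almost everywhere, so their difference is constant.\<close>

lemma lipschitz_ae_derivative_has_integral:
  fixes h g :: "real \<Rightarrow> real"
  assumes lip: "L-lipschitz_on {0..b} h" and "negligible Z"
    and der: "\<And>x. x \<in> {0..b} - Z \<Longrightarrow> (h has_vector_derivative g x) (at x within {0..b})"
    and b: "0 \<le> b"
    and int: "\<And>t. g integrable_on {0..t}" and bd: "\<And>t. t \<in> {0..b} \<Longrightarrow> \<bar>g t\<bar> \<le> K"
  shows "(g has_integral (h b - h 0)) {0..b}"
proof -
  define G where "G t = integral {0..t} g" for t
  have G: "(g has_integral (G t - G s)) {s..t}" if "0 \<le> s" "s \<le> t" for s t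
  proof -
    have "g integrable_on {s..t}" using int[of t] that by (auto intro: integrable_subinterval_real)
    moreover have "integral {0..s} g + integral {s..t} g = integral {0..t} g"
      using that int by (intro Henstock_Kurzweil_Integration.integral_combine)
    ultimately show ?thesis
      unfolding G_def by (metis add_diff_cancel_left' integrable_integral)
  qed
  obtain Z' where Z': "negligible Z'"
    "\<And>x. x \<notin> Z' \<Longrightarrow> 0 < x \<Longrightarrow> (G has_vector_derivative g x) (at x)"
    using ae_has_vector_derivative_of_integral[of g G] G by blast
  have K: "0 \<le> K" using bd[of 0] b by force
  have "K-lipschitz_on {0..b} G"
  proof (rule lipschitz_onI)
    show "0 \<le> K" by (rule K)
    have *: "dist (G t) (G s) \<le> K * dist t s" if "s \<in> {0..b}" "t \<in> {0..b}" "s \<le> t" for s t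
    proof -
      have "norm (G t - G s) \<le> K * measure lborel {s..t}"
        using G[of s t] that bd K by (intro has_integral_bound[of K g, unfolded box_real]) auto
      then show ?thesis using that by (simp add: dist_norm)
    qed
    fix s t assume "s \<in> {0..b}" "t \<in> {0..b}"
    then show "dist (G s) (G t) \<le> K * dist s t"
      using *[of s t] *[of t s] by (cases "s \<le> t") (auto simp: dist_commute)
  qed
  then have "(L + K)-lipschitz_on {0..b} (\<lambda>t. h t - G t)"
    by (intro lipschitz_on_diff lip)
  then have "h b - G b = h 0 - G 0"
  proof (rule lipschitz_ae_zero_derivative_constant)
    \<comment> \<open>0 is exceptional because the derivative of \<open>G\<close> is known at
      positive times only.\<close>
    show "negligible (insert 0 (Z \<union> Z'))" using assms(2) Z' by simp
    fix x assume x: "x \<in> {0..b} - insert 0 (Z \<union> Z')"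
    then have "(G has_vector_derivative g x) (at x within {0..b})"
      using Z'(2)[of x] by (auto intro: has_vector_derivative_at_within)
    then show "((\<lambda>t. h t - G t) has_vector_derivative 0) (at x within {0..b})"
      using has_vector_derivative_diff[OF der[of x]] x by fastforce
  qed fact
  then have "h b - h 0 = G b - G 0" by simp
  then show ?thesis using G[of 0 b] b by simp
qed

section \<open>Global solutions of bounded Lipschitz differential equations\<close>

lemma lipschitz_integral_of_bounded:
  fixes h :: "real \<Rightarrow> 'b::euclidean_space"
  assumes h: "continuous_on {0..} h" and bd: "\<And>t. norm (h t) \<le> K"
  shows "K-lipschitz_on UNIV (\<lambda>t. integral {0..max 0 t} h)"
proof (rule lipschitz_onI)
  show K: "0 \<le> K" using bd[of 0] norm_ge_zero order_trans by blast
  have int: "h integrable_on {s..t}" if "0 \<le> s" for s t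
    using that by (intro integrable_continuous_interval continuous_on_subset[OF h]) auto
  have *: "dist (integral {0..t} h) (integral {0..s} h) \<le> K * dist t s" if "0 \<le> s" "s \<le> t" for s t
  proof -
    have "integral {0..s} h + integral {s..t} h = integral {0..t} h"
      using that int by (intro Henstock_Kurzweil_Integration.integral_combine) auto
    moreover have "norm (integral {s..t} h) \<le> K * measure lborel {s..t}"
      using int that bd K by (intro has_integral_bound[of K h, unfolded box_real]) auto
    ultimately show ?thesis using that by (simp add: dist_norm) (metis add_diff_cancel_left')
  qed
  fix s t :: real
  have "dist (integral {0..max 0 s} h) (integral {0..max 0 t} h) \<le> K * dist (max 0 s) (max 0 t)"
    using *[of "max 0 s" "max 0 t"] *[of "max 0 t" "max 0 s"] by (cases "s \<le> t") (auto simp: dist_commute)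
  also have "\<dots> \<le> K * dist s t"
    using K by (intro mult_left_mono) (auto simp: dist_real_def)
  finally show "dist (integral {0..max 0 s} h) (integral {0..max 0 t} h) \<le> K * dist s t" .
qed

text \<open>With the unknown \<open>u t = exp (- 2 K t) (y t - x)\<close> the Picard operator is a contraction of the bounded
  continuous functions on the whole half-line, so no patching of local solutions is needed.\<close>

lemma bounded_lipschitz_ode_global_solution:
  fixes g :: "'b::euclidean_space \<Rightarrow> 'b"
  assumes lip: "L-lipschitz_on UNIV g" and bd: "\<And>z. norm (g z) \<le> M"
  obtains y :: "real \<Rightarrow> 'b" where "continuous_on {0..} y" "\<And>t. 0 \<le> t \<Longrightarrow> ((\<lambda>s. g (y s)) has_integral (y t - x)) {0..t}"
proof -
  \<comment> \<open>The weight exp (2 K s) has integral at most exp (2 K t) / (2 K) over {0..t}, so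
    a Lipschitz constant at most K gives the contraction factor 1/2. Adding 1 keeps K
    positive.\<close>
  define K where "K = L + 1"
  have L0: "0 \<le> L" using lip by (simp add: lipschitz_on_def)
  then have K: "0 < K" by (simp add: K_def)
  have M0: "0 \<le> M" using bd[of x] norm_ge_zero order_trans by blast
  have gc: "continuous_on UNIV g" using lip by (rule lipschitz_on_continuous_on)
  define H where "H u s = g (x + exp (2 * K * s) *\<^sub>R u s)" for u :: "real \<Rightarrow> 'b" and s
  \<comment> \<open>\<open>max 0 t\<close> makes the operator act on functions of the whole line,
    the domain of the complete space of bounded continuous functions; at negative times it returns
    zero.\<close>
  define T where "T u t = exp (- 2 * K * max 0 t) *\<^sub>R integral {0..max 0 t} (H u)" for u t
  have Hc: "continuous_on UNIV (H (apply_bcontfun u))" for u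
    unfolding H_def by (intro continuous_intros continuous_on_compose2[OF gc]) auto
  have Hi: "H (apply_bcontfun u) integrable_on {0..t}" for u t
    by (intro integrable_continuous_interval continuous_on_subset[OF Hc]) auto
  have Tc: "continuous_on UNIV (T (apply_bcontfun u))" for u
    unfolding T_def
    by (intro continuous_intros lipschitz_on_continuous_on[OF lipschitz_integral_of_bounded[of _ M]]
        continuous_on_subset[OF Hc]) (auto simp: H_def bd)
  have Tb: "norm (T (apply_bcontfun u) t) \<le> M / K" for u t
  proof -
    let ?t = "max 0 t"
    have "norm (integral {0..?t} (H (apply_bcontfun u))) \<le> M * measure lborel {0..?t}"
      using Hi bd M0 by (intro has_integral_bound[of M "H (apply_bcontfun u)", unfolded box_real])
        (auto simp: H_def)
    then have "norm (T (apply_bcontfun u) t) \<le> exp (- 2 * K * ?t) * (M * ?t)"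
      by (auto simp: T_def intro!: mult_left_mono)
    also have "\<dots> = M * (?t * exp (- (2 * K * ?t)))" by (simp add: algebra_simps)
    also have "\<dots> \<le> M * (1 / K)"
    proof (rule mult_left_mono[OF _ M0])
      have "K * ?t \<le> exp (2 * K * ?t)"
        using exp_ge_add_one_self[of "2 * K * ?t"] K mult_nonneg_nonneg[of K ?t] by linarith
      then show "?t * exp (- (2 * K * ?t)) \<le> 1 / K"
        using K by (simp add: exp_minus field_simps)
    qed
    finally show ?thesis by simp
  qed
  have Tbc: "T (apply_bcontfun u) \<in> bcontfun" for u
    using Tc Tb by (rule bcontfun_normI)
  define TT where "TT u = Bcontfun (T (apply_bcontfun u))" for u
  have TT: "apply_bcontfun (TT u) = T (apply_bcontfun u)" for u
    unfolding TT_def using Tbc by (simp add: Bcontfun_inverse)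
  have "dist (TT u) (TT w) \<le> (1/2) * dist u w" for u w :: "real \<Rightarrow>\<^sub>C 'b"
  proof (rule dist_bound)
    fix t :: real
    let ?t = "max 0 t"
    let ?d = "dist u w"
    have "norm (integral {0..?t} (\<lambda>s. H u s - H w s)) \<le> integral {0..?t} (\<lambda>s. K * ?d * exp (2 * K * s))"
    proof (rule integral_norm_bound_integral)
      show "(\<lambda>s. H u s - H w s) integrable_on {0..?t}" using Hi by (intro integrable_diff)
      show "(\<lambda>s. K * ?d * exp (2 * K * s)) integrable_on {0..?t}"
        by (intro integrable_continuous_interval continuous_intros)
      fix s
      have "norm (H u s - H w s) \<le> L * norm (exp (2 * K * s) *\<^sub>R u s - exp (2 * K * s) *\<^sub>R w s)"
        using lipschitz_onD[OF lip, of "x + exp (2 * K * s) *\<^sub>R u s" "x + exp (2 * K * s) *\<^sub>R w s"]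
        by (simp add: H_def dist_norm)
      also have "\<dots> = L * (exp (2 * K * s) * dist (u s) (w s))"
        by (simp add: dist_norm flip: scaleR_diff_right)
      also have "\<dots> \<le> K * (exp (2 * K * s) * ?d)"
        using L0 by (intro mult_mono dist_bounded) (auto simp: K_def)
      finally show "norm (H u s - H w s) \<le> K * ?d * exp (2 * K * s)" by (simp add: algebra_simps)
    qed
    also have "integral {0..?t} (\<lambda>s. K * ?d * exp (2 * K * s))
        = ?d / 2 * exp (2 * K * ?t) - ?d / 2 * exp (2 * K * 0)"
      using K by (intro integral_unique fundamental_theorem_of_calculus)
        (auto simp flip: has_real_derivative_iff_has_vector_derivative intro!: derivative_eq_intros)
    finally have "norm (integral {0..?t} (H u) - integral {0..?t} (H w)) \<le> ?d / 2 * exp (2 * K * ?t)"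
      using Hi zero_le_dist[of u w]
      by (subst (asm) Henstock_Kurzweil_Integration.integral_diff) (auto simp: algebra_simps simp del: zero_le_dist)
    then have "exp (- 2 * K * ?t) * norm (integral {0..?t} (H u) - integral {0..?t} (H w))
        \<le> exp (- 2 * K * ?t) * (?d / 2 * exp (2 * K * ?t))"
      by (intro mult_left_mono) auto
    also have "\<dots> = ?d / 2 * exp (- 2 * K * ?t + 2 * K * ?t)" by (simp only: exp_add mult_ac)
    finally show "dist (TT u t) (TT w t) \<le> (1/2) * ?d"
      by (simp add: TT T_def dist_norm flip: scaleR_diff_right)
  qed
  then have "\<exists>!u. TT u = u"
    by (intro banach_fix_type[where c = "1/2"]) auto
  then obtain u where u: "TT u = u" by auto
  define y where "y t = x + exp (2 * K * t) *\<^sub>R u t" for t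
  have yt: "y t = x + integral {0..t} (\<lambda>s. g (y s))" if "0 \<le> t" for t
  proof -
    have "u t = exp (- 2 * K * t) *\<^sub>R integral {0..t} (H u)"
      using fun_cong[OF TT[of u], of t] that by (simp add: T_def u)
    then have "exp (2 * K * t) *\<^sub>R u t = exp (2 * K * t + (- 2 * K * t)) *\<^sub>R integral {0..t} (H u)"
      by (simp only: scaleR_scaleR exp_add)
    then show ?thesis by (simp add: y_def H_def[abs_def])
  qed
  show ?thesis
  proof (rule that)
    show yc: "continuous_on {0..} y" unfolding y_def by (intro continuous_intros) auto
    fix t :: real assume "0 \<le> t"
    moreover have "(\<lambda>s. g (y s)) integrable_on {0..t}"
      using Hi[of u t] by (simp add: H_def[abs_def] y_def)
    ultimately show "((\<lambda>s. g (y s)) has_integral (y t - x)) {0..t}"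
      using yt by (simp add: has_integral_integral)
  qed
qed

section \<open>Comparison of derivatives and integrals, elementary inequalities, integrals over the
  half-line\<close>

lemma has_vector_derivative_zero_squeeze:
  fixes F :: "real \<Rightarrow> 'b::real_normed_vector" and g :: "real \<Rightarrow> 'c::real_normed_vector"
  assumes "(F has_vector_derivative 0) (at x within X)"
    and "\<And>r. r \<in> X \<Longrightarrow> norm (g r - g x) \<le> norm (F r - F x)"
  shows "(g has_vector_derivative 0) (at x within X)"
  unfolding has_vector_derivative_def has_derivative_within_alt
proof (intro conjI allI impI)
  fix \<epsilon> :: real assume "0 < \<epsilon>"
  then obtain d where d: "d > 0"
    "\<And>r. r \<in> X \<Longrightarrow> norm (r - x) < d \<Longrightarrow> norm (F r - F x) \<le> \<epsilon> * norm (r - x)"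
    using assms(1) unfolding has_vector_derivative_def has_derivative_within_alt by auto
  then show "\<exists>d>0. \<forall>r\<in>X. norm (r - x) < d \<longrightarrow> norm (g r - g x - (r - x) *\<^sub>R 0) \<le> \<epsilon> * norm (r - x)"
    using assms(2) by (intro exI[of _ d]) (fastforce intro: order_trans)
qed simp

lemma has_integral_le_negligible:
  fixes g h :: "real \<Rightarrow> real"
  assumes "(g has_integral I) X" "(h has_integral J) X" "negligible Z"
    and le: "\<And>s. s \<in> X - Z \<Longrightarrow> g s \<le> h s"
  shows "I \<le> J"
proof (rule has_integral_le)
  show "((\<lambda>s. if s \<in> Z then 0 else g s) has_integral I) X"
    by (rule has_integral_spike[OF assms(3) _ assms(1)]) auto
  show "((\<lambda>s. if s \<in> Z then 0 else h s) has_integral J) X"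
    by (rule has_integral_spike[OF assms(3) _ assms(2)]) auto
qed (use le in auto)

lemma exp_minus_bounds:
  fixes h :: real
  assumes "0 \<le> h" shows "1 - h \<le> exp (- h)" "exp (- h) \<le> 1 - h + h\<^sup>2"
proof -
  show "1 - h \<le> exp (- h)" using exp_ge_add_one_self[of "- h"] by simp
  have "exp (- h) \<le> 1 / (1 + h)"
    using exp_ge_add_one_self[of h] assms by (simp add: exp_minus field_simps)
  also have "\<dots> \<le> 1 - h + h\<^sup>2"
  proof -
    have "1 \<le> (1 - h + h\<^sup>2) * (1 + h)"
      using assms zero_le_power[OF assms, of 3] by (simp add: algebra_simps power2_eq_square power3_eq_cube)
    then show ?thesis using assms by (simp add: pos_divide_le_eq)
  qed
  finally show "exp (- h) \<le> 1 - h + h\<^sup>2" .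
qed

text \<open>The limit that ends both viscosity inequalities: dynamic programming over a time t
  bounds t X from below by a quadratic error, and t tends to 0 after division.\<close>

lemma nonneg_of_quadratic_lower_bound:
  fixes X C t0 :: real
  assumes "0 < t0" and "\<And>t. 0 < t \<Longrightarrow> t < t0 \<Longrightarrow> - C * t\<^sup>2 \<le> t * X"
  shows "0 \<le> X"
proof (rule ccontr)
  assume "\<not> 0 \<le> X"
  \<comment> \<open>The second entry makes (|C| + 1) t at most - X / 2, which contradicts - X \<le>
    C t.\<close>
  define t where "t = min (t0 / 2) (- X / (2 * (\<bar>C\<bar> + 1)))"
  have t: "0 < t" "t < t0" using assms(1) \<open>\<not> 0 \<le> X\<close> by (auto simp: t_def min_def field_simps)
  have "t * (- C * t) \<le> t * X" using assms(2)[OF t] by (simp add: power2_eq_square algebra_simps)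
  then have "- C * t \<le> X" by (simp only: mult_le_cancel_left_pos[OF t(1)])
  then have "- X \<le> C * t" by simp
  also have "\<dots> \<le> (\<bar>C\<bar> + 1) * t" using t by (intro mult_right_mono) auto
  also have "\<dots> \<le> (\<bar>C\<bar> + 1) * (- X / (2 * (\<bar>C\<bar> + 1)))" by (intro mult_left_mono) (auto simp: t_def)
  also have "\<dots> = - X / 2" by (simp add: field_simps)
  finally show False using \<open>\<not> 0 \<le> X\<close> by simp
qed

text \<open>Links the two integrals in use: the control problem is stated with Lebesgue measure,
  while velocities are handled by gauge integrals, whose exceptional sets are negligible
  sets.\<close>

lemma AE_lebesgue_on_iff:
  assumes "S \<in> sets lebesgue"
  shows "(AE s in lebesgue_on S. p s) \<longleftrightarrow> (\<exists>Z. negligible Z \<and> (\<forall>s\<in>S - Z. p s))"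
proof -
  have "(AE s in lebesgue_on S. p s) \<longleftrightarrow> (AE s in lebesgue. s \<in> S \<longrightarrow> p s)"
    using assms by (simp add: AE_restrict_space_iff)
  also have "\<dots> \<longleftrightarrow> (\<exists>Z. negligible Z \<and> (\<forall>s\<in>S - Z. p s))"
  proof
    assume "AE s in lebesgue. s \<in> S \<longrightarrow> p s"
    then obtain Z where "Z \<in> null_sets lebesgue" "{s. \<not> (s \<in> S \<longrightarrow> p s)} \<subseteq> Z"
      unfolding eventually_ae_filter by auto
    then show "\<exists>Z. negligible Z \<and> (\<forall>s\<in>S - Z. p s)"
      unfolding negligible_iff_null_sets by blast
  next
    assume "\<exists>Z. negligible Z \<and> (\<forall>s\<in>S - Z. p s)"
    then obtain Z where "negligible Z" "\<forall>s\<in>S - Z. p s" by blast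
    then show "AE s in lebesgue. s \<in> S \<longrightarrow> p s"
      by (intro AE_I'[of Z]) (auto simp: negligible_iff_null_sets)
  qed
  finally show ?thesis .
qed

lemma measurable_lebesgue_on_shift:
  fixes t :: real
  assumes "0 \<le> t" shows "(\<lambda>s. s + t) \<in> lebesgue_on {0..} \<rightarrow>\<^sub>M lebesgue_on {0..}"
proof (rule measurable_restrict_space3)
  have "(\<lambda>x. t + 1 * x) \<in> lebesgue \<rightarrow>\<^sub>M lebesgue"
    using lebesgue_affine_measurable[where c = "\<lambda>x::real. 1" and t = t] by simp
  then show "(\<lambda>s. s + t) \<in> lebesgue \<rightarrow>\<^sub>M lebesgue" by (simp add: add.commute)
qed (use assms in auto)

text \<open>This separates the running cost up to time t from the cost of the shifted trajectory.
  The tail stays a Lebesgue integral, as in \<open>cost\<close>, while the initial part becomes a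
  gauge integral, ready for pointwise comparison on the bounded interval.\<close>

lemma integral_ray_split:
  fixes h :: "real \<Rightarrow> real"
  assumes h: "integrable (lebesgue_on {0..}) h" and t: "0 \<le> t"
  shows "integrable (lebesgue_on {0..}) (\<lambda>s. h (s + t))"
    and "(LINT s|lebesgue_on {0..}. h s) = integral {0..t} h + (LINT s|lebesgue_on {0..}. h (s + t))"
proof -
  have i0: "integrable lebesgue (\<lambda>s. if s \<in> {0..} then h s else 0)"
    using h by (subst Lebesgue_Measure.integrable_restrict_UNIV) auto
  have ht: "integrable lebesgue (\<lambda>s. indicator {t..} s *\<^sub>R (if s \<in> {0..} then h s else 0))"
    using i0 by (intro integrable_mult_indicator) auto
  have eq: "(\<lambda>s. indicator {t..} s *\<^sub>R (if s \<in> {0..} then h s else 0)) = (\<lambda>s. if s \<in> {t..} then h s else 0)"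
    using t by (auto simp: indicator_def)
  note ht = ht[unfolded eq]
  have "integrable lebesgue (\<lambda>s. if t + 1 * s \<in> {t..} then h (t + 1 * s) else 0)"
    using ht lebesgue_integrable_real_affine_iff[of 1 "\<lambda>s. if s \<in> {t..} then h s else 0" t] by simp
  moreover have eq2: "(\<lambda>s. if t + 1 * s \<in> {t..} then h (t + 1 * s) else 0) = (\<lambda>s. if s \<in> {0..} then h (s + t) else 0)"
    by (auto simp: add.commute)
  ultimately have ih: "integrable lebesgue (\<lambda>s. if s \<in> {0..} then h (s + t) else 0)" by simp
  then show 1: "integrable (lebesgue_on {0..}) (\<lambda>s. h (s + t))"
    by (subst (asm) Lebesgue_Measure.integrable_restrict_UNIV) auto
  have iht: "integrable (lebesgue_on {t..}) h"
    using ht by (subst (asm) Lebesgue_Measure.integrable_restrict_UNIV) auto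
  have "(LINT s|lebesgue_on {t..}. h s) = (LINT s|lebesgue. (if s \<in> {t..} then h s else 0))"
    by (rule Lebesgue_Measure.integral_restrict_UNIV[symmetric]) simp
  also have "\<dots> = (LINT s|lebesgue. (if t + 1 * s \<in> {t..} then h (t + 1 * s) else 0))"
    using lebesgue_integral_real_affine[of 1 "\<lambda>s. if s \<in> {t..} then h s else 0" t] by simp
  also have "\<dots> = (LINT s|lebesgue_on {0..}. h (s + t))"
    unfolding eq2 by (rule Lebesgue_Measure.integral_restrict_UNIV) simp
  finally have tail: "(LINT s|lebesgue_on {t..}. h s) = (LINT s|lebesgue_on {0..}. h (s + t))" .
  have H0: "(h has_integral (LINT s|lebesgue_on {0..}. h s)) {0..}"
    using h by (rule has_integral_integral_lebesgue_on) simp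
  have Ht: "(h has_integral (LINT s|lebesgue_on {t..}. h s)) {t..}"
    using iht by (rule has_integral_integral_lebesgue_on) simp
  have "integrable lebesgue (\<lambda>s. indicator {0..t} s *\<^sub>R (if s \<in> {0..} then h s else 0))"
    using i0 by (intro integrable_mult_indicator) auto
  moreover have "(\<lambda>s. indicator {0..t} s *\<^sub>R (if s \<in> {0..} then h s else 0)) = (\<lambda>s. if s \<in> {0..t} then h s else 0)"
    by (auto simp: indicator_def)
  ultimately have "integrable (lebesgue_on {0..t}) h"
    using Lebesgue_Measure.integrable_restrict_UNIV[of "{0..t}" h] by simp
  then have "h integrable_on {0..t}" by (rule integrable_on_lebesgue_on) simp
  then have "(h has_integral integral {0..t} h) {0..t}" by (rule integrable_integral)
  then have "(h has_integral (integral {0..t} h + (LINT s|lebesgue_on {t..}. h s))) ({0..t} \<union> {t..})"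
    using Ht
  proof (rule has_integral_Un)
    have "{0..t} \<inter> {t..} = {t}" using t by auto
    then show "negligible ({0..t} \<inter> {t..})" by simp
  qed
  moreover have "{0..t} \<union> {t..} = {0..}" using t by auto
  ultimately have "(h has_integral (integral {0..t} h + (LINT s|lebesgue_on {t..}. h s))) {0..}" by simp
  from has_integral_unique[OF H0 this]
  show "(LINT s|lebesgue_on {0..}. h s) = integral {0..t} h + (LINT s|lebesgue_on {0..}. h (s + t))"
    unfolding tail .
qed

section \<open>Primitives of velocities\<close>

lemma has_integral_of_primitive:
  fixes g :: "real \<Rightarrow> 'b::euclidean_space"
  assumes "\<And>t. 0 \<le> t \<Longrightarrow> (g has_integral (y t - x)) {0..t}" and "0 \<le> s" "s \<le> t"
  shows "(g has_integral (y t - y s)) {s..t}"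
proof -
  have "g integrable_on {s..t}"
    using assms(1)[of t] assms(2,3) by (auto simp: integrable_on_def intro: integrable_subinterval_real[of g 0 t, unfolded integrable_on_def])
  then obtain I where I: "(g has_integral I) {s..t}" by (auto simp: integrable_on_def)
  then have "(g has_integral (y s - x + I)) {0..t}"
    using assms by (intro has_integral_combine[of 0 s t]) auto
  then have "y t - x = y s - x + I" using assms by (intro has_integral_unique[OF assms(1)]) auto
  then show ?thesis using I by (simp add: algebra_simps)
qed

lemma continuous_of_primitive:
  fixes g :: "real \<Rightarrow> 'b::euclidean_space"
  assumes "\<And>t. 0 \<le> t \<Longrightarrow> (g has_integral (y t - x)) {0..t}"
  shows "continuous_on {0..} y"
proof -
  have "continuous_on {0..b} y" for b
  proof (cases "0 \<le> b")
    case True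
    then have "continuous_on {0..b} (\<lambda>t. x + integral {0..t} g)"
      using assms[of b] by (intro continuous_intros indefinite_integral_continuous_1) (auto simp: integrable_on_def)
    moreover have "x + integral {0..t} g = y t" if "t \<in> {0..b}" for t
      using integral_unique[OF assms[of t]] that by simp
    ultimately show ?thesis by (rule continuous_on_eq)
  qed simp
  then have "continuous (at t within {0..}) y" if "0 \<le> t" for t
  proof -
    have "continuous (at t within {0..t+1}) y"
      using \<open>continuous_on {0..t+1} y\<close> that by (simp add: continuous_on_eq_continuous_within)
    moreover have "at t within {0..t+1} = at t within {0..}"
      by (rule at_within_nhd[of _ "{..<t+1}"]) auto
    ultimately show ?thesis by simp
  qed
  then show ?thesis by (simp add: continuous_on_eq_continuous_within)
qed

text \<open>The control space need not be second countable, so the Borel sets of the product need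
  not be generated by rectangles and measurability cannot be checked componentwise. With a constant
  control the pair is a continuous function of \<open>y t\<close>.\<close>

lemma measurable_continuous_pair:
  assumes "continuous_on T y" "T \<in> sets lebesgue"
  shows "(\<lambda>t::real. (y t :: 'b::euclidean_space, a :: 'a::topological_space)) \<in> borel_measurable (lebesgue_on T)"
  by (rule measurable_compose[OF continuous_imp_measurable_on_sets_lebesgue[OF assms]
        borel_measurable_continuous_onI]) (intro continuous_intros)

lemma has_integral_inner_const:
  "(g has_integral I) X \<Longrightarrow> ((\<lambda>s. g s \<bullet> c) has_integral (I \<bullet> c)) X"
  using has_integral_linear[OF _ bounded_linear_inner_left, of g I X c] by (simp add: o_def)

section \<open>Geometry\<close>

locale junction_geometry =
  fixes e :: "nat \<Rightarrow> pt" and N :: nat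
  assumes N_gt_1: "N > 1" and e_inj: "inj_on e {0..N}"
    and e_unit: "\<And>i. i \<in> {0..N} \<Longrightarrow> norm (e i) = 1"
    and e_orth: "\<And>i. i \<in> {1..N} \<Longrightarrow> e i \<bullet> e 0 = 0"
begin

abbreviation "P \<equiv> half_plane e"
abbreviation "\<Gamma> \<equiv> Gam e"
abbreviation "S \<equiv> junction e N"

lemma e0_sq [simp]: "e 0 \<bullet> e 0 = 1"
  using e_unit[of 0] by (simp add: dot_square_norm)

lemma ei_sq [simp]: "i \<in> {1..N} \<Longrightarrow> e i \<bullet> e i = 1"
  using e_unit[of i] by (simp add: dot_square_norm)

lemma e0_ei [simp]: "i \<in> {1..N} \<Longrightarrow> e 0 \<bullet> e i = 0" "i \<in> {1..N} \<Longrightarrow> e i \<bullet> e 0 = 0"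
  using e_orth[of i] by (simp_all add: inner_commute)

lemma norm_e0 [simp]: "norm (e 0) = 1"
  using e_unit[of 0] by simp

lemma norm_ei [simp]: "i \<in> {1..N} \<Longrightarrow> norm (e i) = 1"
  using e_unit by simp

lemma plane_iff: "i \<in> {1..N} \<Longrightarrow> z \<in> plane e i \<longleftrightarrow> z = (z \<bullet> e 0) *\<^sub>R e 0 + (z \<bullet> e i) *\<^sub>R e i"
proof
  assume i: "i \<in> {1..N}" and "z \<in> plane e i"
  then obtain a b where "z = a *\<^sub>R e 0 + b *\<^sub>R e i"
    unfolding plane_def span_breakdown_eq span_singleton by (auto simp: algebra_simps)
  then show "z = (z \<bullet> e 0) *\<^sub>R e 0 + (z \<bullet> e i) *\<^sub>R e i"
    using i by (simp add: inner_add_left)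
next
  assume "z = (z \<bullet> e 0) *\<^sub>R e 0 + (z \<bullet> e i) *\<^sub>R e i"
  moreover have "(z \<bullet> e 0) *\<^sub>R e 0 + (z \<bullet> e i) *\<^sub>R e i \<in> plane e i"
    unfolding plane_def by (intro span_add span_scale span_base) auto
  ultimately show "z \<in> plane e i" by simp
qed

lemma P_iff: "i \<in> {1..N} \<Longrightarrow> z \<in> P i \<longleftrightarrow> z \<in> plane e i \<and> 0 \<le> z \<bullet> e i"
  unfolding plane_iff half_plane_def by (auto simp: inner_add_left)

lemma P_plane: "i \<in> {1..N} \<Longrightarrow> z \<in> P i \<Longrightarrow> z \<in> plane e i"
  by (simp add: P_iff)

lemma G_iff: "z \<in> \<Gamma> \<longleftrightarrow> z = (z \<bullet> e 0) *\<^sub>R e 0"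
  unfolding Gam_def by auto

lemma G_sub_P: "i \<in> {1..N} \<Longrightarrow> z \<in> \<Gamma> \<Longrightarrow> z \<in> P i"
  unfolding Gam_def half_plane_def by force

lemma G_P_iff: "i \<in> {1..N} \<Longrightarrow> z \<in> P i \<Longrightarrow> z \<in> \<Gamma> \<longleftrightarrow> z \<bullet> e i = 0"
  unfolding P_iff plane_iff G_iff
  by (metis e0_ei(1) inner_scaleR_left mult_zero_right scaleR_zero_left add_0_right)

lemma G_sub_S: "z \<in> \<Gamma> \<Longrightarrow> z \<in> S"
  using G_sub_P N_gt_1 by (auto simp: junction_def intro!: bexI[of _ 1])

lemma P_sub_S: "i \<in> {1..N} \<Longrightarrow> z \<in> P i \<Longrightarrow> z \<in> S"
  by (auto simp: junction_def)

lemma S_cases: "z \<in> S \<Longrightarrow> \<exists>i\<in>{1..N}. z \<in> P i"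
  by (auto simp: junction_def)

lemma P_inter: "i \<in> {1..N} \<Longrightarrow> j \<in> {1..N} \<Longrightarrow> i \<noteq> j \<Longrightarrow> z \<in> P i \<Longrightarrow> z \<in> P j \<Longrightarrow> z \<in> \<Gamma>"
proof (rule ccontr)
  assume i: "i \<in> {1..N}" and j: "j \<in> {1..N}" and "i \<noteq> j" and zi: "z \<in> P i" and zj: "z \<in> P j" and "z \<notin> \<Gamma>"
  have pos: "z \<bullet> e i > 0" "z \<bullet> e j > 0"
    using G_P_iff[OF i zi] G_P_iff[OF j zj] \<open>z \<notin> \<Gamma>\<close> zi zj P_iff[OF i] P_iff[OF j] by force+
  have "(z \<bullet> e 0) *\<^sub>R e 0 + (z \<bullet> e i) *\<^sub>R e i = (z \<bullet> e 0) *\<^sub>R e 0 + (z \<bullet> e j) *\<^sub>R e j"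
    using zi zj i j P_iff plane_iff by metis
  then have eq: "(z \<bullet> e i) *\<^sub>R e i = (z \<bullet> e j) *\<^sub>R e j" by simp
  then have "norm ((z \<bullet> e i) *\<^sub>R e i) = norm ((z \<bullet> e j) *\<^sub>R e j)" by simp
  then have "z \<bullet> e i = z \<bullet> e j" using pos i j by simp
  then have "e i = e j" using eq pos by simp
  then show False using e_inj i j \<open>i \<noteq> j\<close> by (auto simp: inj_on_def)
qed

lemma P_iff_of_notin_G: "i \<in> {1..N} \<Longrightarrow> j \<in> {1..N} \<Longrightarrow> z \<in> P i \<Longrightarrow> z \<notin> \<Gamma> \<Longrightarrow> z \<in> P j \<longleftrightarrow> i = j"
  using P_inter by blast

lemma closed_P: "i \<in> {1..N} \<Longrightarrow> closed (P i)"
proof -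
  assume i: "i \<in> {1..N}"
  have "P i = span {e 0, e i} \<inter> {z. 0 \<le> z \<bullet> e i}"
    using P_iff[OF i] by (auto simp: plane_def)
  moreover have "closed {z. 0 \<le> z \<bullet> e i}" by (intro closed_Collect_le continuous_intros)
  ultimately show ?thesis by (simp add: closed_Int)
qed

lemma component_le: "i \<in> {1..N} \<Longrightarrow> \<bar>z \<bullet> e i\<bar> \<le> norm z"
  using Cauchy_Schwarz_ineq2[of z "e i"] by simp

lemma component0_le: "\<bar>z \<bullet> e 0\<bar> \<le> norm z"
  using Cauchy_Schwarz_ineq2[of z "e 0"] by simp

lemma inner_plane: "i \<in> {1..N} \<Longrightarrow> p \<in> plane e i \<Longrightarrow> q \<bullet> p = (q \<bullet> e 0) * (p \<bullet> e 0) + (q \<bullet> e i) * (p \<bullet> e i)"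
  by (subst (asm) plane_iff, assumption, erule ssubst[where P = "\<lambda>r. q \<bullet> r = _"]) (simp add: inner_add_right)

lemma plane_diff: "p \<in> plane e i \<Longrightarrow> q \<in> plane e i \<Longrightarrow> p - q \<in> plane e i"
  unfolding plane_def by (rule span_diff)

text \<open>The value zero off \<open>P i\<close> is essential: the vectors \<open>e i\<close> need
  not be orthogonal to one another, so \<open>z \<bullet> e i\<close> itself may be nonzero on the
  other half-planes.\<close>

definition coord :: "nat \<Rightarrow> pt \<Rightarrow> real" where
  "coord i z = (if z \<in> P i then z \<bullet> e i else 0)"

lemma coord_eq: "i \<in> {1..N} \<Longrightarrow> z \<in> P i \<Longrightarrow> coord i z = z \<bullet> e i"
  by (simp add: coord_def)

lemma coord_other: "i \<in> {1..N} \<Longrightarrow> j \<in> {1..N} \<Longrightarrow> i \<noteq> j \<Longrightarrow> z \<in> P i \<Longrightarrow> coord j z = 0"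
  using P_inter G_P_iff by (force simp: coord_def)

lemma coord_G: "i \<in> {1..N} \<Longrightarrow> z \<in> \<Gamma> \<Longrightarrow> coord i z = 0"
  by (auto simp: coord_def G_P_iff)

lemma coord_nonneg: "i \<in> {1..N} \<Longrightarrow> 0 \<le> coord i z"
  by (auto simp: coord_def P_iff)

text \<open>Distinct unit vectors satisfy 0 < |e i - e j|^2 = 2 (1 - e i \<bullet> e j), and there
  are finitely many pairs. The bound c \<le> 1 keeps the factor 1 - c nonnegative in
  \<open>coord_lipschitz\<close>.\<close>

lemma angle_gap: "\<exists>c. 0 < c \<and> c \<le> 1 \<and> (\<forall>i\<in>{1..N}. \<forall>j\<in>{1..N}. i \<noteq> j \<longrightarrow> e i \<bullet> e j \<le> 1 - c)"
proof -
  define R where "R = insert 1 ((\<lambda>(i, j). 1 - e i \<bullet> e j) ` ({1..N} \<times> {1..N} - Id))"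
  have fin: "finite R" unfolding R_def by (intro finite.insertI finite_imageI finite_Diff) auto
  have pos: "0 < r" if "r \<in> R" for r
  proof -
    have "0 < 1 - e i \<bullet> e j" if "i \<in> {1..N}" "j \<in> {1..N}" "i \<noteq> j" for i j
    proof -
      have "e i \<noteq> e j" using e_inj that by (auto simp: inj_on_def)
      then have "0 < (e i - e j) \<bullet> (e i - e j)" by simp
      also have "(e i - e j) \<bullet> (e i - e j) = 2 * (1 - e i \<bullet> e j)"
        using that by (simp add: inner_diff_left inner_diff_right inner_commute del: inner_gt_zero_iff)
      finally show ?thesis by simp
    qed
    then show ?thesis using that unfolding R_def by fastforce
  qed
  have "Min R \<in> R" using fin by (intro Min_in) (auto simp: R_def)
  then have "0 < Min R" by (rule pos)
  moreover have "Min R \<le> 1" using fin by (intro Min_le) (auto simp: R_def)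
  moreover have "e i \<bullet> e j \<le> 1 - Min R" if "i \<in> {1..N}" "j \<in> {1..N}" "i \<noteq> j" for i j
  proof -
    have "Min R \<le> 1 - e i \<bullet> e j" using fin that by (intro Min_le) (auto simp: R_def)
    then show ?thesis by simp
  qed
  ultimately show ?thesis by blast
qed

text \<open>The half-planes meet at angles bounded away from zero, so points of two different ones
  cannot be close unless both are close to \<Gamma>. With normal coordinates a and b the law of
  cosines gives |z - w|^2 \<ge> a^2 + b^2 - 2 a b (1 - c) \<ge> c a^2, whence the constant 1 / sqrt
  c.\<close>

lemma coord_lipschitz:
  "\<exists>K\<ge>1. \<forall>i\<in>{1..N}. \<forall>z\<in>S. \<forall>w\<in>S. \<bar>coord i z - coord i w\<bar> \<le> K * norm (z - w)"
proof -
  obtain c where c: "0 < c" "c \<le> 1" "\<And>i j. i \<in> {1..N} \<Longrightarrow> j \<in> {1..N} \<Longrightarrow> i \<noteq> j \<Longrightarrow> e i \<bullet> e j \<le> 1 - c"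
    using angle_gap by blast
  define K where "K = 1 / sqrt c"
  have K: "1 \<le> K" using c by (simp add: K_def real_sqrt_le_1_iff)
  have *: "coord i z - coord i w \<le> K * norm (z - w)" if i: "i \<in> {1..N}" and zw: "z \<in> S" "w \<in> S" for i z w
  proof (cases "z \<in> P i")
    case True
    note z = True
    have ge: "norm (z - w) \<le> K * norm (z - w)" using K by (simp add: mult_le_cancel_right1)
    obtain j where j: "j \<in> {1..N}" "w \<in> P j" using S_cases[OF zw(2)] by blast
    show ?thesis
    proof (cases "j = i")
      case True
      then have "coord i z - coord i w = (z - w) \<bullet> e i"
        using z j i by (simp add: coord_eq inner_diff_left)
      also have "\<dots> \<le> norm (z - w)" using component_le[OF i, of "z - w"] by linarith
      finally show ?thesis using ge by linarith
    next
      case False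
      define a b where "a = z \<bullet> e i" and "b = w \<bullet> e j"
      have nn: "0 \<le> a" "0 \<le> b" using z j i P_iff by (auto simp: a_def b_def)
      have zw: "z = (z \<bullet> e 0) *\<^sub>R e 0 + a *\<^sub>R e i" "w = (w \<bullet> e 0) *\<^sub>R e 0 + b *\<^sub>R e j"
        using z j i P_iff plane_iff unfolding a_def b_def by metis+
      define d where "d = z \<bullet> e 0 - w \<bullet> e 0"
      have "z - w = d *\<^sub>R e 0 + (a *\<^sub>R e i - b *\<^sub>R e j)"
        by (subst zw(1), subst zw(2)) (simp add: d_def algebra_simps)
      then have "(norm (z - w))\<^sup>2 = (d *\<^sub>R e 0 + (a *\<^sub>R e i - b *\<^sub>R e j)) \<bullet> (d *\<^sub>R e 0 + (a *\<^sub>R e i - b *\<^sub>R e j))"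
        by (simp only: power2_norm_eq_inner)
      also have "\<dots> = d\<^sup>2 + (a\<^sup>2 + b\<^sup>2 - 2 * (a * b) * (e i \<bullet> e j))"
        using e0_ei[OF i] e0_ei[OF j(1)] ei_sq[OF i] ei_sq[OF j(1)] by (simp add: inner_add_left inner_add_right inner_diff_left
            inner_diff_right power2_eq_square algebra_simps inner_commute del: ei_sq e0_ei)
      finally have "(norm (z - w))\<^sup>2 = d\<^sup>2 + (a\<^sup>2 + b\<^sup>2 - 2 * (a * b) * (e i \<bullet> e j))" .
      moreover have "(a * b) * (e i \<bullet> e j) \<le> (a * b) * (1 - c)"
        using nn c(3)[OF i j(1)] False by (intro mult_left_mono) auto
      then have "2 * (a * b) * (e i \<bullet> e j) \<le> (1 - c) * (2 * (a * b))" by (simp add: algebra_simps)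
      moreover have "(1 - c) * (2 * (a * b)) \<le> (1 - c) * (a\<^sup>2 + b\<^sup>2)"
        using c sum_squares_bound[of a b] by (intro mult_left_mono) auto
      moreover have "(1 - c) * (a\<^sup>2 + b\<^sup>2) = a\<^sup>2 + b\<^sup>2 - c * a\<^sup>2 - c * b\<^sup>2" by (simp add: algebra_simps)
      moreover have "0 \<le> c * b\<^sup>2" "0 \<le> d\<^sup>2" using c by auto
      ultimately have "c * a\<^sup>2 \<le> (norm (z - w))\<^sup>2" by linarith
      then have "sqrt (c * a\<^sup>2) \<le> norm (z - w)" by (simp add: real_le_lsqrt)
      then have "sqrt c * a \<le> norm (z - w)" using nn by (simp add: real_sqrt_mult)
      then have "a \<le> K * norm (z - w)" using c by (simp add: K_def field_simps)
      moreover have "coord i w = 0" using coord_other[OF j(1) i] False j by auto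
      ultimately show ?thesis using z i by (simp add: coord_eq a_def)
    qed
  next
    case False
    then have "coord i z - coord i w \<le> 0" using coord_nonneg[OF i, of w] by (simp add: coord_def[of i z])
    also have "0 \<le> K * norm (z - w)" using K by simp
    finally show ?thesis .
  qed
  show ?thesis
  proof (intro exI[of _ K] conjI ballI)
    show "1 \<le> K" by (rule K)
    fix i z w assume "i \<in> {1..N}" "z \<in> S" "w \<in> S"
    then show "\<bar>coord i z - coord i w\<bar> \<le> K * norm (z - w)"
      using *[of i z w] *[of i w z] by (simp add: norm_minus_commute abs_le_iff)
  qed
qed

text \<open>The retraction of the space onto a half-plane through which the dynamics are extended.\<close>

definition retract :: "nat \<Rightarrow> pt \<Rightarrow> pt" where
  "retract i z = (z \<bullet> e 0) *\<^sub>R e 0 + max 0 (z \<bullet> e i) *\<^sub>R e i"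

lemma retract_in_P: "retract i z \<in> P i"
  unfolding retract_def half_plane_def
  by (intro CollectI exI[of _ "z \<bullet> e 0"] exI[of _ "max 0 (z \<bullet> e i)"]) simp

lemma retract_id: "i \<in> {1..N} \<Longrightarrow> z \<in> P i \<Longrightarrow> retract i z = z"
  unfolding retract_def P_iff plane_iff by (auto simp: max_def)

lemma retract_in_G: "z \<bullet> e i \<le> 0 \<Longrightarrow> retract i z \<in> \<Gamma>"
  by (auto simp: retract_def Gam_def)

text \<open>The factor 2 comes from estimating the two components separately. It is the origin of
  the radius \<open>2 * M * T\<close> in the lemmas on extended flows.\<close>

lemma retract_lipschitz: "i \<in> {1..N} \<Longrightarrow> norm (retract i z - retract i w) \<le> 2 * norm (z - w)"
proof -
  assume i: "i \<in> {1..N}"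
  have "retract i z - retract i w
      = ((z - w) \<bullet> e 0) *\<^sub>R e 0 + (max 0 (z \<bullet> e i) - max 0 (w \<bullet> e i)) *\<^sub>R e i"
    by (simp add: retract_def algebra_simps inner_diff_left)
  also have "norm \<dots> \<le> \<bar>(z - w) \<bullet> e 0\<bar> + \<bar>max 0 (z \<bullet> e i) - max 0 (w \<bullet> e i)\<bar>"
    using i by (intro order_trans[OF norm_triangle_ineq]) simp
  also have "\<bar>max 0 (z \<bullet> e i) - max 0 (w \<bullet> e i)\<bar> \<le> \<bar>(z - w) \<bullet> e i\<bar>"
    by (simp add: inner_diff_left)
  finally show ?thesis using component_le[OF i, of "z - w"] component0_le[of "z - w"] by linarith
qed

end

section \<open>Controls and trajectories\<close>

text \<open>The existential constants of the assumptions become parameters common to all branches,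
  and the modulus of continuity of the running costs is replaced by its consequence
  \<open>l_unif\<close>, in the form in which it is applied.\<close>

locale junction_control = junction_geometry e N
  for e :: "nat \<Rightarrow> pt" and N :: nat +
  fixes A :: "nat \<Rightarrow> 'a::metric_space set" and f :: "nat \<Rightarrow> pt \<Rightarrow> 'a \<Rightarrow> pt"
    and l :: "nat \<Rightarrow> pt \<Rightarrow> 'a \<Rightarrow> real" and lam M B Lf \<delta> :: real
  assumes lam: "0 < lam"
    and A_ne: "\<And>i. i \<in> {1..N} \<Longrightarrow> A i \<noteq> {}"
    and A_compact: "\<And>i. i \<in> {1..N} \<Longrightarrow> compact (A i)"
    and A_disj: "\<And>i j. i \<in> {1..N} \<Longrightarrow> j \<in> {1..N} \<Longrightarrow> i \<noteq> j \<Longrightarrow> A i \<inter> A j = {}"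
    and f_plane: "\<And>i x a. i \<in> {1..N} \<Longrightarrow> x \<in> P i \<Longrightarrow> a \<in> A i \<Longrightarrow> f i x a \<in> plane e i"
    and f_cont: "\<And>i. i \<in> {1..N} \<Longrightarrow> continuous_on (P i \<times> A i) (\<lambda>(x, a). f i x a)"
    and f_bound: "\<And>i x a. i \<in> {1..N} \<Longrightarrow> x \<in> P i \<Longrightarrow> a \<in> A i \<Longrightarrow> norm (f i x a) \<le> M"
    and f_lip: "\<And>i x y a. i \<in> {1..N} \<Longrightarrow> x \<in> P i \<Longrightarrow> y \<in> P i \<Longrightarrow> a \<in> A i \<Longrightarrow>
        norm (f i x a - f i y a) \<le> Lf * norm (x - y)"
    and l_cont: "\<And>i. i \<in> {1..N} \<Longrightarrow> continuous_on (P i \<times> A i) (\<lambda>(x, a). l i x a)"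
    and l_bound: "\<And>i x a. i \<in> {1..N} \<Longrightarrow> x \<in> P i \<Longrightarrow> a \<in> A i \<Longrightarrow> \<bar>l i x a\<bar> \<le> B"
    and l_unif: "\<And>\<epsilon>. 0 < \<epsilon> \<Longrightarrow> \<exists>d>0. \<forall>i\<in>{1..N}. \<forall>x\<in>P i. \<forall>y\<in>P i. \<forall>a\<in>A i.
        norm (x - y) < d \<longrightarrow> \<bar>l i x a - l i y a\<bar> \<le> \<epsilon>"
    and FL_convex: "\<And>i x. i \<in> {1..N} \<Longrightarrow> x \<in> P i \<Longrightarrow> convex (FL A f l i x)"
    and normal_ctrl: "\<And>i x r. i \<in> {1..N} \<Longrightarrow> x \<in> \<Gamma> \<Longrightarrow> \<bar>r\<bar> \<le> \<delta> \<Longrightarrow> \<exists>a\<in>A i. f i x a \<bullet> e i = r"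
    and M_pos: "0 < M" and B_pos: "0 < B" and Lf_pos: "0 < Lf" and \<delta>_pos: "0 < \<delta>"
begin

abbreviation "G g \<equiv> glue e N A g"
abbreviation "Ctrl \<equiv> ctrl_set e N A"
abbreviation "Traj \<equiv> trajectories e N A f"
abbreviation "Cost \<equiv> cost e N A l lam"

text \<open>Removes the distinction between \<Gamma> and the open half-planes: a point of \<Gamma>
  lies in every \<open>P i\<close>, so there the control alone selects the index.\<close>

lemma ctrl_set_iff: "(x, a) \<in> Ctrl \<longleftrightarrow> (\<exists>i\<in>{1..N}. x \<in> P i \<and> a \<in> A i)"
proof
  assume "(x, a) \<in> Ctrl"
  then have *: "x \<in> S" "\<And>i. i \<in> {1..N} \<Longrightarrow> x \<in> P i \<Longrightarrow> x \<notin> \<Gamma> \<Longrightarrow> a \<in> A i"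
    "x \<in> \<Gamma> \<Longrightarrow> \<exists>i\<in>{1..N}. a \<in> A i"
    unfolding ctrl_set_def by auto
  show "\<exists>i\<in>{1..N}. x \<in> P i \<and> a \<in> A i"
    using * S_cases[of x] G_sub_P[of _ x] by (cases "x \<in> \<Gamma>") blast+
next
  assume "\<exists>i\<in>{1..N}. x \<in> P i \<and> a \<in> A i"
  then obtain i where i: "i \<in> {1..N}" "x \<in> P i" "a \<in> A i" by blast
  have "a \<in> A j" if "j \<in> {1..N}" "x \<in> P j - \<Gamma>" for j
    using P_iff_of_notin_G[OF that(1) i(1)] that(2) i by blast
  moreover have "x \<in> S" using i(1,2) by (rule P_sub_S)
  ultimately show "(x, a) \<in> Ctrl"
    unfolding ctrl_set_def using i by blast
qed

lemma glue_eq: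
  assumes i: "i \<in> {1..N}" "x \<in> P i" "a \<in> A i"
  shows "G g x a = g i x a"
proof -
  have "(THE i. i \<in> {1..N} \<and> (x \<in> P i - \<Gamma> \<or> x \<in> \<Gamma> \<and> a \<in> A i)) = i"
  proof (rule the_equality)
    show "i \<in> {1..N} \<and> (x \<in> P i - \<Gamma> \<or> x \<in> \<Gamma> \<and> a \<in> A i)" using i by blast
    fix j assume "j \<in> {1..N} \<and> (x \<in> P j - \<Gamma> \<or> x \<in> \<Gamma> \<and> a \<in> A j)"
    then show "j = i" using i P_iff_of_notin_G[of i j x] A_disj[of i j] by blast
  qed
  then show ?thesis by (simp add: glue_def)
qed

lemma glue_f_bound: "(x, a) \<in> Ctrl \<Longrightarrow> norm (G f x a) \<le> M"
  using ctrl_set_iff glue_eq f_bound by metis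

lemma glue_l_bound: "(x, a) \<in> Ctrl \<Longrightarrow> \<bar>G l x a\<bar> \<le> B"
  using ctrl_set_iff glue_eq[where g = l] l_bound by metis

text \<open>On \<open>Ctrl\<close> the glued function is a finite sum of continuous functions on the
  closed sets \<open>P i \<times> A i\<close>, each extended by zero. These sets are disjoint
  because the \<open>A i\<close> are, even though the \<open>P i\<close> overlap on \<Gamma>. The
  times in \<open>Z\<close> are absorbed by the completeness of Lebesgue measure.\<close>

lemma glue_measurable:
  fixes g :: "nat \<Rightarrow> pt \<Rightarrow> 'a \<Rightarrow> 'b::euclidean_space" and y :: "real \<Rightarrow> pt"
  assumes g: "\<And>i. i \<in> {1..N} \<Longrightarrow> continuous_on (P i \<times> A i) (\<lambda>(x, a). g i x a)"
    and meas: "(\<lambda>t. (y t, \<alpha> t)) \<in> borel_measurable (lebesgue_on {0..})"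
    and Z: "negligible Z" "\<And>t. t \<in> {0..} - Z \<Longrightarrow> (y t, \<alpha> t) \<in> Ctrl"
  shows "(\<lambda>t. G g (y t) (\<alpha> t)) \<in> borel_measurable (lebesgue_on {0..})"
proof -
  define u where "u z = (\<Sum>i\<in>{1..N}. if z \<in> P i \<times> A i then (\<lambda>(x, a). g i x a) z else 0)" for z
  have ray: "{0::real..} \<in> sets lebesgue" by simp
  have "u \<in> borel_measurable borel"
    unfolding u_def
    by (intro borel_measurable_sum borel_measurable_continuous_on_if g borel_closed closed_Times
        closed_P compact_imp_closed A_compact continuous_on_const)
  then have "(\<lambda>t. u (y t, \<alpha> t)) \<in> borel_measurable (lebesgue_on {0..})"
    by (rule measurable_compose[OF meas])
  then have "(\<lambda>t. if t \<in> {0..} then u (y t, \<alpha> t) else 0) \<in> borel_measurable lebesgue"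
    by (rule borel_measurable_if_I[OF _ ray])
  moreover have "AE t in lebesgue. (if t \<in> {0..} then u (y t, \<alpha> t) else 0) = (if t \<in> {0..} then G g (y t) (\<alpha> t) else 0)"
  proof -
    have "u z = G g (fst z) (snd z)" if z: "z \<in> Ctrl" for z
    proof -
      obtain i where i: "i \<in> {1..N}" "fst z \<in> P i" "snd z \<in> A i"
        using z ctrl_set_iff[of "fst z" "snd z"] unfolding prod.collapse by blast
      have "u z = (\<Sum>j\<in>{1..N}. if j = i then g i (fst z) (snd z) else 0)"
        unfolding u_def using i A_disj[of i] by (intro sum.cong) (auto simp: case_prod_unfold mem_Times_iff)
      also have "\<dots> = g i (fst z) (snd z)" using i by simp
      finally show ?thesis using glue_eq[OF i, of g] by simp
    qed
    then have "u (y t, \<alpha> t) = G g (y t) (\<alpha> t)" if "t \<in> {0..} - Z" for t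
      using Z(2)[OF that] by fastforce
    then show ?thesis
      using Z(1) by (intro AE_I'[of Z]) (auto simp: negligible_iff_null_sets)
  qed
  ultimately have "(\<lambda>t. if t \<in> {0..} then G g (y t) (\<alpha> t) else 0) \<in> borel_measurable lebesgue"
    by (rule borel_measurable_AE)
  then show ?thesis by (rule borel_measurable_if_D)
qed


text \<open>\<open>Linf_loc\<close> with an explicit null set and without its local bound. For
  solutions of the dynamics that bound follows from the speed limit \<open>M\<close> and the
  compactness of the control sets, see \<open>trajectoriesI\<close>.\<close>

definition admissible :: "(real \<Rightarrow> pt) \<Rightarrow> (real \<Rightarrow> 'a) \<Rightarrow> bool" where
  "admissible y \<alpha> \<longleftrightarrow> (\<lambda>t. (y t, \<alpha> t)) \<in> borel_measurable (lebesgue_on {0..}) \<and>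
     (\<exists>Z. negligible Z \<and> (\<forall>t\<in>{0..} - Z. (y t, \<alpha> t) \<in> Ctrl))"

abbreviation "V y \<alpha> \<equiv> (\<lambda>s. G f (y s) (\<alpha> s))"

lemma glue_integrable:
  fixes g :: "nat \<Rightarrow> pt \<Rightarrow> 'a \<Rightarrow> 'b::euclidean_space"
  assumes g: "\<And>i. i \<in> {1..N} \<Longrightarrow> continuous_on (P i \<times> A i) (\<lambda>(x, a). g i x a)"
    and K: "\<And>i x a. i \<in> {1..N} \<Longrightarrow> x \<in> P i \<Longrightarrow> a \<in> A i \<Longrightarrow> norm (g i x a) \<le> K"
    and adm: "admissible y \<alpha>"
  shows "integrable (lebesgue_on {0..t}) (\<lambda>s. G g (y s) (\<alpha> s))"
proof -
  obtain Z where Z: "negligible Z" "\<And>t. t \<in> {0..} - Z \<Longrightarrow> (y t, \<alpha> t) \<in> Ctrl"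
    and m: "(\<lambda>t. (y t, \<alpha> t)) \<in> borel_measurable (lebesgue_on {0..})"
    using adm unfolding admissible_def by blast
  interpret finite_measure "lebesgue_on {0..t}"
    by (intro finite_measure_lebesgue_on) auto
  show ?thesis
  proof (rule integrable_const_bound)
    show "(\<lambda>s. G g (y s) (\<alpha> s)) \<in> borel_measurable (lebesgue_on {0..t})"
      by (rule measurable_restrict_mono[OF glue_measurable[OF g m Z]]) auto
    have "norm (G g (y s) (\<alpha> s)) \<le> K" if s: "s \<in> {0..} - Z" for s
    proof -
      obtain i where "i \<in> {1..N}" "y s \<in> P i" "\<alpha> s \<in> A i" using Z(2)[OF s] unfolding ctrl_set_iff by blast
      then show ?thesis using K glue_eq[of i "y s" "\<alpha> s" g] by simp
    qed
    then show "AE s in lebesgue_on {0..t}. norm (G g (y s) (\<alpha> s)) \<le> K"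
      using Z by (subst AE_lebesgue_on_iff) (auto intro!: exI[of _ Z])
  qed
qed

lemma admissible_integrable:
  assumes "admissible y \<alpha>"
  shows "integrable (lebesgue_on {0..t}) (V y \<alpha>)"
  using f_cont f_bound assms by (rule glue_integrable)

lemma admissible_cost_integrable:
  assumes "admissible y \<alpha>"
  shows "integrable (lebesgue_on {0..}) (\<lambda>t. G l (y t) (\<alpha> t) * exp (- lam * t))"
    and "\<bar>Cost (y, \<alpha>)\<bar> \<le> B / lam"
proof -
  obtain Z where Z: "negligible Z" "\<And>t. t \<in> {0..} - Z \<Longrightarrow> (y t, \<alpha> t) \<in> Ctrl"
    and m: "(\<lambda>t. (y t, \<alpha> t)) \<in> borel_measurable (lebesgue_on {0..})"
    using assms unfolding admissible_def by blast
  have hi: "((\<lambda>t. exp (- lam * t)) has_integral exp (- lam * 0) / lam) {0..}"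
    using lam by (rule has_integral_exp_minus_to_infinity)
  then have "(\<lambda>t. exp (- lam * t)) absolutely_integrable_on {0..}"
    by (intro nonnegative_absolutely_integrable_1) (auto simp: integrable_on_def)
  then have ei: "integrable (lebesgue_on {0..}) (\<lambda>t. exp (- lam * t))"
    by (rule absolutely_integrable_imp_integrable) simp
  have ev: "(LINT t|lebesgue_on {0..}. exp (- lam * t)) = 1 / lam"
    using lebesgue_integral_eq_integral[OF ei] integral_unique[OF hi] by simp
  have bd: "AE t in lebesgue_on {0..}. norm (G l (y t) (\<alpha> t) * exp (- lam * t)) \<le> B * exp (- lam * t)"
    using Z glue_l_bound
    by (subst AE_lebesgue_on_iff) (auto intro!: exI[of _ Z] mult_right_mono simp: abs_mult)
  have meas: "(\<lambda>t. G l (y t) (\<alpha> t) * exp (- lam * t)) \<in> borel_measurable (lebesgue_on {0..})"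
    by (intro borel_measurable_times glue_measurable[OF l_cont m Z] borel_measurable_integrable[OF ei])
  show i: "integrable (lebesgue_on {0..}) (\<lambda>t. G l (y t) (\<alpha> t) * exp (- lam * t))"
  proof (rule Bochner_Integration.integrable_bound[OF _ meas])
    show "integrable (lebesgue_on {0..}) (\<lambda>t. B * exp (- lam * t))" using ei by simp
    show "AE t in lebesgue_on {0..}. norm (G l (y t) (\<alpha> t) * exp (- lam * t)) \<le> norm (B * exp (- lam * t))"
      using bd B_pos by (auto elim!: eventually_mono)
  qed
  have "norm (LINT t|lebesgue_on {0..}. G l (y t) (\<alpha> t) * exp (- lam * t)) \<le> (LINT t|lebesgue_on {0..}. B * exp (- lam * t))"
    using i ei bd by (intro Bochner_Integration.integral_norm_bound[THEN order_trans] integral_mono_AE) auto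
  also have "\<dots> = B / lam" using ev by simp
  finally show "\<bar>Cost (y, \<alpha>)\<bar> \<le> B / lam" by (simp add: cost_def)
qed

lemma admissible_increment_bound:
  assumes "admissible y \<alpha>" and s: "0 \<le> s" "s \<le> t" and I: "(V y \<alpha> has_integral I) {s..t}"
  shows "norm I \<le> M * (t - s)"
proof -
  obtain Z where Z: "negligible Z" "\<And>t. t \<in> {0..} - Z \<Longrightarrow> (y t, \<alpha> t) \<in> Ctrl"
    using assms unfolding admissible_def by blast
  have "((\<lambda>r. if r \<in> Z then 0 else V y \<alpha> r) has_integral I) {s..t}"
    using I by (rule has_integral_spike[OF Z(1), rotated]) auto
  then have "norm I \<le> M * measure lborel {s..t}"
    using Z(2) glue_f_bound M_pos s by (intro has_integral_bound[of M "\<lambda>r. if r \<in> Z then 0 else V y \<alpha> r", unfolded box_real]) auto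
  then show ?thesis using s by simp
qed

lemma trajectory_lipschitz:
  assumes "admissible y \<alpha>" and "\<And>t. 0 \<le> t \<Longrightarrow> (V y \<alpha> has_integral (y t - x)) {0..t}"
  shows "M-lipschitz_on {0..} y"
proof (rule lipschitz_onI)
  have *: "dist (y t) (y s) \<le> M * dist t s" if "0 \<le> s" "s \<le> t" for s t
    using admissible_increment_bound[OF assms(1) that has_integral_of_primitive[OF assms(2) that]] that
    by (simp add: dist_norm)
  fix s t :: real assume "s \<in> {0..}" "t \<in> {0..}"
  then show "dist (y s) (y t) \<le> M * dist s t"
    using *[of s t] *[of t s] by (cases "s \<le> t") (auto simp: dist_commute)
qed (use M_pos in simp)

lemma trajectoriesI:
  assumes adm: "admissible y \<alpha>" and S: "\<And>t. 0 \<le> t \<Longrightarrow> y t \<in> S"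
    and int: "\<And>t. 0 \<le> t \<Longrightarrow> (V y \<alpha> has_integral (y t - x)) {0..t}"
  shows "(y, \<alpha>) \<in> Traj x"
proof -
  obtain Z where Z: "negligible Z" "\<And>t. t \<in> {0..} - Z \<Longrightarrow> (y t, \<alpha> t) \<in> Ctrl"
    and m: "(\<lambda>t. (y t, \<alpha> t)) \<in> borel_measurable (lebesgue_on {0..})"
    using adm unfolding admissible_def by blast
  have lip: "M-lipschitz_on {0..} y" using adm int by (rule trajectory_lipschitz)
  have "bounded (\<Union>i\<in>{1..N}. A i)"
    by (intro bounded_UN ballI compact_imp_bounded[OF A_compact]) simp_all
  then obtain a0 R where R: "\<And>a i. i \<in> {1..N} \<Longrightarrow> a \<in> A i \<Longrightarrow> dist a0 a \<le> R"
    unfolding bounded_def by blast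
  have dist': "dist (y 0, a0) (y t, \<alpha> t) \<le> M * T + R" if t: "t \<in> {0..T} - Z" for t T
  proof -
    have "dist (y 0) (y t) \<le> M * dist 0 t" using t by (intro lipschitz_onD[OF lip]) auto
    also have "\<dots> \<le> M * T" using t M_pos by (intro mult_left_mono) auto
    finally have "dist (y 0) (y t) \<le> M * T" .
    moreover obtain i where "i \<in> {1..N}" "\<alpha> t \<in> A i"
      using Z(2)[of t] t unfolding ctrl_set_iff by auto
    then have "dist a0 (\<alpha> t) \<le> R" by (rule R)
    ultimately show ?thesis
      using sqrt_sum_squares_le_sum[of "dist (y 0) (y t)" "dist a0 (\<alpha> t)"] by (simp add: dist_Pair_Pair)
  qed
  have bd: "\<exists>c r. AE t in lebesgue_on {0..T}. dist c (y t, \<alpha> t) \<le> r" for T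
  proof (intro exI)
    show "AE t in lebesgue_on {0..T}. dist (y 0, a0) (y t, \<alpha> t) \<le> M * T + R"
      using Z(1) dist' by (subst AE_lebesgue_on_iff) auto
  qed
  have "AE t in lebesgue_on {0..}. (y t, \<alpha> t) \<in> Ctrl"
    using Z by (subst AE_lebesgue_on_iff) auto
  then have "Linf_loc (Ctrl) (\<lambda>t. (y t, \<alpha> t))"
    unfolding Linf_loc_def using m bd by blast
  moreover have "y t = x + (LINT s|lebesgue_on {0..t}. V y \<alpha> s)" if "0 \<le> t" for t
    using lebesgue_integral_eq_integral[OF admissible_integrable[OF adm, of t]] integral_unique[OF int[OF that]]
    by simp
  ultimately show ?thesis
    unfolding trajectories_def using S lip by auto
qed

lemma trajectoriesD:
  assumes "(y, \<alpha>) \<in> Traj x"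
  shows "admissible y \<alpha>" and "\<And>t. 0 \<le> t \<Longrightarrow> y t \<in> S" and "y 0 = x"
    and "\<And>t. 0 \<le> t \<Longrightarrow> (V y \<alpha> has_integral (y t - x)) {0..t}"
proof -
  have L: "Linf_loc (Ctrl) (\<lambda>t. (y t, \<alpha> t))"
    and eq: "\<And>t. 0 \<le> t \<Longrightarrow> y t = x + (LINT s|lebesgue_on {0..t}. V y \<alpha> s)"
    using assms unfolding trajectories_def by auto
  show "\<And>t. 0 \<le> t \<Longrightarrow> y t \<in> S" using assms unfolding trajectories_def by auto
  have "AE t in lebesgue_on {0..}. (y t, \<alpha> t) \<in> Ctrl" using L by (simp add: Linf_loc_def)
  then show adm: "admissible y \<alpha>"
    using L unfolding admissible_def Linf_loc_def by (subst (asm) AE_lebesgue_on_iff) auto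
  show int: "(V y \<alpha> has_integral (y t - x)) {0..t}" if "0 \<le> t" for t
    using has_integral_integral_lebesgue_on[OF admissible_integrable[OF adm, of t]] eq[OF that] by simp
  have "(V y \<alpha> has_integral 0) {0..0}" using has_integral_refl(2)[of "V y \<alpha>" 0] by simp
  from has_integral_unique[OF int[OF order_refl] this] show "y 0 = x" by simp
qed

text \<open>Half of dynamic programming: the tail of a trajectory competes for the value at
  \<open>y t\<close>.\<close>

lemma trajectory_shift:
  assumes "(y, \<alpha>) \<in> Traj x" and t: "0 \<le> t"
  shows "(\<lambda>s. y (s + t), \<lambda>s. \<alpha> (s + t)) \<in> Traj (y t)"
proof (rule trajectoriesI)
  note D = trajectoriesD[OF assms(1)]
  obtain Z where Z: "negligible Z" "\<And>t. t \<in> {0..} - Z \<Longrightarrow> (y t, \<alpha> t) \<in> Ctrl"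
    and m: "(\<lambda>t. (y t, \<alpha> t)) \<in> borel_measurable (lebesgue_on {0..})"
    using D(1) unfolding admissible_def by blast
  show "admissible (\<lambda>s. y (s + t)) (\<lambda>s. \<alpha> (s + t))"
    unfolding admissible_def
  proof (intro conjI exI[of _ "(\<lambda>s. s - t) ` Z"] ballI)
    show "(\<lambda>s. (y (s + t), \<alpha> (s + t))) \<in> borel_measurable (lebesgue_on {0..})"
      using measurable_compose[OF measurable_lebesgue_on_shift[OF t] m] .
    show "negligible ((\<lambda>s. s - t) ` Z)"
      using negligible_translation[OF Z(1), of "- t"] by simp
    fix s assume s: "s \<in> {0..} - (\<lambda>s. s - t) ` Z"
    then have "s + t \<notin> Z" using imageI[of "s + t" Z "\<lambda>s. s - t"] by auto
    then have "s + t \<in> {0..} - Z" using t s by simp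
    then show "(y (s + t), \<alpha> (s + t)) \<in> Ctrl" by (rule Z(2))
  qed
  show "y (s + t) \<in> S" if "0 \<le> s" for s using D(2) that t by simp
  fix s :: real assume s: "0 \<le> s"
  have "(V y \<alpha> has_integral (y (s + t) - y t)) {0 + t..s + t}"
    using has_integral_of_primitive[OF D(4), of t "s + t"] s t by simp
  then show "((\<lambda>s. G f (y (s + t)) (\<alpha> (s + t))) has_integral (y (s + t) - y t)) {0..s}"
    using has_integral_shift_Icc_real[unfolded o_def, of "V y \<alpha>" t _ 0 s] by (simp add: add.commute)
qed

lemma cost_split:
  assumes "admissible y \<alpha>" and t: "0 \<le> t"
  shows "Cost (y, \<alpha>) = integral {0..t} (\<lambda>s. G l (y s) (\<alpha> s) * exp (- lam * s)) +
      exp (- lam * t) * Cost (\<lambda>s. y (s + t), \<lambda>s. \<alpha> (s + t))"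
proof -
  have "(\<lambda>s. G l (y (s + t)) (\<alpha> (s + t)) * exp (- lam * (s + t)))
      = (\<lambda>s. exp (- lam * t) * (G l (y (s + t)) (\<alpha> (s + t)) * exp (- lam * s)))"
  proof
    fix s
    have "exp (- lam * (s + t)) = exp (- lam * t) * exp (- lam * s)"
      by (simp add: algebra_simps flip: exp_add)
    then show "G l (y (s + t)) (\<alpha> (s + t)) * exp (- lam * (s + t))
        = exp (- lam * t) * (G l (y (s + t)) (\<alpha> (s + t)) * exp (- lam * s))" by simp
  qed
  then show ?thesis
    using integral_ray_split(2)[OF admissible_cost_integrable(1)[OF assms(1)] t] by (simp add: cost_def)
qed

section \<open>Arcs with a constant control and their concatenation with trajectories\<close>

definition piece :: "nat \<Rightarrow> 'a \<Rightarrow> real \<Rightarrow> (real \<Rightarrow> pt) \<Rightarrow> bool" where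
  "piece i a T y \<longleftrightarrow> 0 \<le> T \<and> (\<forall>t\<in>{0..T}. y t \<in> P i) \<and>
     (\<forall>t\<in>{0..T}. ((\<lambda>s. f i (y s) a) has_integral (y t - y 0)) {0..t})"

lemma piece_cost_has_integral:
  assumes i: "i \<in> {1..N}" and a: "a \<in> A i" and y: "piece i a T y" "continuous_on {0..T} y"
  shows "((\<lambda>s. l i (y s) a * exp (- lam * s)) has_integral
      integral {0..T} (\<lambda>s. l i (y s) a * exp (- lam * s))) {0..T}"
proof (rule integrable_integral, rule integrable_continuous_interval)
  have "continuous_on {0..T} (\<lambda>s. (\<lambda>(x, a). l i x a) (y s, a))"
    using y a by (intro continuous_on_compose2[OF l_cont[OF i]] continuous_intros) (auto simp: piece_def)
  then show "continuous_on {0..T} (\<lambda>s. l i (y s) a * exp (- lam * s))"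
    by (intro continuous_intros) simp
qed

text \<open>The other half of dynamic programming: competitors for the value at \<open>z 0\<close>
  are obtained by prepending an arc to competitors for the value at \<open>z T\<close>.\<close>

lemma piece_concat:
  assumes i: "i \<in> {1..N}" "a \<in> A i" and p: "piece i a T z"
    and tr: "(y, \<alpha>) \<in> Traj (z T)"
  shows "\<exists>ya\<in>Traj (z 0). Cost ya =
      integral {0..T} (\<lambda>s. l i (z s) a * exp (- lam * s)) + exp (- lam * T) * Cost (y, \<alpha>)"
proof -
  note D = trajectoriesD[OF tr]
  have T: "0 \<le> T" and zP: "\<And>t. 0 \<le> t \<Longrightarrow> t \<le> T \<Longrightarrow> z t \<in> P i"
    and zint: "\<And>t. 0 \<le> t \<Longrightarrow> t \<le> T \<Longrightarrow> ((\<lambda>s. f i (z s) a) has_integral (z t - z 0)) {0..t}"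
    using p unfolding piece_def by auto
  \<comment> \<open>The positions agree at T because \<open>y 0\<close> is \<open>z T\<close>; the
    controls may differ there, which is why integrals are compared off the single point T.\<close>
  define y' where "y' t = (if t < T then z t else y (t - T))" for t
  define \<alpha>' where "\<alpha>' t = (if t < T then a else \<alpha> (t - T))" for t
  have y'_eq: "y' t = z t" if "t \<le> T" for t using that D(3) by (auto simp: y'_def)
  have sh: "(\<lambda>s. y' (s + T)) s = y s" "(\<lambda>s. \<alpha>' (s + T)) s = \<alpha> s" if "0 \<le> s" for s
    using that by (auto simp: y'_def \<alpha>'_def)
  have int: "(V y' \<alpha>' has_integral (y' t - z 0)) {0..t}" if t: "0 \<le> t" for t
  proof -
    have 1: "(V y' \<alpha>' has_integral (z t - z 0)) {0..t}" if "0 \<le> t" "t \<le> T" for t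
    proof (rule has_integral_spike[of "{T}"])
      show "((\<lambda>s. f i (z s) a) has_integral (z t - z 0)) {0..t}" using that by (rule zint)
      fix s assume "s \<in> {0..t} - {T}"
      then have s: "0 \<le> s" "s < T" using that by auto
      then show "V y' \<alpha>' s = f i (z s) a"
        using glue_eq[OF i(1) zP i(2), of s f] by (simp add: y'_def \<alpha>'_def)
    qed simp
    show ?thesis
    proof (cases "t \<le> T")
      case True
      then show ?thesis using 1[OF t] by (simp add: y'_eq)
    next
      case False
      then have tT: "0 \<le> t - T" "T \<le> t" by auto
      have "((\<lambda>s. V y \<alpha> (s - T)) has_integral (y (t - T) - z T)) {0 + T..(t - T) + T}"
        using D(4)[OF tT(1)] has_integral_shift_Icc_real[unfolded o_def, of "\<lambda>s. V y \<alpha> (s - T)" T _ 0 "t - T"]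
        by (simp add: add.commute)
      then have "((\<lambda>s. V y \<alpha> (s - T)) has_integral (y (t - T) - z T)) {T..t}" by simp
      then have "(V y' \<alpha>' has_integral (y (t - T) - z T)) {T..t}"
        by (rule has_integral_eq[rotated]) (simp add: y'_def \<alpha>'_def)
      from has_integral_combine[OF T tT(2) 1[OF T order_refl] this]
      show ?thesis using False by (simp add: y'_def)
    qed
  qed
  have zc: "continuous_on {0..} y'"
    using int by (rule continuous_of_primitive)
  obtain Z where Z: "negligible Z" "\<And>t. t \<in> {0..} - Z \<Longrightarrow> (y t, \<alpha> t) \<in> Ctrl"
    and m: "(\<lambda>t. (y t, \<alpha> t)) \<in> borel_measurable (lebesgue_on {0..})"
    using D(1) unfolding admissible_def by blast
  have "admissible y' \<alpha>'"
    unfolding admissible_def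
  proof (intro conjI exI[of _ "(\<lambda>s. T + s) ` Z"] ballI)
    \<comment> \<open>The pair is measurable as a whole on each side of T: on the arc it is
      continuous in time, afterwards it is a translate of the given pair.\<close>
    have "(\<lambda>t. if t < T then (y' t, a) else (y (t - T), \<alpha> (t - T))) \<in> borel_measurable (lebesgue_on {0..})"
    proof (subst measurable_If_restrict_space_iff)
      show "{x \<in> space (lebesgue_on {0..}). x < T} \<in> sets (lebesgue_on {0..})"
        by (simp add: sets_restrict_space) (rule image_eqI[of _ _ "{..<T}"], auto)
      have r1: "restrict_space (lebesgue_on {0..}) {x. x < T} = lebesgue_on ({0..} \<inter> {..<T})"
        by (subst restrict_restrict_space) (auto simp: lessThan_def)
      have r2: "restrict_space (lebesgue_on {0..}) {x. \<not> x < T} = lebesgue_on {T..}"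
      proof -
        have "{0..} \<inter> {x. \<not> x < T} = {T..}" using T by auto
        then show ?thesis by (subst restrict_restrict_space) (auto simp: not_less atLeast_def[symmetric])
      qed
      have "(\<lambda>x. - T + 1 * x) \<in> lebesgue \<rightarrow>\<^sub>M lebesgue"
        using lebesgue_affine_measurable[where c = "\<lambda>x::real. 1" and t = "- T"] by simp
      then have "(\<lambda>t. t - T) \<in> lebesgue_on {T..} \<rightarrow>\<^sub>M lebesgue_on {0..}"
        by (intro measurable_restrict_space3) auto
      from measurable_compose[OF this m]
      have 2: "(\<lambda>t. (y (t - T), \<alpha> (t - T))) \<in> borel_measurable (lebesgue_on {T..})" .
      have 1: "(\<lambda>t. (y' t, a)) \<in> borel_measurable (lebesgue_on ({0..} \<inter> {..<T}))"
        by (intro measurable_continuous_pair continuous_on_subset[OF zc]) auto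
      show "(\<lambda>t. (y' t, a)) \<in> borel_measurable (restrict_space (lebesgue_on {0..}) {x. x < T}) \<and>
          (\<lambda>t. (y (t - T), \<alpha> (t - T))) \<in> borel_measurable (restrict_space (lebesgue_on {0..}) {x. \<not> x < T})"
        unfolding r1 r2 using 1 2 by blast
    qed
    moreover have "(\<lambda>t. (y' t, \<alpha>' t)) = (\<lambda>t. if t < T then (y' t, a) else (y (t - T), \<alpha> (t - T)))"
      by (auto simp: y'_def \<alpha>'_def)
    ultimately show "(\<lambda>t. (y' t, \<alpha>' t)) \<in> borel_measurable (lebesgue_on {0..})" by simp
    show "negligible ((\<lambda>s. T + s) ` Z)" by (rule negligible_translation[OF Z(1)])
    fix t assume t: "t \<in> {0..} - (\<lambda>s. T + s) ` Z"
    show "(y' t, \<alpha>' t) \<in> Ctrl"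
    proof (cases "t < T")
      case True
      then show ?thesis using i zP[of t] t unfolding ctrl_set_iff by (auto simp: y'_def \<alpha>'_def)
    next
      case False
      moreover have "t - T \<notin> Z"
      proof
        assume "t - T \<in> Z"
        then have "T + (t - T) \<in> (\<lambda>s. T + s) ` Z" by (rule imageI)
        then show False using t by simp
      qed
      ultimately show ?thesis using Z(2)[of "t - T"] by (simp add: y'_def \<alpha>'_def)
    qed
  qed
  note adm = this
  have "(y', \<alpha>') \<in> Traj (z 0)"
  proof (rule trajectoriesI[OF adm _ int])
    fix t :: real assume t: "0 \<le> t"
    show "y' t \<in> S"
      using D(2)[of "t - T"] P_sub_S[OF i(1) zP[OF t]] by (auto simp: y'_def)
  qed
  moreover have "Cost (y', \<alpha>') = integral {0..T} (\<lambda>s. l i (z s) a * exp (- lam * s))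
      + exp (- lam * T) * Cost (y, \<alpha>)"
  proof -
    have "integral {0..T} (\<lambda>s. G l (y' s) (\<alpha>' s) * exp (- lam * s)) = integral {0..T} (\<lambda>s. l i (z s) a * exp (- lam * s))"
    proof (rule integral_spike[of "{T}"])
      fix s assume "s \<in> {0..T} - {T}"
      then show "l i (z s) a * exp (- lam * s) = G l (y' s) (\<alpha>' s) * exp (- lam * s)"
        using glue_eq[OF i(1) zP i(2), of s l] by (simp add: y'_def \<alpha>'_def)
    qed simp
    moreover have "Cost (\<lambda>s. y' (s + T), \<lambda>s. \<alpha>' (s + T)) = Cost (y, \<alpha>)"
      unfolding cost_def case_prod_conv by (intro Bochner_Integration.integral_cong refl) (simp add: sh)
    ultimately show ?thesis using cost_split[OF adm T] by simp
  qed
  ultimately show ?thesis by blast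
qed


section \<open>Existence of arcs inside one half-plane, and of trajectories\<close>

lemma extended_flow:
  assumes i: "i \<in> {1..N}" and a: "a \<in> A i" and z: "z \<in> P i"
  obtains y where "y 0 = z" "continuous_on {0..} y"
    and "\<And>s t. 0 \<le> s \<Longrightarrow> s \<le> t \<Longrightarrow> ((\<lambda>r. f i (retract i (y r)) a) has_integral (y t - y s)) {s..t}"
    and "\<And>t. 0 \<le> t \<Longrightarrow> y t \<in> plane e i" and "\<And>t. 0 \<le> t \<Longrightarrow> norm (y t - z) \<le> M * t"
proof -
  let ?g = "\<lambda>w. f i (retract i w) a"
  \<comment> \<open>Composed with the retraction the field is bounded and globally Lipschitz, so a
    solution exists for all times. It may leave the half-plane; the later lemmas give conditions
    under which it does not.\<close>
  have lip: "(Lf * 2)-lipschitz_on UNIV ?g"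
  proof (rule lipschitz_onI)
    fix w w'
    have "norm (?g w - ?g w') \<le> Lf * norm (retract i w - retract i w')"
      using i a by (intro f_lip retract_in_P)
    also have "\<dots> \<le> Lf * (2 * norm (w - w'))"
      using i Lf_pos by (intro mult_left_mono retract_lipschitz) auto
    finally show "dist (?g w) (?g w') \<le> Lf * 2 * dist w w'" by (simp add: dist_norm)
  qed (use Lf_pos in simp)
  obtain y :: "real \<Rightarrow> pt" where yc: "continuous_on {0..} y"
    and yi: "\<And>t. 0 \<le> t \<Longrightarrow> ((\<lambda>s. ?g (y s)) has_integral (y t - z)) {0..t}"
    using bounded_lipschitz_ode_global_solution[OF lip f_bound[OF i retract_in_P a], of z] by blast
  have y0: "y 0 = z"
  proof -
    have "((\<lambda>s. ?g (y s)) has_integral 0) {0..0}" using has_integral_refl(2)[of "\<lambda>s. ?g (y s)" 0] by simp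
    from has_integral_unique[OF yi[OF order_refl] this] show ?thesis by simp
  qed
  show ?thesis
  proof (rule that)
    show "y 0 = z" "continuous_on {0..} y" by (fact y0 yc)+
    show "((\<lambda>r. ?g (y r)) has_integral (y t - y s)) {s..t}" if "0 \<le> s" "s \<le> t" for s t
      using has_integral_of_primitive[OF yi that] .
    fix t :: real assume t: "0 \<le> t"
    \<comment> \<open>The projection onto the orthogonal complement of the plane. It annihilates
      every velocity, so the solution cannot leave the plane.\<close>
    define q where "q w = w - (w \<bullet> e 0) *\<^sub>R e 0 - (w \<bullet> e i) *\<^sub>R e i" for w
    have q: "bounded_linear q"
      unfolding q_def by (intro linear_conv_bounded_linear[THEN iffD1] linearI) (auto simp: algebra_simps inner_add_left)
    have q0: "q w = 0 \<longleftrightarrow> w \<in> plane e i" for w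
      unfolding plane_iff[OF i] q_def by (auto simp: algebra_simps)
    have "((\<lambda>s. q (?g (y s))) has_integral q (y t - z)) {0..t}"
      using has_integral_linear[OF yi[OF t] q] by (simp add: o_def)
    moreover have "(\<lambda>s. q (?g (y s))) = (\<lambda>s. 0)"
      using f_plane[OF i retract_in_P a] q0 by auto
    ultimately have "q (y t - z) = 0" using has_integral_unique[OF has_integral_0] by metis
    then have "y t - z \<in> plane e i" using q0 by blast
    then have "(y t - z) + z \<in> plane e i"
      using P_plane[OF i z] unfolding plane_def by (rule span_add)
    then show "y t \<in> plane e i" by simp
    have "norm (y t - z) \<le> M * measure lborel {0..t}"
      using yi[OF t] f_bound[OF i retract_in_P a] M_pos
      by (intro has_integral_bound[of M "\<lambda>s. ?g (y s)", unfolded box_real]) auto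
    then show "norm (y t - z) \<le> M * t" using t by simp
  qed
qed

lemma piece_of_extended_flow:
  assumes i: "i \<in> {1..N}" and T: "0 \<le> T" and yP: "\<And>t. 0 \<le> t \<Longrightarrow> t \<le> T \<Longrightarrow> y t \<in> P i"
    and yi: "\<And>s t. 0 \<le> s \<Longrightarrow> s \<le> t \<Longrightarrow> ((\<lambda>r. f i (retract i (y r)) a) has_integral (y t - y s)) {s..t}"
  shows "piece i a T y"
  unfolding piece_def
proof (intro conjI ballI T)
  fix t assume t: "t \<in> {0..T}"
  show "y t \<in> P i" using t yP by simp
  have "((\<lambda>r. f i (retract i (y r)) a) has_integral (y t - y 0)) {0..t}" using yi[of 0 t] t by simp
  then show "((\<lambda>s. f i (y s) a) has_integral (y t - y 0)) {0..t}"
    by (rule has_integral_eq[rotated]) (use t yP retract_id[OF i] in auto)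
qed

lemma retract_flow_close:
  assumes "i \<in> {1..N}" "z \<in> P i" "norm (w - z) \<le> M * t" "t \<le> T"
  shows "norm (retract i w - z) \<le> 2 * M * T"
proof -
  have "norm (retract i w - retract i z) \<le> 2 * norm (w - z)" using assms by (intro retract_lipschitz)
  also have "\<dots> \<le> 2 * (M * T)" using assms M_pos mult_left_mono[of t T M] by linarith
  finally show ?thesis using retract_id assms by simp
qed

text \<open>Once the extended flow is outside the half-plane, its retraction lies on \<Gamma>, where
  the control points inward, so the normal component cannot have decreased since the last time it
  was nonnegative. Far from \<Gamma> the condition on \<open>w\<close> is empty.\<close>

lemma piece_exists:
  assumes i: "i \<in> {1..N}" and a: "a \<in> A i" and z: "z \<in> P i" and T: "0 \<le> T"
    and inward: "\<And>w. w \<in> \<Gamma> \<Longrightarrow> norm (w - z) \<le> 2 * M * T \<Longrightarrow> 0 \<le> f i w a \<bullet> e i"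
  obtains y where "piece i a T y" "y 0 = z" "continuous_on {0..T} y"
    "\<And>t. 0 \<le> t \<Longrightarrow> t \<le> T \<Longrightarrow> norm (y t - z) \<le> M * t"
proof -
  obtain y where y0: "y 0 = z" and yc: "continuous_on {0..} y"
    and yi: "\<And>s t. 0 \<le> s \<Longrightarrow> s \<le> t \<Longrightarrow> ((\<lambda>r. f i (retract i (y r)) a) has_integral (y t - y s)) {s..t}"
    and yp: "\<And>t. 0 \<le> t \<Longrightarrow> y t \<in> plane e i" and yM: "\<And>t. 0 \<le> t \<Longrightarrow> norm (y t - z) \<le> M * t"
    using extended_flow[OF i a z] by blast
  have nn: "0 \<le> y t \<bullet> e i" if t: "0 \<le> t" "t \<le> T" for t
  proof (rule ccontr)
    assume neg: "\<not> 0 \<le> y t \<bullet> e i"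
    let ?C = "{r \<in> {0..t}. 0 \<le> y r \<bullet> e i}"
    have "closed ({0..t} \<inter> (\<lambda>r. y r \<bullet> e i) -` {0..})"
      by (intro continuous_closed_preimage continuous_intros continuous_on_subset[OF yc]) auto
    moreover have "{0..t} \<inter> (\<lambda>r. y r \<bullet> e i) -` {0..} = ?C" by auto
    ultimately have "closed ?C" by simp
    moreover have "bounded ?C" by (rule bounded_subset[OF bounded_closed_interval[of 0 t]]) auto
    ultimately have "compact ?C" by (simp only: compact_eq_bounded_closed)
    moreover have "0 \<in> ?C" using t y0 z P_iff[OF i] by auto
    ultimately obtain s where s: "s \<in> ?C" "\<And>r. r \<in> ?C \<Longrightarrow> r \<le> s"
      using compact_attains_sup[of ?C] by auto
    have st: "0 \<le> s" "s \<le> t" using s by auto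
    have "((\<lambda>r. f i (retract i (y r)) a \<bullet> e i) has_integral ((y t - y s) \<bullet> e i)) {s..t}"
      using has_integral_inner_const[OF yi[OF st]] .
    \<comment> \<open>At s the flow is still in the half-plane and the sign of the normal velocity
      is unknown, so this single time is discarded.\<close>
    then have "((\<lambda>r. if r \<in> {s} then 0 else f i (retract i (y r)) a \<bullet> e i) has_integral ((y t - y s) \<bullet> e i)) {s..t}"
      by (rule has_integral_spike[of "{s}", rotated 2]) auto
    then have "0 \<le> (y t - y s) \<bullet> e i"
    proof (rule has_integral_nonneg)
      fix r assume r: "r \<in> {s..t}"
      show "0 \<le> (if r \<in> {s} then 0 else f i (retract i (y r)) a \<bullet> e i)"
      proof (cases "r = s")
        case False
        then have "\<not> 0 \<le> y r \<bullet> e i" using s(2)[of r] r st by auto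
        then have "retract i (y r) \<in> \<Gamma>" by (intro retract_in_G) simp
        moreover have "norm (retract i (y r) - z) \<le> 2 * M * T"
          using r st t by (intro retract_flow_close[OF i z yM]) auto
        ultimately show ?thesis using inward by simp
      qed simp
    qed
    then show False using s(1) neg by (simp add: inner_diff_left)
  qed
  then have yP: "y t \<in> P i" if "0 \<le> t" "t \<le> T" for t
    using yp that P_iff[OF i] by blast
  show ?thesis
  proof (rule that)
    show "piece i a T y" by (rule piece_of_extended_flow[OF i T yP yi])
    show "y 0 = z" by fact
    show "continuous_on {0..T} y" by (rule continuous_on_subset[OF yc]) auto
  qed (use yM in auto)
qed

text \<open>The normal component falls at rate at least \<open>c\<close>, so it vanishes at some
  time T not later than \<open>(z \<bullet> e i) / c\<close>. By the same monotonicity it is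
  nonnegative before T, so the flow is in the half-plane until it reaches \<Gamma>.\<close>

lemma piece_to_interface:
  assumes i: "i \<in> {1..N}" and a: "a \<in> A i" and z: "z \<in> P i" and c: "0 < c"
    and outward: "\<And>w. w \<in> P i \<Longrightarrow> norm (w - z) \<le> 2 * M * ((z \<bullet> e i) / c) \<Longrightarrow> f i w a \<bullet> e i \<le> - c"
  obtains y T where "piece i a T y" "y 0 = z" "T \<le> (z \<bullet> e i) / c" "y T \<in> \<Gamma>" "norm (y T - z) \<le> M * T"
    "continuous_on {0..T} y"
proof -
  obtain y where y0: "y 0 = z" and yc: "continuous_on {0..} y"
    and yi: "\<And>s t. 0 \<le> s \<Longrightarrow> s \<le> t \<Longrightarrow> ((\<lambda>r. f i (retract i (y r)) a) has_integral (y t - y s)) {s..t}"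
    and yp: "\<And>t. 0 \<le> t \<Longrightarrow> y t \<in> plane e i" and yM: "\<And>t. 0 \<le> t \<Longrightarrow> norm (y t - z) \<le> M * t"
    using extended_flow[OF i a z] by blast
  define T0 where "T0 = (z \<bullet> e i) / c"
  have T0: "0 \<le> T0" using z c P_iff[OF i] by (simp add: T0_def)
  have dec: "(y t - y s) \<bullet> e i \<le> - c * (t - s)" if st: "0 \<le> s" "s \<le> t" "t \<le> T0" for s t
  proof -
    have "((\<lambda>r. f i (retract i (y r)) a \<bullet> e i) has_integral ((y t - y s) \<bullet> e i)) {s..t}"
      using has_integral_inner_const[OF yi] st by blast
    moreover have "((\<lambda>r. - c) has_integral (- c * (t - s))) {s..t}"
      using has_integral_const_real[of "- c" s t] st by (simp add: mult.commute)
    ultimately show ?thesis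
    proof (rule has_integral_le)
      fix r assume r: "r \<in> {s..t}"
      show "f i (retract i (y r)) a \<bullet> e i \<le> - c"
        using r st unfolding T0_def[symmetric]
        by (intro outward retract_in_P) (auto simp: T0_def[symmetric] intro!: retract_flow_close[OF i z yM])
    qed
  qed
  have "y T0 \<bullet> e i \<le> 0" using dec[of 0 T0] T0 c by (simp add: y0 inner_diff_left T0_def)
  moreover have "0 \<le> y 0 \<bullet> e i" using y0 z P_iff[OF i] by simp
  moreover have "continuous_on {0..T0} (\<lambda>t. y t \<bullet> e i)"
    by (intro continuous_intros continuous_on_subset[OF yc]) auto
  ultimately obtain T where T: "0 \<le> T" "T \<le> T0" "y T \<bullet> e i = 0"
    using IVT2'[of "\<lambda>t. y t \<bullet> e i" T0 0 0] T0 by blast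
  have yP: "y t \<in> P i" if "0 \<le> t" "t \<le> T" for t
  proof -
    have "(y T - y t) \<bullet> e i \<le> - c * (T - t)" using that T by (intro dec) auto
    also have "\<dots> \<le> 0" using that c by (simp add: mult_nonneg_nonneg)
    finally have "0 \<le> y t \<bullet> e i" using T by (simp add: inner_diff_left)
    then show ?thesis using yp that P_iff[OF i] by blast
  qed
  show ?thesis
  proof (rule that)
    show "piece i a T y" by (rule piece_of_extended_flow[OF i T(1) yP yi])
    show "y 0 = z" by fact
    show "T \<le> (z \<bullet> e i) / c" using T by (simp add: T0_def)
    show "y T \<in> \<Gamma>" using G_P_iff[OF i yP] T by simp
    show "norm (y T - z) \<le> M * T" using T by (intro yM)
    show "continuous_on {0..T} y" by (rule continuous_on_subset[OF yc]) auto
  qed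
qed

lemma f_normal_perturb:
  assumes "i \<in> {1..N}" "x \<in> P i" "w \<in> P i" "a \<in> A i"
  shows "\<bar>f i w a \<bullet> e i - f i x a \<bullet> e i\<bar> \<le> Lf * norm (w - x)"
  using component_le[OF assms(1), of "f i w a - f i x a"] f_lip[OF assms(1,3,2,4)]
  by (simp add: inner_diff_left)

text \<open>Let \<open>x0\<close> be the projection of \<open>x\<close> onto \<Gamma> and choose
  normal velocity \<delta> there. A point of \<Gamma> within 2 M \<tau> of \<open>x\<close> is
  within 4 M \<tau> of \<open>x0\<close>, so the normal velocity changes by at most 4 Lf M \<tau>,
  which is \<delta> for the chosen \<tau>. As \<tau> does not depend on \<open>x\<close>, arcs of
  this length can be chained to cover all times.\<close>

lemma uniform_piece:
  "\<exists>\<tau>>0. \<forall>x\<in>S. \<exists>i\<in>{1..N}. \<exists>a\<in>A i. \<exists>y. piece i a \<tau> y \<and> y 0 = x"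
proof (intro exI[of _ "\<delta> / (4 * Lf * M)"] conjI ballI)
  let ?\<tau> = "\<delta> / (4 * Lf * M)"
  show "0 < ?\<tau>" using \<delta>_pos Lf_pos M_pos by simp
  fix x assume "x \<in> S"
  then obtain i where i: "i \<in> {1..N}" and x: "x \<in> P i" using S_cases by blast
  define x0 where "x0 = (x \<bullet> e 0) *\<^sub>R e 0"
  have x0: "x0 \<in> \<Gamma>" by (auto simp: x0_def Gam_def)
  obtain a where a: "a \<in> A i" "f i x0 a \<bullet> e i = \<delta>" using normal_ctrl[OF i x0, of \<delta>] \<delta>_pos by auto
  have "0 \<le> f i w a \<bullet> e i" if w: "w \<in> \<Gamma>" "norm (w - x) \<le> 2 * M * ?\<tau>" for w
  proof -
    have "x - x0 = (x \<bullet> e i) *\<^sub>R e i" using x P_plane[OF i x] plane_iff[OF i] unfolding x0_def by (metis add_diff_cancel_left')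
    then have "norm (x - x0) = \<bar>(x - w) \<bullet> e i\<bar>"
      using i w(1) G_P_iff[OF i G_sub_P[OF i w(1)]] by (simp add: inner_diff_left)
    also have "\<dots> \<le> norm (x - w)" by (rule component_le[OF i])
    finally have "norm (w - x0) \<le> 2 * (2 * M * ?\<tau>)"
      using w(2) norm_triangle_ineq[of "w - x" "x - x0"] by (simp add: norm_minus_commute)
    then have "Lf * norm (w - x0) \<le> Lf * (2 * (2 * M * ?\<tau>))" using Lf_pos by (intro mult_left_mono) auto
    also have "\<dots> = \<delta>" using Lf_pos M_pos by (simp add: field_simps)
    finally show ?thesis
      using f_normal_perturb[OF i G_sub_P[OF i x0] G_sub_P[OF i w(1)] a(1)] a(2) by linarith
  qed
  then obtain y where "piece i a ?\<tau> y" "y 0 = x"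
    using piece_exists[OF i a(1) x, of ?\<tau>] \<open>0 < ?\<tau>\<close> by (metis less_imp_le)
  then show "\<exists>i\<in>{1..N}. \<exists>a\<in>A i. \<exists>y. piece i a ?\<tau> y \<and> y 0 = x" using i a by blast
qed

text \<open>Instead of staying on \<open>\<Gamma>\<close>, which would need a measurable selection of tangential controls, the
  trajectory switches between constant controls that point away from \<open>\<Gamma>\<close>.\<close>

lemma trajectory_exists:
  assumes x0: "x0 \<in> S"
  shows "Traj x0 \<noteq> {}"
proof -
  obtain \<tau> where \<tau>: "0 < \<tau>"
    and ex: "\<forall>x\<in>S. \<exists>i a y. i \<in> {1..N} \<and> a \<in> A i \<and> piece i a \<tau> y \<and> y 0 = x"
    using uniform_piece by blast
  obtain J a Y where JaY: "\<And>x. x \<in> S \<Longrightarrow> J x \<in> {1..N}" "\<And>x. x \<in> S \<Longrightarrow> a x \<in> A (J x)"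
    "\<And>x. x \<in> S \<Longrightarrow> piece (J x) (a x) \<tau> (Y x)" "\<And>x. x \<in> S \<Longrightarrow> Y x 0 = x"
    using ex unfolding bchoice_iff by blast
  have YP: "Y x t \<in> P (J x)" if "x \<in> S" "0 \<le> t" "t \<le> \<tau>" for x t
    using JaY(3)[OF that(1)] that by (auto simp: piece_def)
  have YS: "Y x t \<in> S" if "x \<in> S" "0 \<le> t" "t \<le> \<tau>" for x t
    using P_sub_S[OF JaY(1) YP] that by blast
  define X where "X n = ((\<lambda>x. Y x \<tau>) ^^ n) x0" for n
  have XS: "X n \<in> S" for n
    by (induction n) (use x0 YS \<tau> in \<open>auto simp: X_def\<close>)
  have XSuc: "X (Suc n) = Y (X n) \<tau>" for n by (simp add: X_def)
  \<comment> \<open>Arc n governs the times from n \<tau> up to, but excluding, (n + 1)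
    \<tau>.\<close>
  define k where "k t = nat \<lfloor>t / \<tau>\<rfloor>" for t
  define y where "y t = Y (X (k t)) (t - real (k t) * \<tau>)" for t
  define \<alpha> where "\<alpha> t = a (X (k t))" for t
  have kI: "k t = n" if "real n * \<tau> \<le> t" "t < real (Suc n) * \<tau>" for n t
  proof -
    have "\<lfloor>t / \<tau>\<rfloor> = int n" using that \<tau> by (intro floor_unique) (auto simp: field_simps)
    then show ?thesis by (simp add: k_def)
  qed
  have kD: "real (k t) * \<tau> \<le> t" "t < real (Suc (k t)) * \<tau>" if "0 \<le> t" for t
  proof -
    have "0 \<le> t / \<tau>" using that \<tau> by simp
    then have "real (k t) = of_int \<lfloor>t / \<tau>\<rfloor>" by (simp add: k_def)
    then have "real (k t) \<le> t / \<tau>" "t / \<tau> < real (Suc (k t))" by linarith+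
    then show "real (k t) * \<tau> \<le> t" "t < real (Suc (k t)) * \<tau>" using \<tau> by (auto simp: field_simps)
  qed
  \<comment> \<open>The formula of arc n holds at its right end as well, since arc n + 1 starts
    where arc n stops; the control may jump there.\<close>
  have y_eq: "y t = Y (X n) (t - real n * \<tau>)" if "real n * \<tau> \<le> t" "t \<le> real (Suc n) * \<tau>" for n t
  proof (cases "t < real (Suc n) * \<tau>")
    case True
    then show ?thesis using kI[OF that(1)] by (simp add: y_def)
  next
    case False
    then have t: "t = real (Suc n) * \<tau>" using that by simp
    then have "k t = Suc n" using \<tau> by (intro kI) (auto simp: field_simps)
    then have "y t = X (Suc n)" using JaY(4)[OF XS] t by (simp add: y_def)
    then show ?thesis using t by (simp add: XSuc algebra_simps)
  qed
  have ctrl: "y t \<in> P (J (X (k t)))" "\<alpha> t \<in> A (J (X (k t)))" if "0 \<le> t" for t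
    using YP[OF XS, of "t - real (k t) * \<tau>" "k t"] kD[OF that] JaY(2)[OF XS]
    by (auto simp: y_def \<alpha>_def algebra_simps)
  have seg: "(V y \<alpha> has_integral (y t - y (real n * \<tau>))) {real n * \<tau>..t}"
    if t: "real n * \<tau> \<le> t" "t \<le> real (Suc n) * \<tau>" for n t
  proof -
    let ?c = "real n * \<tau>"
    let ?i = "J (X n)"
    have "((\<lambda>s. f ?i (Y (X n) s) (a (X n))) has_integral (Y (X n) (t - ?c) - Y (X n) 0)) {0..t - ?c}"
      using JaY(3)[OF XS, of n] t by (simp add: piece_def algebra_simps)
    then have "((\<lambda>s. f ?i (Y (X n) (s - ?c)) (a (X n))) has_integral (Y (X n) (t - ?c) - Y (X n) 0)) {0 + ?c..(t - ?c) + ?c}"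
      using has_integral_shift_Icc_real[unfolded o_def, of "\<lambda>s. f ?i (Y (X n) (s - ?c)) (a (X n))" ?c _ 0 "t - ?c"]
      by (simp add: add.commute)
    then have "((\<lambda>s. f ?i (Y (X n) (s - ?c)) (a (X n))) has_integral (y t - y ?c)) {?c..t}"
      using y_eq[OF t] y_eq[of n ?c] \<tau> by (simp add: algebra_simps)
    then show ?thesis
    proof (rule has_integral_spike[of "{real (Suc n) * \<tau>}", rotated 2])
      fix s assume "s \<in> {?c..t} - {real (Suc n) * \<tau>}"
      then have s: "?c \<le> s" "s < real (Suc n) * \<tau>" using t by auto
      have s0: "0 \<le> s" using s(1) \<tau> by (meson mult_nonneg_nonneg of_nat_0_le_iff less_imp_le order_trans)
      have "y s = Y (X n) (s - ?c)" using s by (intro y_eq) auto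
      moreover have "k s = n" using s by (rule kI)
      ultimately show "V y \<alpha> s = f ?i (Y (X n) (s - ?c)) (a (X n))"
        using glue_eq[OF JaY(1)[OF XS] ctrl[OF s0], of f] by (simp add: \<alpha>_def)
    qed simp
  qed
  have y0: "y 0 = x0"
    using y_eq[of 0 0] \<tau> JaY(4)[OF x0] by (simp add: X_def)
  have all: "\<forall>t\<in>{0..real n * \<tau>}. (V y \<alpha> has_integral (y t - x0)) {0..t}" for n
  proof (induction n)
    case 0
    show ?case using y0 has_integral_refl(2)[of "V y \<alpha>" 0] by simp
  next
    case (Suc n)
    show ?case
    proof
      fix t assume t: "t \<in> {0..real (Suc n) * \<tau>}"
      show "(V y \<alpha> has_integral (y t - x0)) {0..t}"
      proof (cases "t \<le> real n * \<tau>")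
        case True
        then show ?thesis using Suc t by simp
      next
        case False
        then have 1: "real n * \<tau> \<le> t" "t \<le> real (Suc n) * \<tau>" using t by auto
        have 2: "(V y \<alpha> has_integral (y (real n * \<tau>) - x0)) {0..real n * \<tau>}"
          using Suc \<tau> by simp
        show ?thesis
          using has_integral_combine[OF _ 1(1) 2 seg[OF 1]] \<tau> by simp
      qed
    qed
  qed
  have int: "(V y \<alpha> has_integral (y t - x0)) {0..t}" if "0 \<le> t" for t
    using all[of "Suc (k t)"] kD[OF that] that by auto
  have yc: "continuous_on {0..} y" using int by (rule continuous_of_primitive)
  have "admissible y \<alpha>"
    unfolding admissible_def
  proof (intro conjI exI[of _ "{}"] ballI)
    \<comment> \<open>The control depends on time only through the integer \<open>k t\<close>, so
      the pair is a countable patchwork of pairs with constant control.\<close>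
    have "k \<in> borel \<rightarrow>\<^sub>M count_space UNIV" unfolding k_def by measurable
    then have "k \<in> lborel \<rightarrow>\<^sub>M count_space UNIV" by simp
    then have "k \<in> lebesgue_on {0..} \<rightarrow>\<^sub>M count_space UNIV"
      by (intro measurable_restrict_space1 measurable_completion)
    moreover have "(\<lambda>t. (y t, a (X n))) \<in> borel_measurable (lebesgue_on {0..})" for n
      using yc by (rule measurable_continuous_pair) simp
    ultimately show "(\<lambda>t. (y t, \<alpha> t)) \<in> borel_measurable (lebesgue_on {0..})"
      unfolding \<alpha>_def
      using measurable_compose_countable[where f = "\<lambda>n t. (y t, a (X n))" and g = k] by blast
    fix t :: real assume "t \<in> {0..} - {}"
    then show "(y t, \<alpha> t) \<in> Ctrl"
      using ctrl[of t] JaY(1)[OF XS] unfolding ctrl_set_iff by auto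
  qed simp
  then have "(y, \<alpha>) \<in> Traj x0"
  proof (rule trajectoriesI[OF _ _ int])
    show "y t \<in> S" if "0 \<le> t" for t using P_sub_S[OF JaY(1)[OF XS] ctrl(1)[OF that]] .
  qed
  then show ?thesis by blast
qed

section \<open>The value function and dynamic programming\<close>

abbreviation "vf \<equiv> value_function e N A f l lam"

definition vr :: "pt \<Rightarrow> real" where "vr x = real_of_ereal (vf x)"

lemma vr:
  assumes "x \<in> S"
  shows "vf x = ereal (vr x)" and "\<bar>vr x\<bar> \<le> B / lam"
    and "\<And>ya. ya \<in> Traj x \<Longrightarrow> vr x \<le> Cost ya"
    and "\<And>\<eta>. 0 < \<eta> \<Longrightarrow> \<exists>ya\<in>Traj x. Cost ya < vr x + \<eta>"
proof -
  have bd: "\<bar>Cost ya\<bar> \<le> B / lam" if "ya \<in> Traj x" for ya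
    using that trajectoriesD(1) admissible_cost_integrable(2) by (cases ya) blast
  obtain ya0 where ya0: "ya0 \<in> Traj x" using trajectory_exists[OF assms] by blast
  have "vf x \<le> ereal (Cost ya0)" unfolding value_function_def by (rule INF_lower[OF ya0])
  also have "\<dots> \<le> ereal (B / lam)" using bd[OF ya0] by simp
  finally have 1: "vf x \<le> ereal (B / lam)" .
  have 2: "ereal (- (B / lam)) \<le> vf x"
    unfolding value_function_def
  proof (rule INF_greatest)
    fix ya assume "ya \<in> Traj x"
    then show "ereal (- (B / lam)) \<le> ereal (Cost ya)" using bd[of ya] by simp
  qed
  show eq: "vf x = ereal (vr x)" using 1 2 unfolding vr_def by (cases "vf x") auto
  show "\<bar>vr x\<bar> \<le> B / lam" using 1 2 unfolding eq by simp
  show "vr x \<le> Cost ya" if "ya \<in> Traj x" for ya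
  proof -
    have "vf x \<le> ereal (Cost ya)" unfolding value_function_def by (rule INF_lower[OF that])
    then show ?thesis by (simp add: eq)
  qed
  show "\<exists>ya\<in>Traj x. Cost ya < vr x + \<eta>" if "0 < \<eta>" for \<eta>
  proof -
    have "vf x < ereal (vr x + \<eta>)" using that by (simp add: eq)
    then show ?thesis unfolding value_function_def INF_less_iff by simp
  qed
qed

lemma dpp_piece:
  assumes i: "i \<in> {1..N}" "a \<in> A i" and p: "piece i a T z"
  shows "vr (z 0) \<le> integral {0..T} (\<lambda>s. l i (z s) a * exp (- lam * s)) + exp (- lam * T) * vr (z T)"
proof (rule field_le_epsilon)
  fix \<eta> :: real assume \<eta>: "0 < \<eta>"
  have T: "0 \<le> T" "z 0 \<in> S" "z T \<in> S"
    using p P_sub_S[OF i(1)] by (auto simp: piece_def)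
  obtain y \<alpha> where ya: "(y, \<alpha>) \<in> Traj (z T)" "Cost (y, \<alpha>) < vr (z T) + \<eta>"
    using vr(4)[OF T(3) \<eta>] by fastforce
  from piece_concat[OF i p ya(1)] vr(3)[OF T(2)]
  have "vr (z 0) \<le> integral {0..T} (\<lambda>s. l i (z s) a * exp (- lam * s)) + exp (- lam * T) * Cost (y, \<alpha>)"
    by fastforce
  also have "exp (- lam * T) * Cost (y, \<alpha>) \<le> exp (- lam * T) * (vr (z T) + \<eta>)"
    using ya(2) by (intro mult_left_mono) auto
  also have "\<dots> \<le> exp (- lam * T) * vr (z T) + \<eta>"
    using T lam \<eta> by (simp add: distrib_left mult_le_cancel_right1)
  finally show "vr (z 0) \<le> integral {0..T} (\<lambda>s. l i (z s) a * exp (- lam * s)) + exp (- lam * T) * vr (z T) + \<eta>"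
    by simp
qed

text \<open>One near-optimal trajectory serves all times t: whatever t is, its tail costs at least
  the value at \<open>y t\<close>.\<close>

lemma dpp_trajectory:
  assumes x: "x \<in> S" and \<eta>: "0 < \<eta>"
  obtains y \<alpha> where "(y, \<alpha>) \<in> Traj x"
    "\<And>t. 0 \<le> t \<Longrightarrow> integral {0..t} (\<lambda>s. G l (y s) (\<alpha> s) * exp (- lam * s)) + exp (- lam * t) * vr (y t) \<le> vr x + \<eta>"
proof -
  obtain y \<alpha> where ya: "(y, \<alpha>) \<in> Traj x" "Cost (y, \<alpha>) < vr x + \<eta>"
    using vr(4)[OF x \<eta>] by fastforce
  show ?thesis
  proof (rule that[OF ya(1)])
    fix t :: real assume t: "0 \<le> t"
    have "vr (y t) \<le> Cost (\<lambda>s. y (s + t), \<lambda>s. \<alpha> (s + t))"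
      using vr(3)[OF trajectoriesD(2)[OF ya(1) t] trajectory_shift[OF ya(1) t]] .
    then have "exp (- lam * t) * vr (y t) \<le> exp (- lam * t) * Cost (\<lambda>s. y (s + t), \<lambda>s. \<alpha> (s + t))"
      by (intro mult_left_mono) auto
    then show "integral {0..t} (\<lambda>s. G l (y s) (\<alpha> s) * exp (- lam * s)) + exp (- lam * t) * vr (y t) \<le> vr x + \<eta>"
      using cost_split[OF trajectoriesD(1)[OF ya(1)] t] ya(2) by linarith
  qed
qed

section \<open>Piecewise linear functions along trajectories\<close>

text \<open>Linear on each half-plane: the tangential slope \<open>p\<close> is common to all of
  them, which makes the function continuous across \<Gamma>, while the normal slopes
  \<open>b i\<close> are free.\<close>

definition \<psi> :: "real \<Rightarrow> (nat \<Rightarrow> real) \<Rightarrow> pt \<Rightarrow> real" where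
  "\<psi> p b z = p * (z \<bullet> e 0) + (\<Sum>i\<in>{1..N}. b i * coord i z)"

definition d\<psi> :: "real \<Rightarrow> (nat \<Rightarrow> real) \<Rightarrow> nat \<Rightarrow> pt \<Rightarrow> 'a \<Rightarrow> real" where
  "d\<psi> p b i x a = p * (f i x a \<bullet> e 0) + b i * (f i x a \<bullet> e i)"

lemma \<psi>_eq: "i \<in> {1..N} \<Longrightarrow> z \<in> P i \<Longrightarrow> \<psi> p b z = p * (z \<bullet> e 0) + b i * (z \<bullet> e i)"
proof -
  assume i: "i \<in> {1..N}" "z \<in> P i"
  have "(\<Sum>j\<in>{1..N}. b j * coord j z) = (\<Sum>j\<in>{1..N}. if j = i then b i * (z \<bullet> e i) else 0)"
    using i coord_eq coord_other by (intro sum.cong) auto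
  also have "\<dots> = b i * (z \<bullet> e i)" using i by simp
  finally show ?thesis by (simp add: \<psi>_def)
qed

lemma \<psi>_lipschitz:
  obtains K where "0 \<le> K" "\<And>z w. z \<in> S \<Longrightarrow> w \<in> S \<Longrightarrow> \<bar>\<psi> p b z - \<psi> p b w\<bar> \<le> K * norm (z - w)"
proof -
  obtain K0 where K0: "1 \<le> K0" "\<And>i z w. i \<in> {1..N} \<Longrightarrow> z \<in> S \<Longrightarrow> w \<in> S \<Longrightarrow> \<bar>coord i z - coord i w\<bar> \<le> K0 * norm (z - w)"
    using coord_lipschitz by blast
  show ?thesis
  proof (rule that)
    show "0 \<le> \<bar>p\<bar> + (\<Sum>i\<in>{1..N}. \<bar>b i\<bar> * K0)" using K0 by (intro add_nonneg_nonneg sum_nonneg) auto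
    fix z w assume zw: "z \<in> S" "w \<in> S"
    have "\<psi> p b z - \<psi> p b w = p * ((z - w) \<bullet> e 0) + (\<Sum>i\<in>{1..N}. b i * (coord i z - coord i w))"
      by (simp add: \<psi>_def sum_subtractf algebra_simps inner_diff_left)
    also have "\<bar>\<dots>\<bar> \<le> \<bar>p * ((z - w) \<bullet> e 0)\<bar> + \<bar>\<Sum>i\<in>{1..N}. b i * (coord i z - coord i w)\<bar>"
      by (rule abs_triangle_ineq)
    also have "\<dots> \<le> \<bar>p\<bar> * norm (z - w) + (\<Sum>i\<in>{1..N}. \<bar>b i\<bar> * (K0 * norm (z - w)))"
    proof (rule add_mono)
      show "\<bar>p * ((z - w) \<bullet> e 0)\<bar> \<le> \<bar>p\<bar> * norm (z - w)"
        unfolding abs_mult by (intro mult_left_mono component0_le) simp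
      show "\<bar>\<Sum>i\<in>{1..N}. b i * (coord i z - coord i w)\<bar> \<le> (\<Sum>i\<in>{1..N}. \<bar>b i\<bar> * (K0 * norm (z - w)))"
        using K0(2) zw by (intro order_trans[OF sum_abs] sum_mono) (auto simp: abs_mult intro!: mult_left_mono)
    qed
    also have "\<dots> = (\<bar>p\<bar> + (\<Sum>i\<in>{1..N}. \<bar>b i\<bar> * K0)) * norm (z - w)"
      by (simp add: algebra_simps sum_distrib_left)
    finally show "\<bar>\<psi> p b z - \<psi> p b w\<bar> \<le> (\<bar>p\<bar> + (\<Sum>i\<in>{1..N}. \<bar>b i\<bar> * K0)) * norm (z - w)" .
  qed
qed

lemma d\<psi>_cont: "i \<in> {1..N} \<Longrightarrow> continuous_on (P i \<times> A i) (\<lambda>(x, a). d\<psi> p b i x a)"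
  using f_cont[of i] unfolding d\<psi>_def case_prod_unfold by (intro continuous_intros) auto

lemma d\<psi>_bound:
  assumes i: "i \<in> {1..N}" "x \<in> P i" "a \<in> A i"
  shows "\<bar>d\<psi> p b i x a\<bar> \<le> (\<bar>p\<bar> + (\<Sum>i\<in>{1..N}. \<bar>b i\<bar>)) * M"
proof -
  have "\<bar>d\<psi> p b i x a\<bar> \<le> \<bar>p * (f i x a \<bullet> e 0)\<bar> + \<bar>b i * (f i x a \<bullet> e i)\<bar>"
    unfolding d\<psi>_def by (rule abs_triangle_ineq)
  also have "\<dots> \<le> \<bar>p\<bar> * M + \<bar>b i\<bar> * M"
    unfolding abs_mult using f_bound[OF i] component0_le[of "f i x a"] component_le[OF i(1), of "f i x a"]
    by (intro add_mono mult_left_mono) auto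
  also have "\<bar>b i\<bar> \<le> (\<Sum>i\<in>{1..N}. \<bar>b i\<bar>)" using i by (intro member_le_sum) auto
  finally show ?thesis using M_pos by (simp add: algebra_simps)
qed

text \<open>Bounds all normal coordinates at once by the norm of a vector that is linear in z, so
  its derivative along a trajectory is available without knowing which half-plane the trajectory is
  in.\<close>

lemma coord_le_normal: "i \<in> {1..N} \<Longrightarrow> z \<in> S \<Longrightarrow> \<bar>coord i z\<bar> \<le> norm (z - (z \<bullet> e 0) *\<^sub>R e 0)"
proof -
  assume i: "i \<in> {1..N}" and "z \<in> S"
  have "z \<in> P i \<Longrightarrow> z - (z \<bullet> e 0) *\<^sub>R e 0 = (z \<bullet> e i) *\<^sub>R e i"
    using P_plane[OF i] plane_iff[OF i] by (metis add_diff_cancel_left')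
  then show ?thesis using i by (simp add: coord_def)
qed

text \<open>The trajectory may cross \<open>\<Gamma>\<close> infinitely often. At almost every time spent on \<open>\<Gamma>\<close> the set of such
  times accumulates, so the velocity there is tangential and all normal coordinates have derivative zero.\<close>

lemma chain_rule:
  assumes tr: "(y, \<alpha>) \<in> Traj x" and T: "0 \<le> T"
  shows "((\<lambda>s. G (d\<psi> p b) (y s) (\<alpha> s)) has_integral (\<psi> p b (y T) - \<psi> p b (y 0))) {0..T}"
proof -
  note D = trajectoriesD[OF tr]
  obtain Z1 where Z1: "negligible Z1" "\<And>t. t \<in> {0..} - Z1 \<Longrightarrow> (y t, \<alpha> t) \<in> Ctrl"
    using D(1) unfolding admissible_def by blast
  obtain Z2 where Z2: "negligible Z2" "\<And>s. s \<notin> Z2 \<Longrightarrow> 0 < s \<Longrightarrow> (y has_vector_derivative V y \<alpha> s) (at s)"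
    using ae_has_vector_derivative_of_integral[of "V y \<alpha>" y] has_integral_of_primitive[OF D(4)] by blast
  define W where "W = {t \<in> {0..T}. y t \<in> \<Gamma>}"
  \<comment> \<open>0 is exceptional because derivatives are known at positive times, and the
    isolated times on \<Gamma> because no limit can be taken there within \<open>W\<close>.\<close>
  define Z where "Z = insert 0 (Z1 \<union> Z2 \<union> {t \<in> W. \<not> t islimpt W})"
  have "negligible {t \<in> W. \<not> t islimpt W}"
    unfolding negligible_iff_null_sets
    by (intro null_sets_completionI countable_imp_null_set_lborel countable_isolated_points)
  then have Z: "negligible Z" using Z1 Z2 by (simp add: Z_def)
  have lip: "M-lipschitz_on {0..} y" using D(1,4) by (rule trajectory_lipschitz)
  obtain K where K: "0 \<le> K" "\<And>z w. z \<in> S \<Longrightarrow> w \<in> S \<Longrightarrow> \<bar>\<psi> p b z - \<psi> p b w\<bar> \<le> K * norm (z - w)"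
    using \<psi>_lipschitz by blast
  let ?h = "\<lambda>t. \<psi> p b (y t)"
  let ?g = "\<lambda>s. G (d\<psi> p b) (y s) (\<alpha> s)"
  have hl: "(K * M)-lipschitz_on {0..T} ?h"
  proof (rule lipschitz_onI)
    fix s t assume st: "s \<in> {0..T}" "t \<in> {0..T}"
    have "\<bar>?h s - ?h t\<bar> \<le> K * norm (y s - y t)" using st D(2) by (intro K) auto
    also have "\<dots> \<le> K * (M * dist s t)"
      using lipschitz_onD[OF lip, of s t] st K(1) by (intro mult_left_mono) (auto simp: dist_norm)
    finally show "dist (?h s) (?h t) \<le> K * M * dist s t" by (simp add: dist_norm mult.assoc)
  qed (use K M_pos in simp)
  have der: "(?h has_vector_derivative ?g s) (at s within {0..T})" if s: "s \<in> {0..T} - Z" for s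
  proof -
    have s0: "0 < s" "s \<le> T" "s \<notin> Z1" "s \<notin> Z2" using s by (auto simp: Z_def)
    obtain j where j: "j \<in> {1..N}" "y s \<in> P j" "\<alpha> s \<in> A j"
      using Z1(2)[of s] s0 unfolding ctrl_set_iff by auto
    have gs: "?g s = p * (V y \<alpha> s \<bullet> e 0) + b j * (V y \<alpha> s \<bullet> e j)"
      using glue_eq[OF j, of f] glue_eq[OF j, of "d\<psi> p b"] by (simp add: d\<psi>_def)
    have dy: "(y has_vector_derivative V y \<alpha> s) (at s within X)" for X
      using Z2(2)[of s] s0 by (auto intro: has_vector_derivative_at_within)
    have dyc: "((\<lambda>t. y t \<bullet> c) has_vector_derivative (V y \<alpha> s \<bullet> c)) (at s within X)" for X c
      using bounded_linear.has_vector_derivative[OF bounded_linear_inner_left dy] .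
    show ?thesis
    proof (cases "y s \<in> \<Gamma>")
      case False
      have lin: "((\<lambda>t. p * (y t \<bullet> e 0) + b j * (y t \<bullet> e j)) has_vector_derivative ?g s) (at s within {0..T})"
        unfolding gs by (intro has_vector_derivative_add has_vector_derivative_mult_right dyc)
      have pos: "0 < coord j (y s)"
        using j False coord_eq[OF j(1,2)] G_P_iff[OF j(1,2)] coord_nonneg[OF j(1), of "y s"] by auto
      obtain K0 where K0: "1 \<le> K0" "\<And>i z w. i \<in> {1..N} \<Longrightarrow> z \<in> S \<Longrightarrow> w \<in> S \<Longrightarrow> \<bar>coord i z - coord i w\<bar> \<le> K0 * norm (z - w)"
        using coord_lipschitz by blast
      \<comment> \<open>In less time than this the j-th coordinate, which is
        \<open>K0\<close>-Lipschitz along a path of speed at most \<open>M\<close>, cannot drop to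
        zero.\<close>
      have inP: "y t \<in> P j" if t: "t \<in> {0..T}" "dist t s < coord j (y s) / (K0 * M)" for t
      proof -
        have "\<bar>coord j (y t) - coord j (y s)\<bar> \<le> K0 * norm (y t - y s)" using t s0 D(2) j by (intro K0) auto
        also have "\<dots> \<le> K0 * (M * dist t s)"
          using lipschitz_onD[OF lip, of t s] t s0 K0(1) by (intro mult_left_mono) (auto simp: dist_norm)
        also have "\<dots> < coord j (y s)" using t(2) K0(1) M_pos by (simp add: field_simps)
        finally have "0 < coord j (y t)" by linarith
        then show ?thesis by (auto simp: coord_def split: if_splits)
      qed
      show ?thesis
        unfolding has_vector_derivative_def
      proof (rule has_derivative_transform_within[OF lin[unfolded has_vector_derivative_def]])
        show "0 < coord j (y s) / (K0 * M)" using pos K0(1) M_pos by simp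
        fix t assume "t \<in> {0..T}" "dist t s < coord j (y s) / (K0 * M)"
        then show "p * (y t \<bullet> e 0) + b j * (y t \<bullet> e j) = ?h t" using inP \<psi>_eq[OF j(1)] by simp
      qed (use s in simp)
    next
      case True
      then have "s islimpt W" using s by (auto simp: Z_def W_def)
      have "(\<lambda>t. y t \<bullet> e j) t = (\<lambda>t. 0) t" if "t \<in> W" for t
        using that G_P_iff[OF j(1) G_sub_P[OF j(1)]] by (auto simp: W_def)
      then have "((\<lambda>t. 0) has_vector_derivative (V y \<alpha> s \<bullet> e j)) (at s within W)"
        using has_vector_derivative_transform[of s W "\<lambda>t. 0" "\<lambda>t. y t \<bullet> e j"] dyc True s0
        by (auto simp: W_def)
      then have Vj: "V y \<alpha> s \<bullet> e j = 0"
        using vector_derivative_unique_within[of s W "\<lambda>t. 0" _ 0] \<open>s islimpt W\<close>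
        by (auto simp: trivial_limit_within)
      have "V y \<alpha> s \<in> plane e j" using glue_eq[OF j, of f] f_plane[OF j] by simp
      then have "V y \<alpha> s = (V y \<alpha> s \<bullet> e 0) *\<^sub>R e 0" using plane_iff[OF j(1)] Vj by simp
      then have q0: "V y \<alpha> s - (V y \<alpha> s \<bullet> e 0) *\<^sub>R e 0 = 0" by simp
      let ?q = "\<lambda>t. y t - (y t \<bullet> e 0) *\<^sub>R e 0"
      have "(?q has_vector_derivative (V y \<alpha> s - (V y \<alpha> s \<bullet> e 0) *\<^sub>R e 0)) (at s within {0..T})"
        by (intro has_vector_derivative_diff dy
            bounded_linear.has_vector_derivative[OF bounded_linear_scaleR_left dyc])
      then have dq: "(?q has_vector_derivative 0) (at s within {0..T})" by (simp only: q0)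
      \<comment> \<open>Near this time the trajectory may visit every half-plane, so the coordinate
        of each has to be differentiated. All are dominated by \<open>?q\<close>, which vanishes to
        first order.\<close>
      have dc: "((\<lambda>t. coord i (y t)) has_vector_derivative 0) (at s within {0..T})" if i: "i \<in> {1..N}" for i
      proof (rule has_vector_derivative_zero_squeeze[OF dq])
        fix r assume "r \<in> {0..T}"
        then have "\<bar>coord i (y r)\<bar> \<le> norm (?q r)" using coord_le_normal[OF i D(2)] by simp
        moreover have "?q s = 0" using True G_iff by simp
        ultimately show "norm (coord i (y r) - coord i (y s)) \<le> norm (?q r - ?q s)"
          using coord_G[OF i True] by simp
      qed
      have "(?h has_vector_derivative (p * (V y \<alpha> s \<bullet> e 0) + (\<Sum>i\<in>{1..N}. b i * 0))) (at s within {0..T})"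
        unfolding \<psi>_def
        by (intro has_vector_derivative_add has_vector_derivative_mult_right has_vector_derivative_sum dyc dc)
      then show ?thesis unfolding gs by (simp add: Vj)
    qed
  qed
  \<comment> \<open>Zero on the exceptional set, so that the bound on the integrand holds at every
    time.\<close>
  define g0 where "g0 s = (if s \<in> Z then 0 else ?g s)" for s
  have "(g0 has_integral (?h T - ?h 0)) {0..T}"
  proof (rule lipschitz_ae_derivative_has_integral[OF hl Z _ T])
    show "(?h has_vector_derivative g0 s) (at s within {0..T})" if "s \<in> {0..T} - Z" for s
      using der[OF that] that by (simp add: g0_def)
    show "g0 integrable_on {0..t}" for t
    proof (rule integrable_spike[OF _ Z])
      show "?g integrable_on {0..t}"
        using d\<psi>_bound
        by (intro integrable_on_lebesgue_on
            glue_integrable[where K = "(\<bar>p\<bar> + (\<Sum>i\<in>{1..N}. \<bar>b i\<bar>)) * M"] d\<psi>_cont D(1)) auto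
    qed (simp add: g0_def)
    fix t assume "t \<in> {0..T}"
    show "\<bar>g0 t\<bar> \<le> (\<bar>p\<bar> + (\<Sum>i\<in>{1..N}. \<bar>b i\<bar>)) * M"
    proof (cases "t \<in> Z")
      case True
      then show ?thesis using M_pos by (simp add: g0_def sum_nonneg)
    next
      case False
      then obtain i where "i \<in> {1..N}" "y t \<in> P i" "\<alpha> t \<in> A i"
        using Z1(2)[of t] \<open>t \<in> {0..T}\<close> unfolding ctrl_set_iff by (auto simp: Z_def)
      then show ?thesis using d\<psi>_bound[of i "y t" "\<alpha> t"] glue_eq[of i "y t" "\<alpha> t" "d\<psi> p b"] False by (simp add: g0_def)
    qed
  qed
  then show ?thesis
    by (rule has_integral_spike[OF Z, rotated]) (simp add: g0_def)
qed


section \<open>Viscosity inequalities for linearised test functions\<close>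

lemma discount_bounds:
  assumes "0 \<le> s" "s \<le> t"
  shows "1 - lam * t \<le> exp (- lam * s)" "exp (- lam * s) \<le> 1"
    "exp (- lam * t) * c \<le> c - lam * t * c + lam\<^sup>2 * t\<^sup>2 * \<bar>c\<bar>"
    "c - lam * t * c - lam\<^sup>2 * t\<^sup>2 * \<bar>c\<bar> \<le> exp (- lam * t) * c"
proof -
  have "1 - lam * s \<le> exp (- lam * s)" using exp_minus_bounds(1)[of "lam * s"] assms lam by simp
  moreover have "lam * s \<le> lam * t" using assms lam by simp
  ultimately show "1 - lam * t \<le> exp (- lam * s)" by linarith
  show "exp (- lam * s) \<le> 1" using assms lam by simp
  have "\<bar>exp (- lam * t) - (1 - lam * t)\<bar> \<le> (lam * t)\<^sup>2"
    using exp_minus_bounds[of "lam * t"] assms lam by (simp add: abs_le_iff)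
  then have "\<bar>exp (- lam * t) - (1 - lam * t)\<bar> * \<bar>c\<bar> \<le> (lam * t)\<^sup>2 * \<bar>c\<bar>" by (intro mult_right_mono) auto
  then have "\<bar>(exp (- lam * t) - (1 - lam * t)) * c\<bar> \<le> lam\<^sup>2 * t\<^sup>2 * \<bar>c\<bar>"
    by (simp add: abs_mult power_mult_distrib)
  then have "\<bar>exp (- lam * t) * c - (c - lam * t * c)\<bar> \<le> lam\<^sup>2 * t\<^sup>2 * \<bar>c\<bar>"
    by (simp add: algebra_simps)
  then show "exp (- lam * t) * c \<le> c - lam * t * c + lam\<^sup>2 * t\<^sup>2 * \<bar>c\<bar>"
    "c - lam * t * c - lam\<^sup>2 * t\<^sup>2 * \<bar>c\<bar> \<le> exp (- lam * t) * c" by linarith+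
qed

lemma discounted_cost_bounds:
  assumes "\<bar>c\<bar> \<le> B" "0 \<le> s" "s \<le> t"
  shows "c - B * lam * t \<le> c * exp (- lam * s)" "c * exp (- lam * s) \<le> c + B * lam * t"
proof -
  have "\<bar>c\<bar> * \<bar>exp (- lam * s) - 1\<bar> \<le> B * (lam * t)"
    using discount_bounds(1,2)[OF assms(2,3)] assms(1) by (intro mult_mono) auto
  then have "\<bar>c * exp (- lam * s) - c\<bar> \<le> B * lam * t"
    by (simp add: algebra_simps flip: abs_mult)
  then show "c - B * lam * t \<le> c * exp (- lam * s)" "c * exp (- lam * s) \<le> c + B * lam * t" by linarith+
qed

text \<open>An increment c of size O(t) changes only by O(t^2) under discounting, so it can be used
  undiscounted. The nonnegative error R is kept as it is.\<close>

lemma discount_mult_lower: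
  assumes "0 \<le> t" "\<bar>c\<bar> \<le> k" "0 \<le> R"
  shows "c - lam * t * k - R \<le> exp (- lam * t) * (c - R)"
    and "exp (- lam * t) * (c + R) \<le> c + lam * t * k + R"
proof -
  have E: "1 - lam * t \<le> exp (- lam * t)" "exp (- lam * t) \<le> 1"
    using discount_bounds(1,2)[OF assms(1) order_refl] by auto
  have "\<bar>exp (- lam * t) - 1\<bar> * \<bar>c\<bar> \<le> (lam * t) * k" using E assms by (intro mult_mono) auto
  then have 1: "\<bar>exp (- lam * t) * c - c\<bar> \<le> lam * t * k" by (simp add: algebra_simps flip: abs_mult)
  have 2: "exp (- lam * t) * R \<le> R" using E assms(3) by (intro mult_left_le_one_le) auto
  show "c - lam * t * k - R \<le> exp (- lam * t) * (c - R)"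
    "exp (- lam * t) * (c + R) \<le> c + lam * t * k + R"
    using 1 2 by (simp_all add: algebra_simps)
qed

text \<open>The hypothesis on \<open>K\<close> has to cover also the controls that push against \<open>\<Gamma>\<close>, which do not enter
  \<open>H\<^sub>\<Gamma>\<close>; on \<open>\<Gamma>\<close> it is arranged with \<open>normal_multiplier\<close>.\<close>

lemma supersolution_inequality:
  assumes x: "x \<in> S" and above: "\<And>z. z \<in> S \<Longrightarrow> u z \<le> vr z"
    and approx: "\<And>\<eta> \<rho>. 0 < \<eta> \<Longrightarrow> 0 < \<rho> \<Longrightarrow> \<exists>z\<in>S. norm (z - x) < \<rho> \<and> vr z < u x + \<eta>"
    and r: "0 < r" and \<epsilon>: "0 \<le> \<epsilon>"
    and test: "\<And>z. z \<in> S \<Longrightarrow> norm (z - x) < r \<Longrightarrow> u x + (\<psi> p b z - \<psi> p b x) - \<epsilon> * norm (z - x) \<le> u z"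
    and ham: "\<And>i z a. i \<in> {1..N} \<Longrightarrow> z \<in> P i \<Longrightarrow> norm (z - x) < r \<Longrightarrow> a \<in> A i \<Longrightarrow>
        - K \<le> d\<psi> p b i z a + l i z a"
  shows "0 \<le> lam * u x + K + \<epsilon> * M"
proof -
  obtain k where k: "0 \<le> k" "\<And>z w. z \<in> S \<Longrightarrow> w \<in> S \<Longrightarrow> \<bar>\<psi> p b z - \<psi> p b w\<bar> \<le> k * norm (z - w)"
    using \<psi>_lipschitz by blast
  \<comment> \<open>For t < t0 one has t^2 + M t \<le> (1 + M) t < r, so a trajectory that starts
    within t^2 of x stays in the ball of the hypotheses up to time t.\<close>
  define t0 where "t0 = min 1 (r / (1 + M))"
  show ?thesis
  proof (rule nonneg_of_quadratic_lower_bound)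
    show "0 < t0" using r M_pos by (simp add: t0_def)
    fix t assume t: "0 < t" "t < t0"
    have tt: "t\<^sup>2 \<le> t" using t by (simp add: t0_def power2_eq_square mult_le_cancel_left1)
    have tr: "t\<^sup>2 + M * t < r"
    proof -
      have "t * (1 + M) < r" using t M_pos by (simp add: t0_def pos_less_divide_eq)
      then show ?thesis using tt by (simp add: algebra_simps)
    qed
    have t2: "0 < t\<^sup>2" using t by simp
    obtain z where z: "z \<in> S" "norm (z - x) < t\<^sup>2" "vr z < u x + t\<^sup>2" using approx[OF t2 t2] by blast
    obtain y \<alpha> where tr_y: "(y, \<alpha>) \<in> Traj z"
      and dpp: "\<And>s. 0 \<le> s \<Longrightarrow> integral {0..s} (\<lambda>s. G l (y s) (\<alpha> s) * exp (- lam * s)) + exp (- lam * s) * vr (y s) \<le> vr z + t\<^sup>2"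
      using dpp_trajectory[OF z(1) t2] by blast
    note D = trajectoriesD[OF tr_y]
    have y0: "y 0 = z" by (rule D(3))
    have near: "norm (y s - x) \<le> t\<^sup>2 + M * t" if s: "0 \<le> s" "s \<le> t" for s
    proof -
      have "norm (y s - z) \<le> M * (s - 0)"
        using admissible_increment_bound[OF D(1) order_refl s(1) D(4)[OF s(1)]] .
      also have "\<dots> \<le> M * t" using s M_pos by simp
      finally show ?thesis using z(2) norm_triangle_ineq[of "y s - z" "z - x"] by simp
    qed
    define \<Delta> where "\<Delta> = \<psi> p b (y t) - \<psi> p b z"
    define I where "I = integral {0..t} (\<lambda>s. G l (y s) (\<alpha> s) * exp (- lam * s))"
    have I: "((\<lambda>s. G l (y s) (\<alpha> s) * exp (- lam * s)) has_integral I) {0..t}"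
    proof -
      have "(\<lambda>s. G l (y s) (\<alpha> s) * exp (- lam * s)) integrable_on {0..}"
        by (rule integrable_on_lebesgue_on[OF admissible_cost_integrable(1)[OF D(1)]]) simp
      then have "(\<lambda>s. G l (y s) (\<alpha> s) * exp (- lam * s)) integrable_on {0..t}"
        by (rule integrable_on_subinterval[where a = 0 and b = t, unfolded box_real]) auto
      then show ?thesis unfolding I_def by (rule integrable_integral)
    qed
    obtain Z where Z: "negligible Z" "\<And>t. t \<in> {0..} - Z \<Longrightarrow> (y t, \<alpha> t) \<in> Ctrl"
      using D(1) unfolding admissible_def by blast
    \<comment> \<open>By the chain rule \<open>d\<psi>\<close> integrates to the increment \<Delta>,
      so the pointwise bound on \<open>d\<psi>\<close> plus running cost becomes a lower bound for
      the cost of the trajectory; \<open>B * lam * t\<close> pays for the discount.\<close>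
    have lower: "((\<lambda>s. (- K - B * lam * t) - G (d\<psi> p b) (y s) (\<alpha> s)) has_integral
        ((- K - B * lam * t) * t - \<Delta>)) {0..t}"
      unfolding \<Delta>_def y0[symmetric] using t has_integral_const_real[of "- K - B * lam * t" 0 t]
      by (intro has_integral_diff chain_rule[OF tr_y]) (auto simp: mult.commute)
    have J: "(- K - B * lam * t) * t - \<Delta> \<le> I"
    proof (rule has_integral_le_negligible[OF lower I Z(1)])
      fix s assume s: "s \<in> {0..t} - Z"
      obtain i where i: "i \<in> {1..N}" "y s \<in> P i" "\<alpha> s \<in> A i"
        using Z(2)[of s] s unfolding ctrl_set_iff by auto
      have "- K \<le> d\<psi> p b i (y s) (\<alpha> s) + l i (y s) (\<alpha> s)"
        using near[of s] s tr i by (intro ham) auto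
      moreover have "l i (y s) (\<alpha> s) - B * lam * t \<le> l i (y s) (\<alpha> s) * exp (- lam * s)"
        using s l_bound[OF i] by (intro discounted_cost_bounds) auto
      ultimately show "- K - B * lam * t - G (d\<psi> p b) (y s) (\<alpha> s) \<le> G l (y s) (\<alpha> s) * exp (- lam * s)"
        using glue_eq[OF i, of l] glue_eq[OF i, of "d\<psi> p b"] by simp
    qed
    \<comment> \<open>The first term accounts for starting at \<open>z\<close> instead of
      \<open>x\<close>, the second for the error of the test inequality. Only \<epsilon> M t is of
      first order; it becomes the term \<epsilon> M of the conclusion.\<close>
    define R where "R = k * t\<^sup>2 + \<epsilon> * (t\<^sup>2 + M * t)"
    have R: "0 \<le> R" using k(1) \<epsilon> t M_pos by (simp add: R_def)
    have ytS: "y t \<in> S" using D(2) t by simp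
    have "u x + (\<Delta> - R) \<le> vr (y t)"
    proof -
      have "\<epsilon> * norm (y t - x) \<le> \<epsilon> * (t\<^sup>2 + M * t)" using near[of t] t \<epsilon> by (intro mult_left_mono) auto
      moreover have "\<bar>\<psi> p b z - \<psi> p b x\<bar> \<le> k * t\<^sup>2"
        using k(2)[OF z(1) x] mult_left_mono[OF less_imp_le[OF z(2)] k(1)] by linarith
      moreover have "u x + (\<psi> p b (y t) - \<psi> p b x) - \<epsilon> * norm (y t - x) \<le> u (y t)"
        using near[of t] t tr by (intro test ytS) auto
      ultimately show ?thesis using above[OF ytS] unfolding \<Delta>_def R_def by linarith
    qed
    then have "exp (- lam * t) * (u x + (\<Delta> - R)) \<le> exp (- lam * t) * vr (y t)" by (intro mult_left_mono) auto
    moreover have "exp (- lam * t) * (u x + (\<Delta> - R)) = exp (- lam * t) * u x + exp (- lam * t) * (\<Delta> - R)"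
      by (simp add: algebra_simps)
    moreover have "u x - lam * t * u x - lam\<^sup>2 * t\<^sup>2 * \<bar>u x\<bar> \<le> exp (- lam * t) * u x"
      using t by (intro discount_bounds(4)[of 0]) auto
    moreover have "\<Delta> - lam * t * (k * M * t) - R \<le> exp (- lam * t) * (\<Delta> - R)"
    proof (rule discount_mult_lower(1)[OF _ _ R])
      have "norm (y t - z) \<le> M * (t - 0)"
        using t by (intro admissible_increment_bound[OF D(1) order_refl _ D(4)]) auto
      then have "k * norm (y t - z) \<le> k * (M * t)" using k(1) by (intro mult_left_mono) auto
      then show "\<bar>\<Delta>\<bar> \<le> k * M * t" using k(2)[OF ytS z(1)] unfolding \<Delta>_def by (simp add: mult.assoc)
    qed (use t in simp)
    moreover have "I + exp (- lam * t) * vr (y t) \<le> vr z + t\<^sup>2" unfolding I_def using dpp[of t] t by simp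
    ultimately have "(- K - B * lam * t) * t + (u x - lam * t * u x - lam\<^sup>2 * t\<^sup>2 * \<bar>u x\<bar>)
        - lam * t * (k * M * t) - R \<le> u x + 2 * t\<^sup>2"
      using J z(3) by linarith
    then show "- (2 + B * lam + lam * k * M + k + \<epsilon> + lam\<^sup>2 * \<bar>u x\<bar>) * t\<^sup>2 \<le> t * (lam * u x + K + \<epsilon> * M)"
      unfolding R_def by (simp add: algebra_simps power2_eq_square)
  qed
qed

text \<open>Run the constant control \<open>a\<close> from points of \<open>P i\<close> that nearly
  realise \<open>u x\<close>. Off \<Gamma> the condition \<open>inward\<close> is made empty by a
  small \<open>r\<close>. The velocity is Lipschitz, so its variation is O(t) on the arc; the
  running cost is merely uniformly continuous, so its variation is absorbed by \<kappa>.\<close>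

lemma subsolution_inequality:
  assumes i: "i \<in> {1..N}" and x: "x \<in> P i" and a: "a \<in> A i"
    and below: "\<And>z. z \<in> S \<Longrightarrow> vr z \<le> u z"
    and approx: "\<And>\<eta> \<rho>. 0 < \<eta> \<Longrightarrow> 0 < \<rho> \<Longrightarrow> \<exists>z\<in>P i. norm (z - x) < \<rho> \<and> u x - \<eta> < vr z"
    and r: "0 < r" and \<epsilon>: "0 \<le> \<epsilon>"
    and test: "\<And>z. z \<in> P i \<Longrightarrow> norm (z - x) < r \<Longrightarrow> u z \<le> u x + q \<bullet> (z - x) + \<epsilon> * norm (z - x)"
    and inward: "\<And>w. w \<in> \<Gamma> \<Longrightarrow> norm (w - x) < r \<Longrightarrow> 0 \<le> f i w a \<bullet> e i"
  shows "lam * u x \<le> q \<bullet> f i x a + l i x a + \<epsilon> * M"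
proof (rule field_le_epsilon)
  fix \<kappa> :: real assume "0 < \<kappa>"
  then obtain d where d: "0 < d" "\<And>w. w \<in> P i \<Longrightarrow> norm (w - x) < d \<Longrightarrow> \<bar>l i w a - l i x a\<bar> \<le> \<kappa>"
    using l_unif[of \<kappa>] i x a by metis
  \<comment> \<open>\<open>piece_exists\<close> looks at the points of \<Gamma> within 2 M t of
    \<open>z\<close>; adding |z - x| < t^2 \<le> t gives the factor 1 + 2 M.\<close>
  define t0 where "t0 = min 1 (min r d / (1 + 2 * M))"
  have "0 \<le> q \<bullet> f i x a + l i x a + \<epsilon> * M + \<kappa> - lam * u x"
  proof (rule nonneg_of_quadratic_lower_bound)
    show "0 < t0" using r d M_pos by (simp add: t0_def)
    fix t assume t: "0 < t" "t < t0"
    have tt: "t\<^sup>2 \<le> t" using t by (simp add: t0_def power2_eq_square mult_le_cancel_left1)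
    have "t * (1 + 2 * M) < min r d" using t M_pos by (simp add: t0_def pos_less_divide_eq)
    then have tr2: "t * (1 + 2 * M) < r" "t * (1 + 2 * M) < d" by simp_all
    define m where "m = t * (1 + M)"
    have tm: "t\<^sup>2 + M * t \<le> m" "m < r" "m < d" "0 \<le> m"
    proof -
      define v where "v = M * t"
      have v: "0 \<le> v" using t M_pos by (simp add: v_def)
      have m: "m = t + v" by (simp add: m_def v_def algebra_simps)
      have "t * (1 + 2 * M) = m + v" by (simp add: m_def v_def algebra_simps)
      then have tr3: "m + v < r" "m + v < d" using tr2 by simp_all
      show "t\<^sup>2 + M * t \<le> m" using tt unfolding m v_def by simp
      show "m < r" using tr3(1) v by simp
      show "m < d" using tr3(2) v by simp
      show "0 \<le> m" using v t(1) unfolding m by simp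
    qed
    have t2: "0 < t\<^sup>2" using t by simp
    obtain z where z: "z \<in> P i" "norm (z - x) < t\<^sup>2" "u x - t\<^sup>2 < vr z" using approx[OF t2 t2] by blast
    have inw: "0 \<le> f i w a \<bullet> e i" if "w \<in> \<Gamma>" "norm (w - z) \<le> 2 * M * t" for w
    proof (rule inward[OF that(1)])
      have "norm (w - x) \<le> norm (w - z) + norm (z - x)" using norm_triangle_ineq[of "w - z" "z - x"] by simp
      also have "\<dots> < t * (1 + 2 * M)" using that z tt by (simp add: algebra_simps)
      finally show "norm (w - x) < r" using tr2 by simp
    qed
    obtain y where p: "piece i a t y" and y0: "y 0 = z" and yc: "continuous_on {0..t} y"
      and yM: "\<And>s. 0 \<le> s \<Longrightarrow> s \<le> t \<Longrightarrow> norm (y s - z) \<le> M * s"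
      using piece_exists[OF i a z(1) less_imp_le[OF t(1)] inw] by blast
    have yP: "y s \<in> P i" if "0 \<le> s" "s \<le> t" for s using p that by (auto simp: piece_def)
    have near: "norm (y s - x) \<le> t\<^sup>2 + M * t" if s: "0 \<le> s" "s \<le> t" for s
    proof -
      have "norm (y s - z) \<le> M * t" using yM[OF s] s M_pos mult_left_mono[of s t M] by linarith
      then show ?thesis using z(2) norm_triangle_ineq[of "y s - z" "z - x"] by simp
    qed
    have "((\<lambda>s. l i (y s) a * exp (- lam * s)) has_integral
        integral {0..t} (\<lambda>s. l i (y s) a * exp (- lam * s))) {0..t}"
      using i a p yc by (rule piece_cost_has_integral)
    moreover have "((\<lambda>s. l i x a + \<kappa> + B * lam * t) has_integral ((l i x a + \<kappa> + B * lam * t) * t)) {0..t}"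
      using has_integral_const_real[of "l i x a + \<kappa> + B * lam * t" 0 t] t by (simp add: mult.commute)
    ultimately have I: "integral {0..t} (\<lambda>s. l i (y s) a * exp (- lam * s)) \<le> (l i x a + \<kappa> + B * lam * t) * t"
    proof (rule has_integral_le)
      fix s assume s: "s \<in> {0..t}"
      have "l i (y s) a * exp (- lam * s) \<le> l i (y s) a + B * lam * t"
        using s l_bound[OF i yP a] by (intro discounted_cost_bounds) auto
      moreover have "\<bar>l i (y s) a - l i x a\<bar> \<le> \<kappa>" using s near[of s] tm yP by (intro d(2)) auto
      ultimately show "l i (y s) a * exp (- lam * s) \<le> l i x a + \<kappa> + B * lam * t" by linarith
    qed
    have "((\<lambda>s. f i (y s) a) has_integral (y t - z)) {0..t}" using p t y0 by (auto simp: piece_def)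
    then have "((\<lambda>s. f i (y s) a \<bullet> q) has_integral ((y t - z) \<bullet> q)) {0..t}" by (rule has_integral_inner_const)
    moreover have "((\<lambda>s. q \<bullet> f i x a + norm q * Lf * m) has_integral ((q \<bullet> f i x a + norm q * Lf * m) * t)) {0..t}"
      using has_integral_const_real[of "q \<bullet> f i x a + norm q * Lf * m" 0 t] t by (simp add: mult.commute)
    ultimately have Q: "(y t - z) \<bullet> q \<le> (q \<bullet> f i x a + norm q * Lf * m) * t"
    proof (rule has_integral_le)
      fix s assume s: "s \<in> {0..t}"
      have "f i (y s) a \<bullet> q = q \<bullet> f i x a + q \<bullet> (f i (y s) a - f i x a)"
        by (simp add: inner_diff_right inner_commute)
      also have "q \<bullet> (f i (y s) a - f i x a) \<le> norm q * norm (f i (y s) a - f i x a)"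
        by (rule norm_cauchy_schwarz)
      also have "\<dots> \<le> norm q * (Lf * norm (y s - x))"
        using s f_lip[OF i yP x a] by (intro mult_left_mono) auto
      also have "\<dots> \<le> norm q * (Lf * m)"
        using near[of s] s tm Lf_pos by (intro mult_left_mono) auto
      finally show "f i (y s) a \<bullet> q \<le> q \<bullet> f i x a + norm q * Lf * m" by (simp add: mult.assoc)
    qed
    define D where "D = q \<bullet> (y t - x)"
    define R where "R = \<epsilon> * (t\<^sup>2 + M * t)"
    have R: "0 \<le> R" using \<epsilon> t M_pos by (simp add: R_def)
    have nt: "norm (y t - x) \<le> t\<^sup>2 + M * t" using near[of t] t by simp
    have Db: "\<bar>D\<bar> \<le> norm q * m"
      using Cauchy_Schwarz_ineq2[of q "y t - x"] mult_left_mono[of "norm (y t - x)" m "norm q"] nt tm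
      unfolding D_def by simp
    have "q \<bullet> (z - x) \<le> norm q * t\<^sup>2"
      using norm_cauchy_schwarz[of q "z - x"] mult_left_mono[of "norm (z - x)" "t\<^sup>2" "norm q"] z(2) by simp
    then have DQ: "D \<le> (q \<bullet> f i x a + norm q * Lf * m) * t + norm q * t\<^sup>2"
      using Q unfolding D_def by (simp add: inner_diff_right inner_diff_left inner_commute)
    have "vr (y t) \<le> u x + (D + R)"
    proof -
      have "vr (y t) \<le> u (y t)" using t yP[of t] P_sub_S[OF i] by (intro below) auto
      moreover have "u (y t) \<le> u x + q \<bullet> (y t - x) + \<epsilon> * norm (y t - x)"
        using nt tm t yP by (intro test) auto
      moreover have "\<epsilon> * norm (y t - x) \<le> R" unfolding R_def using nt \<epsilon> by (intro mult_left_mono)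
      ultimately show ?thesis unfolding D_def by linarith
    qed
    then have "exp (- lam * t) * vr (y t) \<le> exp (- lam * t) * (u x + (D + R))" by (intro mult_left_mono) auto
    moreover have "exp (- lam * t) * (u x + (D + R)) = exp (- lam * t) * u x + exp (- lam * t) * (D + R)"
      by (simp add: algebra_simps)
    moreover have "exp (- lam * t) * u x \<le> u x - lam * t * u x + lam\<^sup>2 * t\<^sup>2 * \<bar>u x\<bar>"
      using t by (intro discount_bounds(3)[of 0]) auto
    moreover have "exp (- lam * t) * (D + R) \<le> D + lam * t * (norm q * m) + R"
      using t by (intro discount_mult_lower(2)[OF _ Db R]) simp
    moreover have "vr z \<le> integral {0..t} (\<lambda>s. l i (y s) a * exp (- lam * s)) + exp (- lam * t) * vr (y t)"
      using dpp_piece[OF i a p] y0 by simp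
    ultimately have "u x - t\<^sup>2 \<le> (l i x a + \<kappa> + B * lam * t) * t + (u x - lam * t * u x + lam\<^sup>2 * t\<^sup>2 * \<bar>u x\<bar>)
        + ((q \<bullet> f i x a + norm q * Lf * m) * t + norm q * t\<^sup>2) + lam * t * (norm q * m) + R"
      using I DQ z(3) by linarith
    then show "- (1 + B * lam + lam\<^sup>2 * \<bar>u x\<bar> + norm q * Lf * (1 + M) + norm q + lam * norm q * (1 + M) + \<epsilon>) * t\<^sup>2
        \<le> t * (q \<bullet> f i x a + l i x a + \<epsilon> * M + \<kappa> - lam * u x)"
      unfolding R_def m_def by (simp add: algebra_simps power2_eq_square)
  qed
  then show "lam * u x \<le> q \<bullet> f i x a + l i x a + \<epsilon> * M + \<kappa>" by simp
qed

end

section \<open>Envelopes\<close>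

lemma eventually_nhds_in_iff:
  "(\<forall>\<^sub>F z in inf (nhds x) (principal S). p z) \<longleftrightarrow> (\<exists>\<rho>>0. \<forall>z\<in>S. norm (z - x) < \<rho> \<longrightarrow> p z)" for x :: pt
  unfolding eventually_inf_principal eventually_nhds_metric by (auto simp: dist_norm)

lemma eventually_at_within_iff:
  "(\<forall>\<^sub>F z in at x within S. p z) \<longleftrightarrow> (\<exists>\<rho>>0. \<forall>z\<in>S. z \<noteq> x \<longrightarrow> norm (z - x) < \<rho> \<longrightarrow> p z)" for x :: pt
  unfolding eventually_at by (auto simp: dist_norm)

context
  fixes S :: "pt set" and u :: "pt \<Rightarrow> ereal" and w :: "pt \<Rightarrow> real" and C :: real
  assumes u: "\<And>z. z \<in> S \<Longrightarrow> u z = ereal (w z)" and w: "\<And>z. z \<in> S \<Longrightarrow> \<bar>w z\<bar> \<le> C"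
begin

lemma lower_envelope_ereal:
  assumes x: "x \<in> S"
  shows "Liminf (inf (nhds x) (principal S)) u = ereal (lower_envelope S u x)"
proof -
  let ?F = "inf (nhds x) (principal S)"
  have "ereal (- C) \<le> Liminf ?F u"
  proof (rule Liminf_bounded)
    have "ereal (- C) \<le> u z" if "z \<in> S" for z using u[OF that] w[OF that] by simp
    then show "\<forall>\<^sub>F z in ?F. ereal (- C) \<le> u z" unfolding eventually_nhds_in_iff by (auto intro: exI[of _ 1])
  qed
  moreover have "Liminf ?F u \<le> ereal C"
  proof (rule ccontr)
    assume "\<not> Liminf ?F u \<le> ereal C"
    \<comment> \<open>The filter includes \<open>x\<close> itself, so an eventual strict bound holds
      at \<open>x\<close>.\<close>
    then have "\<forall>\<^sub>F z in ?F. ereal C < u z" using le_Liminf_iff[of "Liminf ?F u" ?F u] by auto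
    then have "ereal C < u x" unfolding eventually_nhds_in_iff using x by auto
    then show False using u[OF x] w[OF x] by simp
  qed
  ultimately show ?thesis unfolding lower_envelope_def by (cases "Liminf ?F u") auto
qed

lemma lower_envelope_less:
  assumes x: "x \<in> S" and c: "c < lower_envelope S u x"
  shows "\<exists>\<rho>>0. \<forall>z\<in>S. norm (z - x) < \<rho> \<longrightarrow> c < w z"
proof -
  let ?F = "inf (nhds x) (principal S)"
  have "ereal c < Liminf ?F u" using lower_envelope_ereal[OF x] c by simp
  then have "\<forall>\<^sub>F z in ?F. ereal c < u z" using le_Liminf_iff[of "Liminf ?F u" ?F u] by auto
  then obtain \<rho> where "\<rho> > 0" "\<forall>z\<in>S. norm (z - x) < \<rho> \<longrightarrow> ereal c < u z"
    unfolding eventually_nhds_in_iff by blast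
  then show ?thesis using u by auto
qed

lemma lower_envelope_approx:
  assumes x: "x \<in> S" and c: "lower_envelope S u x < c" and \<rho>: "0 < \<rho>"
  shows "\<exists>z\<in>S. norm (z - x) < \<rho> \<and> w z < c"
proof (rule ccontr)
  let ?F = "inf (nhds x) (principal S)"
  assume "\<not> ?thesis"
  then have "\<forall>z\<in>S. norm (z - x) < \<rho> \<longrightarrow> ereal c \<le> u z" using u by force
  then have "\<forall>\<^sub>F z in ?F. ereal c \<le> u z" unfolding eventually_nhds_in_iff using \<rho> by blast
  then have "ereal c \<le> Liminf ?F u" by (rule Liminf_bounded)
  then show False using lower_envelope_ereal[OF x] c by simp
qed

lemma lower_envelope_le: "x \<in> S \<Longrightarrow> lower_envelope S u x \<le> w x"
  using lower_envelope_less[of x "w x"] by (metis diff_self less_irrefl norm_zero not_less)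

lemma lower_envelope_lsc: "lsc_on S (lower_envelope S u)"
  unfolding lsc_on_def
proof (intro ballI allI impI)
  fix x c assume x: "x \<in> S" and c: "c < lower_envelope S u x"
  \<comment> \<open>The bound above \<open>c'\<close> near x passes to the envelope at z only as a
    weak inequality; the gap between c and \<open>c'\<close> restores strictness.\<close>
  obtain c' where c': "c < c'" "c' < lower_envelope S u x" using c dense by blast
  obtain \<rho> where \<rho>: "\<rho> > 0" "\<And>z. z \<in> S \<Longrightarrow> norm (z - x) < \<rho> \<Longrightarrow> c' < w z"
    using lower_envelope_less[OF x c'(2)] by blast
  show "\<forall>\<^sub>F z in at x within S. c < lower_envelope S u z"
    unfolding eventually_at_within_iff
  proof (intro exI[of _ "\<rho> / 2"] conjI ballI impI)
    fix z assume z: "z \<in> S" "norm (z - x) < \<rho> / 2"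
    have "\<not> lower_envelope S u z < c'"
    proof
      assume "lower_envelope S u z < c'"
      then obtain z' where z': "z' \<in> S" "norm (z' - z) < \<rho> / 2" "w z' < c'"
        using lower_envelope_approx[OF z(1)] \<rho>(1) by (metis half_gt_zero)
      have "norm (z' - x) < \<rho>" using z z' norm_triangle_ineq[of "z' - z" "z - x"] by simp
      then show False using \<rho>(2)[OF z'(1)] z'(3) by simp
    qed
    then show "c < lower_envelope S u z" using c'(1) by simp
  qed (use \<rho> in simp)
qed

end

text \<open>Facts about upper envelopes are read off from lower envelopes of the negated
  function.\<close>

lemma upper_envelope_eq: "upper_envelope S u x = - lower_envelope S (\<lambda>z. - u z) x"
  unfolding upper_envelope_def lower_envelope_def by (simp add: ereal_Liminf_uminus)

lemma usc_on_iff_lsc_on_uminus: "usc_on S u \<longleftrightarrow> lsc_on S (\<lambda>z. - u z)"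
proof -
  have "usc_on S u" if "lsc_on S (\<lambda>z. - u z)"
    unfolding usc_on_def
  proof (intro ballI allI impI)
    fix x c assume "x \<in> S" "u x < c"
    then have "\<forall>\<^sub>F z in at x within S. - c < - u z" using that unfolding lsc_on_def by (metis neg_less_iff_less)
    then show "\<forall>\<^sub>F z in at x within S. u z < c" by simp
  qed
  moreover have "lsc_on S (\<lambda>z. - u z)" if "usc_on S u"
    unfolding lsc_on_def
  proof (intro ballI allI impI)
    fix x c assume "x \<in> S" "c < - u x"
    then have "\<forall>\<^sub>F z in at x within S. u z < - c" using that unfolding usc_on_def by (metis less_minus_iff)
    then show "\<forall>\<^sub>F z in at x within S. c < - u z" by (simp add: less_minus_iff)
  qed
  ultimately show ?thesis by blast
qed

section \<open>Test functions\<close>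

lemma at_zero_ray_neq_bot: "at (0::real) within {0..} \<noteq> bot"
proof -
  have "at_right (0::real) \<le> at 0 within {0..}" by (rule at_le) auto
  then show ?thesis using trivial_limit_at_right_real[of "0::real"] by (auto simp: bot_unique)
qed

context junction_geometry
begin

text \<open>Both derivatives are that of the restriction to the ray common to X and Y. With X = Y
  this gives uniqueness of the gradient in a half-plane; with two half-planes it compares tangential
  slopes.\<close>

lemma directional_derivative_unique:
  fixes \<phi> :: "pt \<Rightarrow> real"
  assumes "(\<phi> has_derivative (\<lambda>h. p \<bullet> h)) (at x within X)" "(\<phi> has_derivative (\<lambda>h. p' \<bullet> h)) (at x within Y)"
    and h: "\<And>s. 0 \<le> s \<Longrightarrow> x + s *\<^sub>R h \<in> X \<and> x + s *\<^sub>R h \<in> Y"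
  shows "p \<bullet> h = p' \<bullet> h"
proof -
  have *: "((\<lambda>s. \<phi> (x + s *\<^sub>R h)) has_vector_derivative (p \<bullet> h)) (at 0 within {0..})"
    if "(\<phi> has_derivative (\<lambda>h. p \<bullet> h)) (at x within X)" "\<And>s. 0 \<le> s \<Longrightarrow> x + s *\<^sub>R h \<in> X" for X p
  proof -
    have "(\<phi> has_derivative (\<lambda>h. p \<bullet> h)) (at (x + 0 *\<^sub>R h) within (\<lambda>s. x + s *\<^sub>R h) ` {0..})"
      using that by (intro has_derivative_subset[OF that(1)[THEN back_subst[of "\<lambda>z. (\<phi> has_derivative (\<lambda>h. p \<bullet> h)) (at z within X)"]]]) auto
    moreover have "((\<lambda>s. x + s *\<^sub>R h) has_derivative (\<lambda>s. s *\<^sub>R h)) (at 0 within {0..})"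
      by (auto intro!: derivative_eq_intros)
    ultimately have "((\<lambda>s. \<phi> (x + s *\<^sub>R h)) has_derivative (\<lambda>s. p \<bullet> (s *\<^sub>R h))) (at 0 within {0..})"
      using has_derivative_in_compose[of "\<lambda>s. x + s *\<^sub>R h" _ 0 "{0..}" \<phi>] by blast
    then show ?thesis by (simp add: has_vector_derivative_def)
  qed
  have "at (0::real) within {0..} \<noteq> bot" by (rule at_zero_ray_neq_bot)
  then show ?thesis
    using vector_derivative_unique_within[OF _ *[OF assms(1)] *[OF assms(2)]] h by blast
qed

lemma P_add: "i \<in> {1..N} \<Longrightarrow> x \<in> P i \<Longrightarrow> y \<in> P i \<Longrightarrow> x + y \<in> P i"
  unfolding P_iff plane_def by (auto simp: span_add inner_add_left)

lemma P_scale: "i \<in> {1..N} \<Longrightarrow> x \<in> P i \<Longrightarrow> 0 \<le> s \<Longrightarrow> s *\<^sub>R x \<in> P i"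
  unfolding P_iff plane_def by (auto simp: span_scale)

lemma e_in_P: "i \<in> {1..N} \<Longrightarrow> e i \<in> P i" "i \<in> {1..N} \<Longrightarrow> e 0 \<in> P i"
  unfolding P_iff plane_def by (auto intro: span_base)

text \<open>The vector representing the derivative on the plane is determined by its values on
  \<open>e 0\<close> and \<open>e i\<close>, and from any point of the closed half-plane both
  directions can be followed without leaving it. So the definite description is meaningful.\<close>

lemma inner_grad_has_derivative:
  fixes \<phi> :: "pt \<Rightarrow> real"
  assumes i: "i \<in> {1..N}" and x: "x \<in> P i" and d: "\<phi> differentiable (at x within P i)"
  shows "(\<phi> has_derivative (\<lambda>h. inner_grad e i \<phi> x \<bullet> h)) (at x within P i)"
proof -
  obtain D where D: "(\<phi> has_derivative D) (at x within P i)" using d unfolding differentiable_def by blast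
  then interpret D: bounded_linear D by (rule has_derivative_bounded_linear)
  define p where "p = D (e 0) *\<^sub>R e 0 + D (e i) *\<^sub>R e i"
  have pp: "p \<in> plane e i" unfolding p_def plane_def by (intro span_add span_scale span_base) auto
  have Dp: "D h = p \<bullet> h" if "h \<in> plane e i" for h
  proof -
    have "h = (h \<bullet> e 0) *\<^sub>R e 0 + (h \<bullet> e i) *\<^sub>R e i" using that plane_iff[OF i] by simp
    then have "D h = (h \<bullet> e 0) * D (e 0) + (h \<bullet> e i) * D (e i)"
      by (metis D.add D.scaleR real_scaleR_def)
    then show ?thesis by (simp add: p_def inner_add_left inner_add_right inner_commute mult.commute)
  qed
  have dp: "(\<phi> has_derivative (\<lambda>h. p \<bullet> h)) (at x within P i)"
    unfolding has_derivative_within_alt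
  proof (intro conjI allI impI)
    show "bounded_linear ((\<bullet>) p)" by (rule bounded_linear_inner_right)
    fix \<epsilon> :: real assume "0 < \<epsilon>"
    then obtain r where "r > 0" "\<forall>y\<in>P i. norm (y - x) < r \<longrightarrow> norm (\<phi> y - \<phi> x - D (y - x)) \<le> \<epsilon> * norm (y - x)"
      using D unfolding has_derivative_within_alt by blast
    then show "\<exists>r>0. \<forall>y\<in>P i. norm (y - x) < r \<longrightarrow> norm (\<phi> y - \<phi> x - p \<bullet> (y - x)) \<le> \<epsilon> * norm (y - x)"
      using Dp plane_diff[OF P_plane[OF i] P_plane[OF i x]] by auto
  qed
  have "inner_grad e i \<phi> x = p"
    unfolding inner_grad_def
  proof (rule the_equality)
    show "p \<in> plane e i \<and> (\<phi> has_derivative (\<lambda>h. p \<bullet> h)) (at x within P i)" using pp dp by blast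
    fix p' assume p': "p' \<in> plane e i \<and> (\<phi> has_derivative (\<lambda>h. p' \<bullet> h)) (at x within P i)"
    have "p' \<bullet> h = p \<bullet> h" if "h \<in> P i" for h
      using p' dp P_add[OF i x P_scale[OF i that]] by (intro directional_derivative_unique) auto
    then have "p' \<bullet> e 0 = p \<bullet> e 0" "p' \<bullet> e i = p \<bullet> e i" using e_in_P[OF i] by auto
    then show "p' = p" using p' pp plane_iff[OF i] by metis
  qed
  then show ?thesis using dp by simp
qed

text \<open>Test functions are required to be differentiable off \<Gamma> only. At a point of
  \<Gamma> the continuity of the gradient takes over: the mean value theorem is applied on the
  segment to an interior point, along which the gradient is close to its value \<open>q\<close> at
  \<open>x\<close>.\<close>

lemma grad_has_derivative:
  assumes \<phi>: "\<phi> \<in> test_functions e N" and i: "i \<in> {1..N}" and x: "x \<in> P i"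
  shows "(\<phi> has_derivative (\<lambda>h. grad e i \<phi> x \<bullet> h)) (at x within P i)"
proof -
  have cont: "continuous_on S \<phi>" and diff: "\<And>x. x \<in> P i \<Longrightarrow> x \<notin> \<Gamma> \<Longrightarrow> \<phi> differentiable (at x within P i)"
    and gcont: "continuous_on (P i) (grad e i \<phi>)"
    using \<phi> i unfolding test_functions_def by auto
  have inside: "(\<phi> has_derivative (\<lambda>h. grad e i \<phi> z \<bullet> h)) (at z within P i)" if "z \<in> P i" "z \<notin> \<Gamma>" for z
    using inner_grad_has_derivative[OF i that(1) diff[OF that]] that by (simp add: grad_def)
  have contP: "continuous_on (P i) \<phi>" by (rule continuous_on_subset[OF cont]) (use P_sub_S[OF i] in auto)
  show ?thesis
  proof (cases "x \<in> \<Gamma>")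
    case False
    then show ?thesis using inside x by blast
  next
    case True
    then have x0: "x \<bullet> e i = 0" using G_P_iff[OF i x] by simp
    define q where "q = grad e i \<phi> x"
    have "(\<phi> has_derivative (\<lambda>h. q \<bullet> h)) (at x within P i)"
      unfolding has_derivative_within_alt
    proof (intro conjI allI impI)
      show "bounded_linear ((\<bullet>) q)" by (rule bounded_linear_inner_right)
      fix \<epsilon> :: real assume \<epsilon>: "0 < \<epsilon>"
      then obtain d where d: "d > 0" "\<And>z. z \<in> P i \<Longrightarrow> norm (z - x) < d \<Longrightarrow> norm (grad e i \<phi> z - q) < \<epsilon>"
        using gcont x unfolding continuous_on_iff q_def dist_norm by blast
      have int: "\<bar>\<phi> z - \<phi> x - q \<bullet> (z - x)\<bar> \<le> \<epsilon> * norm (z - x)" if z: "z \<in> P i" "z \<notin> \<Gamma>" "norm (z - x) < d" for z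
      proof -
        define c where "c s = x + s *\<^sub>R (z - x)" for s :: real
        have zpos: "0 < z \<bullet> e i" using z G_P_iff[OF i z(1)] P_iff[OF i, of z] by force
        have cP: "c s \<in> P i" if "0 \<le> s" "s \<le> 1" for s
        proof -
          have "c s = (1 - s) *\<^sub>R x + s *\<^sub>R z" by (simp add: c_def algebra_simps)
          then show ?thesis using P_add[OF i P_scale[OF i x] P_scale[OF i z(1)]] that by simp
        qed
        have cG: "c s \<notin> \<Gamma>" if "0 < s" "s \<le> 1" for s
          using G_P_iff[OF i cP, of s] that zpos x0 by (simp add: c_def inner_add_left inner_diff_left)
        define g where "g s = \<phi> (c s) - s * (q \<bullet> (z - x))" for s
        have "continuous_on {0..1} g"
          unfolding g_def using cP
          by (intro continuous_intros continuous_on_compose2[OF contP]) (auto simp: c_def intro!: continuous_intros)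
        moreover have "(g has_derivative (\<lambda>h. h * ((grad e i \<phi> (c s) - q) \<bullet> (z - x)))) (at s)" if s: "0 < s" "s < 1" for s
        proof -
          have "(\<phi> has_derivative (\<lambda>h. grad e i \<phi> (c s) \<bullet> h)) (at (c s) within c ` {0<..<1})"
            using s cP cG by (intro has_derivative_subset[OF inside]) auto
          moreover have "(c has_derivative (\<lambda>h. h *\<^sub>R (z - x))) (at s within {0<..<1})"
            unfolding c_def by (auto intro!: derivative_eq_intros)
          ultimately have "((\<lambda>s. \<phi> (c s)) has_derivative (\<lambda>h. grad e i \<phi> (c s) \<bullet> (h *\<^sub>R (z - x)))) (at s within {0<..<1})"
            using has_derivative_in_compose[of c _ s "{0<..<1}" \<phi>] by blast
          moreover have "at s within {0<..<1} = at s" using s by (intro at_within_open) auto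
          ultimately have "((\<lambda>s. \<phi> (c s)) has_derivative (\<lambda>h. grad e i \<phi> (c s) \<bullet> (h *\<^sub>R (z - x)))) (at s)" by simp
          moreover have "((\<lambda>s. s * (q \<bullet> (z - x))) has_derivative (\<lambda>h. h * (q \<bullet> (z - x)))) (at s)"
            by (auto intro!: derivative_eq_intros)
          ultimately have "(g has_derivative (\<lambda>h. grad e i \<phi> (c s) \<bullet> (h *\<^sub>R (z - x)) - h * (q \<bullet> (z - x)))) (at s)"
            unfolding g_def by (rule has_derivative_diff)
          moreover have "(\<lambda>h. grad e i \<phi> (c s) \<bullet> (h *\<^sub>R (z - x)) - h * (q \<bullet> (z - x)))
              = (\<lambda>h. h * ((grad e i \<phi> (c s) - q) \<bullet> (z - x)))"
            by (simp add: fun_eq_iff inner_diff_left algebra_simps)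
          ultimately show ?thesis by simp
        qed
        ultimately obtain s where s: "0 < s" "s < 1" "g 1 - g 0 = (1 - 0) * ((grad e i \<phi> (c s) - q) \<bullet> (z - x))"
          using mvt[of 0 1 g "\<lambda>s h. h * ((grad e i \<phi> (c s) - q) \<bullet> (z - x))"] by auto
        have "norm (c s - x) \<le> norm (z - x)" using s by (simp add: c_def mult_left_le_one_le)
        then have "norm (grad e i \<phi> (c s) - q) < \<epsilon>" using s z(3) cP by (intro d(2)) auto
        then have "norm (grad e i \<phi> (c s) - q) * norm (z - x) \<le> \<epsilon> * norm (z - x)" by (intro mult_right_mono) auto
        moreover have "g 1 - g 0 = \<phi> z - \<phi> x - q \<bullet> (z - x)" by (simp add: g_def c_def)
        ultimately show ?thesis
          using s(3) Cauchy_Schwarz_ineq2[of "grad e i \<phi> (c s) - q" "z - x"] by simp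
      qed
      \<comment> \<open>If \<open>z\<close> is on \<Gamma> the whole segment lies there and the mean
        value argument fails; the estimate is obtained at \<open>z + s *\<^sub>R e i\<close> and s
        tends to 0.\<close>
      have bdry: "\<bar>\<phi> z - \<phi> x - q \<bullet> (z - x)\<bar> \<le> \<epsilon> * norm (z - x)" if z: "z \<in> P i" "z \<in> \<Gamma>" "norm (z - x) < d" for z
      proof -
        define k where "k s = \<epsilon> * norm (z + s *\<^sub>R e i - x) - \<bar>\<phi> (z + s *\<^sub>R e i) - \<phi> x - q \<bullet> (z + s *\<^sub>R e i - x)\<bar>" for s :: real
        have zP: "z + s *\<^sub>R e i \<in> P i" if "0 \<le> s" for s using P_add[OF i z(1) P_scale[OF i e_in_P(1)[OF i]]] that by simp
        have "continuous_on {0..} k"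
          unfolding k_def using zP by (intro continuous_intros continuous_on_compose2[OF contP]) auto
        then have "(k \<longlongrightarrow> k 0) (at 0 within {0..})" by (simp add: continuous_on)
        moreover have "\<forall>\<^sub>F s in at 0 within {0..}. 0 \<le> k s"
          unfolding eventually_at
        proof (intro exI[of _ "d - norm (z - x)"] conjI ballI impI)
          fix s :: real assume s: "s \<in> {0..}" "s \<noteq> 0 \<and> dist s 0 < d - norm (z - x)"
          then have "z + s *\<^sub>R e i \<notin> \<Gamma>"
            using G_P_iff[OF i zP, of s] G_P_iff[OF i z(1)] z(2) i by (simp add: inner_add_left)
          moreover have "norm (z + s *\<^sub>R e i - x) < d"
          proof -
            have "norm (z + s *\<^sub>R e i - x) = norm ((z - x) + s *\<^sub>R e i)" by (simp add: algebra_simps)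
            also have "\<dots> \<le> norm (z - x) + \<bar>s\<bar>" using i by (intro order_trans[OF norm_triangle_ineq]) simp
            finally show ?thesis using s by simp
          qed
          ultimately show "0 \<le> k s" using int[OF zP] s by (simp add: k_def)
        qed (use z in simp)
        moreover have "at (0::real) within {0..} \<noteq> bot" by (rule at_zero_ray_neq_bot)
        ultimately have "0 \<le> k 0" by (rule tendsto_lowerbound)
        then show ?thesis by (simp add: k_def)
      qed
      show "\<exists>d>0. \<forall>y\<in>P i. norm (y - x) < d \<longrightarrow> norm (\<phi> y - \<phi> x - q \<bullet> (y - x)) \<le> \<epsilon> * norm (y - x)"
        using d(1) int bdry unfolding real_norm_def by blast
    qed
    then show ?thesis by (simp add: q_def)
  qed
qed

lemma test_function_expansion:
  assumes \<phi>: "\<phi> \<in> test_functions e N" and i: "i \<in> {1..N}" and x: "x \<in> P i" and \<epsilon>: "0 < \<epsilon>"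
  obtains d where "d > 0" "\<And>z. z \<in> P i \<Longrightarrow> norm (z - x) < d \<Longrightarrow>
      \<bar>\<phi> z - \<phi> x - grad e i \<phi> x \<bullet> (z - x)\<bar> \<le> \<epsilon> * norm (z - x)"
  using grad_has_derivative[OF \<phi> i x] \<epsilon> unfolding has_derivative_within_alt real_norm_def by blast

text \<open>Both half-planes contain the ray from x in direction \<open>e 0\<close>. This is what
  gives the linearised test function the single tangential slope that \<open>\<psi>\<close>
  has.\<close>

lemma grad_tangential:
  assumes \<phi>: "\<phi> \<in> test_functions e N" and i: "i \<in> {1..N}" and j: "j \<in> {1..N}" and x: "x \<in> \<Gamma>"
  shows "grad e i \<phi> x \<bullet> e 0 = grad e j \<phi> x \<bullet> e 0"
  by (rule directional_derivative_unique[OF grad_has_derivative[OF \<phi> i] grad_has_derivative[OF \<phi> j]])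
    (use i j x G_sub_P P_add P_scale e_in_P(2) in auto)


end

context junction_control
begin

section \<open>Envelopes of the value function and estimates near a point\<close>

abbreviation "up \<equiv> upper_envelope S vf"
abbreviation "lo \<equiv> lower_envelope S vf"

lemma value_lower_envelope:
  shows "lsc_on S lo" and "\<And>z. z \<in> S \<Longrightarrow> lo z \<le> vr z"
    and "\<And>x \<eta> \<rho>. x \<in> S \<Longrightarrow> 0 < \<eta> \<Longrightarrow> 0 < \<rho> \<Longrightarrow> \<exists>z\<in>S. norm (z - x) < \<rho> \<and> vr z < lo x + \<eta>"
proof -
  show "lsc_on S lo" by (rule lower_envelope_lsc[OF vr(1,2)])
  show "lo z \<le> vr z" if "z \<in> S" for z by (rule lower_envelope_le[OF vr(1,2) that])
  show "\<exists>z\<in>S. norm (z - x) < \<rho> \<and> vr z < lo x + \<eta>" if "x \<in> S" "0 < \<eta>" "0 < \<rho>" for x \<eta> \<rho>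
    by (rule lower_envelope_approx[OF vr(1,2) that(1) _ that(3)]) (use that in auto)
qed

lemma value_upper_envelope:
  shows "usc_on S up" and "\<And>z. z \<in> S \<Longrightarrow> vr z \<le> up z"
    and "\<And>x \<eta> \<rho>. x \<in> S \<Longrightarrow> 0 < \<eta> \<Longrightarrow> 0 < \<rho> \<Longrightarrow> \<exists>z\<in>S. norm (z - x) < \<rho> \<and> up x - \<eta> < vr z"
proof -
  let ?lo = "lower_envelope S (\<lambda>z. - vf z)"
  have up: "up = (\<lambda>x. - ?lo x)" using upper_envelope_eq by blast
  have u: "- vf z = ereal (- vr z)" "\<bar>- vr z\<bar> \<le> B / lam" if "z \<in> S" for z
    using vr(1,2)[OF that] by auto
  show "usc_on S up" unfolding usc_on_iff_lsc_on_uminus up using lower_envelope_lsc[where u = "\<lambda>z. - vf z" and w = "\<lambda>z. - vr z", OF u] by simp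
  show "vr z \<le> up z" if "z \<in> S" for z using lower_envelope_le[where u = "\<lambda>z. - vf z" and w = "\<lambda>z. - vr z", OF u that] by (simp add: up)
  show "\<exists>z\<in>S. norm (z - x) < \<rho> \<and> up x - \<eta> < vr z" if "x \<in> S" "0 < \<eta>" "0 < \<rho>" for x \<eta> \<rho>
  proof -
    have "?lo x < ?lo x + \<eta>" using that by simp
    from lower_envelope_approx[where u = "\<lambda>z. - vf z" and w = "\<lambda>z. - vr z", OF u that(1) this that(3)] show ?thesis
      by (force simp: up)
  qed
qed

lemma near_interior:
  assumes i: "i \<in> {1..N}" and x: "x \<in> P i" "x \<notin> \<Gamma>"
  obtains d where "d > 0" "\<And>z. z \<in> S \<Longrightarrow> norm (z - x) < d \<Longrightarrow> z \<in> P i \<and> z \<notin> \<Gamma>"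
proof -
  obtain K0 where K0: "1 \<le> K0" "\<And>i z w. i \<in> {1..N} \<Longrightarrow> z \<in> S \<Longrightarrow> w \<in> S \<Longrightarrow> \<bar>coord i z - coord i w\<bar> \<le> K0 * norm (z - w)"
    using coord_lipschitz by blast
  have pos: "0 < coord i x"
    using i x coord_eq[OF i x(1)] G_P_iff[OF i x(1)] coord_nonneg[OF i, of x] by auto
  show ?thesis
  proof (rule that)
    show "0 < coord i x / K0" using pos K0 by simp
    fix z assume z: "z \<in> S" "norm (z - x) < coord i x / K0"
    have "\<bar>coord i z - coord i x\<bar> \<le> K0 * norm (z - x)" using K0(2)[OF i z(1) P_sub_S[OF i x(1)]] .
    also have "\<dots> < coord i x" using z(2) K0(1) by (simp add: pos_less_divide_eq mult.commute)
    finally have "0 < coord i z" by linarith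
    then show "z \<in> P i \<and> z \<notin> \<Gamma>" using coord_G[OF i, of z] by (auto simp: coord_def split: if_splits)
  qed
qed

text \<open>Uniformity in the control is essential, since the trajectories of the supersolution
  argument carry arbitrary controls; \<open>Lf\<close> and \<open>l_unif\<close> are independent of
  the control.\<close>

lemma running_cost_near:
  assumes "0 < \<kappa>"
  obtains d where "d > 0" "\<And>i z x a. i \<in> {1..N} \<Longrightarrow> z \<in> P i \<Longrightarrow> x \<in> P i \<Longrightarrow> a \<in> A i \<Longrightarrow> norm (z - x) < d \<Longrightarrow>
      d\<psi> p b i x a + l i x a - \<kappa> \<le> d\<psi> p b i z a + l i z a"
proof -
  obtain d1 where d1: "d1 > 0" "\<And>i x y a. i \<in> {1..N} \<Longrightarrow> x \<in> P i \<Longrightarrow> y \<in> P i \<Longrightarrow> a \<in> A i \<Longrightarrow>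
      norm (x - y) < d1 \<Longrightarrow> \<bar>l i x a - l i y a\<bar> \<le> \<kappa> / 2"
    using l_unif[of "\<kappa> / 2"] assms by auto
  define c where "c = (\<bar>p\<bar> + (\<Sum>i\<in>{1..N}. \<bar>b i\<bar>)) * Lf"
  have c: "0 \<le> c" using Lf_pos by (simp add: c_def sum_nonneg)
  show ?thesis
  proof (rule that)
    show "0 < min d1 (\<kappa> / (2 * (c + 1)))" using d1 c assms by simp
    fix i z x a assume *: "i \<in> {1..N}" "z \<in> P i" "x \<in> P i" "a \<in> A i" "norm (z - x) < min d1 (\<kappa> / (2 * (c + 1)))"
    have "\<bar>l i z a - l i x a\<bar> \<le> \<kappa> / 2" using * by (intro d1(2)) auto
    moreover have "\<bar>d\<psi> p b i z a - d\<psi> p b i x a\<bar> \<le> \<kappa> / 2"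
    proof -
      let ?f = "f i z a - f i x a"
      have "d\<psi> p b i z a - d\<psi> p b i x a = p * (?f \<bullet> e 0) + b i * (?f \<bullet> e i)"
        by (simp add: d\<psi>_def inner_diff_left algebra_simps)
      also have "\<bar>\<dots>\<bar> \<le> \<bar>p\<bar> * norm ?f + \<bar>b i\<bar> * norm ?f"
        using component0_le[of ?f] component_le[OF *(1), of ?f]
        by (intro order_trans[OF abs_triangle_ineq] add_mono) (auto simp: abs_mult intro!: mult_left_mono)
      also have "\<dots> = (\<bar>p\<bar> + \<bar>b i\<bar>) * norm ?f" by (simp add: algebra_simps)
      also have "\<dots> \<le> (\<bar>p\<bar> + (\<Sum>i\<in>{1..N}. \<bar>b i\<bar>)) * (Lf * norm (z - x))"
        using * f_lip[OF *(1,2,3,4)] by (intro mult_mono add_mono member_le_sum) (auto intro!: add_nonneg_nonneg sum_nonneg)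
      also have "\<dots> = c * norm (z - x)" by (simp add: c_def)
      also have "\<dots> \<le> (c + 1) * (\<kappa> / (2 * (c + 1)))" using * c by (intro mult_mono) auto
      also have "\<dots> = \<kappa> / 2" using c by (simp add: field_simps)
      finally show ?thesis .
    qed
    ultimately show "d\<psi> p b i x a + l i x a - \<kappa> \<le> d\<psi> p b i z a + l i z a" by linarith
  qed
qed

lemma inner_f: "i \<in> {1..N} \<Longrightarrow> x \<in> P i \<Longrightarrow> a \<in> A i \<Longrightarrow>
    q \<bullet> f i x a = (q \<bullet> e 0) * (f i x a \<bullet> e 0) + (q \<bullet> e i) * (f i x a \<bullet> e i)"
  using inner_plane[OF _ f_plane] by blast

lemma Ham_bdd_above:
  assumes i: "i \<in> {1..N}" and x: "x \<in> P i"
  shows "bdd_above ((\<lambda>a. - (q \<bullet> f i x a) - l i x a) ` A i)"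
proof (rule bdd_aboveI2)
  fix a assume a: "a \<in> A i"
  have "\<bar>q \<bullet> f i x a\<bar> \<le> norm q * M"
    using Cauchy_Schwarz_ineq2[of q "f i x a"] mult_left_mono[OF f_bound[OF i x a], of "norm q"] by simp
  then show "- (q \<bullet> f i x a) - l i x a \<le> norm q * M + B" using l_bound[OF i x a] by linarith
qed

section \<open>The value function is a subsolution\<close>

text \<open>By normal controllability \<open>\<Gamma>\<close> is reached from nearby points in a time proportional to the
  distance, hence at a small cost.\<close>

lemma upper_envelope_interface_approx:
  assumes x: "x \<in> \<Gamma>" and \<eta>: "0 < \<eta>" and \<rho>: "0 < \<rho>"
  shows "\<exists>z\<in>\<Gamma>. norm (z - x) < \<rho> \<and> up x - \<eta> < vr z"
proof -
  \<comment> \<open>Half of the outward speed \<delta> available at x is sacrificed to the variation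
    of the field near x.\<close>
  define c where "c = \<delta> / 2"
  have c: "0 < c" using \<delta>_pos by (simp add: c_def)
  \<comment> \<open>The three entries in turn keep the normal velocity below - c along the arc,
    bring the endpoint within \<rho> of x, and limit the loss 2 B T of running cost and discount to
    \<eta> / 2.\<close>
  define \<sigma> where "\<sigma> = Min {c / (Lf * (1 + 2 * M / c)), \<rho> / (1 + M / c), \<eta> * c / (4 * B)}"
  have \<sigma>0: "0 < \<sigma>" using c Lf_pos M_pos B_pos \<eta> \<rho> by (simp add: \<sigma>_def add_pos_pos)
  have \<sigma>: "Lf * (\<sigma> * (1 + 2 * M / c)) \<le> c" "\<sigma> * (1 + M / c) \<le> \<rho>" "4 * B * \<sigma> \<le> \<eta> * c"
  proof -
    have k: "0 < Lf * (1 + 2 * M / c)" "0 < 1 + M / c" using c Lf_pos M_pos by (simp_all add: add_pos_pos)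
    have "\<sigma> \<le> c / (Lf * (1 + 2 * M / c))" "\<sigma> \<le> \<rho> / (1 + M / c)" "\<sigma> \<le> \<eta> * c / (4 * B)"
      by (simp_all add: \<sigma>_def)
    then have "\<sigma> * (Lf * (1 + 2 * M / c)) \<le> c" "\<sigma> * (1 + M / c) \<le> \<rho>" "\<sigma> * (4 * B) \<le> \<eta> * c"
      using k B_pos by (simp_all only: pos_le_divide_eq mult_pos_pos zero_less_numeral)
    then show "Lf * (\<sigma> * (1 + 2 * M / c)) \<le> c" "\<sigma> * (1 + M / c) \<le> \<rho>" "4 * B * \<sigma> \<le> \<eta> * c"
      by (simp_all add: mult_ac)
  qed
  obtain z where z: "z \<in> S" "norm (z - x) < \<sigma>" "up x - \<eta> / 2 < vr z"
    using value_upper_envelope(3)[OF G_sub_S[OF x], of "\<eta> / 2" \<sigma>] \<eta> \<sigma>0 by auto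
  obtain j where j: "j \<in> {1..N}" "z \<in> P j" using S_cases[OF z(1)] by blast
  have xP: "x \<in> P j" using G_sub_P[OF j(1) x] .
  obtain a where a: "a \<in> A j" "f j x a \<bullet> e j = - \<delta>" using normal_ctrl[OF j(1) x, of "- \<delta>"] \<delta>_pos by auto
  have zj: "z \<bullet> e j \<le> \<sigma>"
    using component_le[OF j(1), of "z - x"] G_P_iff[OF j(1) xP] x z(2) by (simp add: inner_diff_left)
  have zc: "(z \<bullet> e j) / c \<le> \<sigma> / c" using zj c by (simp add: divide_right_mono)
  have out: "f j w a \<bullet> e j \<le> - c" if w: "w \<in> P j" "norm (w - z) \<le> 2 * M * ((z \<bullet> e j) / c)" for w
  proof -
    have "2 * M * ((z \<bullet> e j) / c) \<le> 2 * M * (\<sigma> / c)" using zc M_pos by (intro mult_left_mono) auto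
    moreover have "norm (w - x) \<le> norm (w - z) + norm (z - x)" using norm_triangle_ineq[of "w - z" "z - x"] by simp
    ultimately have "norm (w - x) \<le> \<sigma> * (1 + 2 * M / c)" using w z(2) by (simp add: algebra_simps)
    then have "Lf * norm (w - x) \<le> Lf * (\<sigma> * (1 + 2 * M / c))" using Lf_pos by (intro mult_left_mono) auto
    then have "Lf * norm (w - x) \<le> c" using \<sigma>(1) by linarith
    then show ?thesis using f_normal_perturb[OF j(1) xP w(1) a(1)] a(2) by (simp add: c_def abs_le_iff)
  qed
  obtain y T where y: "piece j a T y" "y 0 = z" "T \<le> (z \<bullet> e j) / c" "y T \<in> \<Gamma>" "norm (y T - z) \<le> M * T"
    "continuous_on {0..T} y"
    using piece_to_interface[OF j(1) a(1) j(2) c out] by blast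
  have T: "0 \<le> T" "T \<le> \<sigma> / c" using y zc by (auto simp: piece_def)
  have yP: "y s \<in> P j" if "0 \<le> s" "s \<le> T" for s using y(1) that by (auto simp: piece_def)
  have "((\<lambda>s. l j (y s) a * exp (- lam * s)) has_integral
      integral {0..T} (\<lambda>s. l j (y s) a * exp (- lam * s))) {0..T}"
    using j(1) a(1) y(1,6) by (rule piece_cost_has_integral)
  moreover have "((\<lambda>s. B) has_integral (B * T)) {0..T}"
    using has_integral_const_real[of B 0 T] T by (simp add: mult.commute)
  ultimately have I: "integral {0..T} (\<lambda>s. l j (y s) a * exp (- lam * s)) \<le> B * T"
  proof (rule has_integral_le)
    fix s assume s: "s \<in> {0..T}"
    have "l j (y s) a * exp (- lam * s) \<le> B * 1"
      using l_bound[OF j(1) yP a(1), of s] s lam B_pos by (intro mult_mono) auto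
    then show "l j (y s) a * exp (- lam * s) \<le> B" by simp
  qed
  have yS: "y T \<in> S" using G_sub_S y(4) .
  have "exp (- lam * T) * (vr (y T) + 0) \<le> vr (y T) + lam * T * (B / lam) + 0"
    using T vr(2)[OF yS] by (intro discount_mult_lower(2)) auto
  then have "exp (- lam * T) * vr (y T) \<le> vr (y T) + B * T" using lam by (simp add: mult.commute)
  then have "vr z \<le> vr (y T) + 2 * (B * T)"
    using dpp_piece[OF j(1) a(1) y(1)] y(2) I by simp
  moreover have "2 * (B * T) \<le> \<eta> / 2"
  proof -
    have "B * T \<le> B * (\<sigma> / c)" using T B_pos by (intro mult_left_mono) auto
    also have "\<dots> \<le> \<eta> / 4" using \<sigma>(3) c by (simp add: field_simps)
    finally show ?thesis by simp
  qed
  ultimately have "up x - \<eta> < vr (y T)" using z(3) by linarith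
  moreover have "norm (y T - x) < \<rho>"
  proof -
    have "M * T \<le> M * (\<sigma> / c)" using T M_pos by (intro mult_left_mono) auto
    then have "norm (y T - x) < \<sigma> * (1 + M / c)"
      using y(5) z(2) norm_triangle_ineq[of "y T - z" "z - x"] by (simp add: algebra_simps)
    then show ?thesis using \<sigma>(2) by simp
  qed
  ultimately show ?thesis using y(4) by blast
qed

lemma local_maximum_expansion:
  assumes x: "x \<in> S" and \<phi>: "\<phi> \<in> test_functions e N"
    and max: "\<forall>\<^sub>F z in at x within S. u z - \<phi> z \<le> u x - \<phi> x"
    and i: "i \<in> {1..N}" "x \<in> P i" and \<epsilon>: "0 < \<epsilon>"
  obtains r where "0 < r" "\<And>z. z \<in> P i \<Longrightarrow> norm (z - x) < r \<Longrightarrow>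
      u z \<le> u x + grad e i \<phi> x \<bullet> (z - x) + \<epsilon> * norm (z - x)"
proof -
  obtain r1 where r1: "r1 > 0" "\<And>z. z \<in> S \<Longrightarrow> z \<noteq> x \<Longrightarrow> norm (z - x) < r1 \<Longrightarrow> u z - \<phi> z \<le> u x - \<phi> x"
    using max unfolding eventually_at_within_iff by blast
  obtain d where d: "d > 0" "\<And>z. z \<in> P i \<Longrightarrow> norm (z - x) < d \<Longrightarrow>
      \<bar>\<phi> z - \<phi> x - grad e i \<phi> x \<bullet> (z - x)\<bar> \<le> \<epsilon> * norm (z - x)"
    using test_function_expansion[OF \<phi> i \<epsilon>] by blast
  show ?thesis
  proof (rule that)
    show "0 < min r1 d" using r1 d by simp
    fix z assume z: "z \<in> P i" "norm (z - x) < min r1 d"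
    then have "u z - \<phi> z \<le> u x - \<phi> x" using r1(2)[of z] P_sub_S[OF i(1)] by (cases "z = x") auto
    then show "u z \<le> u x + grad e i \<phi> x \<bullet> (z - x) + \<epsilon> * norm (z - x)"
      using d(2)[of z] z by (simp add: abs_le_iff)
  qed
qed

lemma subsolution_interior:
  assumes i: "i \<in> {1..N}" and x: "x \<in> P i" "x \<notin> \<Gamma>" and \<phi>: "\<phi> \<in> test_functions e N"
    and max: "\<forall>\<^sub>F z in at x within S. up z - \<phi> z \<le> up x - \<phi> x" and a: "a \<in> A i"
  shows "lam * up x \<le> grad e i \<phi> x \<bullet> f i x a + l i x a"
proof (rule field_le_epsilon)
  fix \<epsilon>' :: real assume \<epsilon>': "0 < \<epsilon>'"
  define \<epsilon> where "\<epsilon> = \<epsilon>' / M"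
  have \<epsilon>: "0 < \<epsilon>" using \<epsilon>' M_pos by (simp add: \<epsilon>_def)
  have xS: "x \<in> S" using P_sub_S[OF i x(1)] .
  obtain r where r: "0 < r" "\<And>z. z \<in> P i \<Longrightarrow> norm (z - x) < r \<Longrightarrow>
      up z \<le> up x + grad e i \<phi> x \<bullet> (z - x) + \<epsilon> * norm (z - x)"
    using local_maximum_expansion[OF xS \<phi> max i x(1) \<epsilon>] by blast
  obtain d where d: "d > 0" "\<And>z. z \<in> S \<Longrightarrow> norm (z - x) < d \<Longrightarrow> z \<in> P i \<and> z \<notin> \<Gamma>"
    using near_interior[OF i x] by blast
  have "lam * up x \<le> grad e i \<phi> x \<bullet> f i x a + l i x a + \<epsilon> * M"
  proof (rule subsolution_inequality[OF i x(1) a value_upper_envelope(2), where r = "min r d"])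
    fix \<eta> \<rho> :: real assume "0 < \<eta>" "0 < \<rho>"
    then show "\<exists>z\<in>P i. norm (z - x) < \<rho> \<and> up x - \<eta> < vr z"
      using value_upper_envelope(3)[OF xS, of \<eta> "min \<rho> d"] d by (auto simp: min_less_iff_conj)
  next
    fix w assume "w \<in> \<Gamma>" "norm (w - x) < min r d"
    then show "0 \<le> f i w a \<bullet> e i" using d(2)[OF G_sub_S] by auto
  qed (use r d \<epsilon> in auto)
  then show "lam * up x \<le> grad e i \<phi> x \<bullet> f i x a + l i x a + \<epsilon>'" using M_pos by (simp add: \<epsilon>_def)
qed

text \<open>A positive normal velocity at x stays nonnegative within distance
  \<open>(f i x a \<bullet> e i) / Lf\<close>, so the control can be kept constant. The
  approximating points are taken on \<Gamma>, hence in \<open>P i\<close> whatever i is.\<close>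

lemma subsolution_interface_strict:
  assumes i: "i \<in> {1..N}" and x: "x \<in> \<Gamma>" and \<phi>: "\<phi> \<in> test_functions e N"
    and max: "\<forall>\<^sub>F z in at x within S. up z - \<phi> z \<le> up x - \<phi> x"
    and a: "a \<in> A i" and pos: "0 < f i x a \<bullet> e i"
  shows "lam * up x \<le> grad e i \<phi> x \<bullet> f i x a + l i x a"
proof (rule field_le_epsilon)
  fix \<epsilon>' :: real assume \<epsilon>': "0 < \<epsilon>'"
  define \<epsilon> where "\<epsilon> = \<epsilon>' / M"
  have \<epsilon>: "0 < \<epsilon>" using \<epsilon>' M_pos by (simp add: \<epsilon>_def)
  have xP: "x \<in> P i" and xS: "x \<in> S" using G_sub_P[OF i x] G_sub_S[OF x] .
  obtain r where r: "0 < r" "\<And>z. z \<in> P i \<Longrightarrow> norm (z - x) < r \<Longrightarrow>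
      up z \<le> up x + grad e i \<phi> x \<bullet> (z - x) + \<epsilon> * norm (z - x)"
    using local_maximum_expansion[OF xS \<phi> max i xP \<epsilon>] by blast
  define d where "d = (f i x a \<bullet> e i) / Lf"
  have d: "0 < d" using pos Lf_pos by (simp add: d_def)
  have "lam * up x \<le> grad e i \<phi> x \<bullet> f i x a + l i x a + \<epsilon> * M"
  proof (rule subsolution_inequality[OF i xP a value_upper_envelope(2), where r = "min r d"])
    fix \<eta> \<rho> :: real assume "0 < \<eta>" "0 < \<rho>"
    then show "\<exists>z\<in>P i. norm (z - x) < \<rho> \<and> up x - \<eta> < vr z"
      using upper_envelope_interface_approx[OF x] G_sub_P[OF i] by blast
  next
    fix w assume w: "w \<in> \<Gamma>" "norm (w - x) < min r d"
    then have "Lf * norm (w - x) \<le> f i x a \<bullet> e i"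
      using Lf_pos by (simp add: d_def pos_less_divide_eq mult.commute)
    then show "0 \<le> f i w a \<bullet> e i" using f_normal_perturb[OF i xP G_sub_P[OF i w(1)] a] by linarith
  qed (use r d \<epsilon> in auto)
  then show "lam * up x \<le> grad e i \<phi> x \<bullet> f i x a + l i x a + \<epsilon>'" using M_pos by (simp add: \<epsilon>_def)
qed

lemma FL_convex_combination:
  assumes i: "i \<in> {1..N}" and x: "x \<in> P i" and "a \<in> A i" "a' \<in> A i" and "0 \<le> \<theta>" "\<theta> \<le> 1"
  obtains a'' where "a'' \<in> A i" "f i x a'' = (1 - \<theta>) *\<^sub>R f i x a + \<theta> *\<^sub>R f i x a'"
    "l i x a'' = (1 - \<theta>) * l i x a + \<theta> * l i x a'"
proof -
  have "(1 - \<theta>) *\<^sub>R (f i x a, l i x a) + \<theta> *\<^sub>R (f i x a', l i x a') \<in> FL A f l i x"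
    using assms by (intro convexD[OF FL_convex[OF i x]]) (auto simp: FL_def)
  then show ?thesis using that by (auto simp: FL_def)
qed

lemma subsolution_interface:
  assumes i: "i \<in> {1..N}" and x: "x \<in> \<Gamma>" and \<phi>: "\<phi> \<in> test_functions e N"
    and max: "\<forall>\<^sub>F z in at x within S. up z - \<phi> z \<le> up x - \<phi> x"
    and a: "a \<in> A i" and nonneg: "0 \<le> f i x a \<bullet> e i"
  shows "lam * up x \<le> grad e i \<phi> x \<bullet> f i x a + l i x a"
proof -
  have xP: "x \<in> P i" using G_sub_P[OF i x] .
  obtain a' where a': "a' \<in> A i" "f i x a' \<bullet> e i = \<delta>" using normal_ctrl[OF i x, of \<delta>] \<delta>_pos by auto
  let ?q = "grad e i \<phi> x"
  \<comment> \<open>Velocity and running cost of the mixed control are affine in \<theta>, and its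
    normal velocity is at least \<theta> \<delta>; the strict case applies and \<theta> tends to
    0.\<close>
  let ?g = "\<lambda>\<theta>. (1 - \<theta>) * (?q \<bullet> f i x a + l i x a) + \<theta> * (?q \<bullet> f i x a' + l i x a')"
  have "(?g \<longlongrightarrow> ?g 0) (at_right 0)" by (intro tendsto_intros)
  moreover have "\<forall>\<^sub>F \<theta> in at_right 0. lam * up x \<le> ?g \<theta>"
    unfolding eventually_at_right_field
  proof (intro exI[of _ 1] conjI allI impI)
    fix \<theta> :: real assume \<theta>: "0 < \<theta>" "\<theta> < 1"
    obtain a'' where a'': "a'' \<in> A i" "f i x a'' = (1 - \<theta>) *\<^sub>R f i x a + \<theta> *\<^sub>R f i x a'"
      "l i x a'' = (1 - \<theta>) * l i x a + \<theta> * l i x a'"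
      using FL_convex_combination[OF i xP a a'(1), of \<theta>] \<theta> by auto
    have "0 < f i x a'' \<bullet> e i"
      using \<theta> a'(2) nonneg \<delta>_pos by (simp add: a'' inner_add_left add_nonneg_pos)
    then have "lam * up x \<le> ?q \<bullet> f i x a'' + l i x a''"
      using subsolution_interface_strict[OF i x \<phi> max a''(1)] by blast
    also have "\<dots> = ?g \<theta>" by (simp add: a'' inner_add_right algebra_simps)
    finally show "lam * up x \<le> ?g \<theta>" .
  qed simp
  ultimately have "lam * up x \<le> ?g 0"
    by (rule tendsto_lowerbound) (rule trivial_limit_at_right_real)
  then show ?thesis by simp
qed

lemma upper_envelope_subsolution: "viscosity_subsolution e N A f l lam up"
  unfolding viscosity_subsolution_def
proof (intro conjI ballI impI value_upper_envelope(1))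
  fix x \<phi> i assume x: "x \<in> S" and \<phi>: "\<phi> \<in> test_functions e N"
    and max: "\<forall>\<^sub>F z in at x within S. up z - \<phi> z \<le> up x - \<phi> x"
    and i: "i \<in> {1..N}" and xi: "x \<in> P i - \<Gamma>"
  have "Ham A f l i x (grad e i \<phi> x) \<le> - (lam * up x)"
    unfolding Ham_def
  proof (rule cSUP_least[OF A_ne[OF i]])
    fix a assume a: "a \<in> A i"
    show "- (grad e i \<phi> x \<bullet> f i x a) - l i x a \<le> - (lam * up x)"
      using subsolution_interior[OF i _ _ \<phi> max a] xi by simp
  qed
  then show "lam * up x + Ham A f l i x (grad e i \<phi> x) \<le> 0" by simp
next
  fix x \<phi> assume \<phi>: "\<phi> \<in> test_functions e N"
    and max: "\<forall>\<^sub>F z in at x within S. up z - \<phi> z \<le> up x - \<phi> x" and x: "x \<in> \<Gamma>"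
  have "Ham_plus e A f l i x (grad e i \<phi> x) \<le> - (lam * up x)" if i: "i \<in> {1..N}" for i
    unfolding Ham_plus_def
  proof (rule cSUP_least)
    obtain a where "a \<in> A i" "f i x a \<bullet> e i = \<delta>" using normal_ctrl[OF i x, of \<delta>] \<delta>_pos by auto
    then have "a \<in> {a \<in> A i. 0 \<le> f i x a \<bullet> e i}" using \<delta>_pos by simp
    then show "{a \<in> A i. 0 \<le> f i x a \<bullet> e i} \<noteq> {}" by blast
    fix a assume "a \<in> {a \<in> A i. 0 \<le> f i x a \<bullet> e i}"
    then show "- (grad e i \<phi> x \<bullet> f i x a) - l i x a \<le> - (lam * up x)"
      using subsolution_interface[OF i x \<phi> max, of a] by simp
  qed
  then have "Ham_Gam e N A f l x (\<lambda>i. grad e i \<phi> x) \<le> - (lam * up x)"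
    unfolding Ham_Gam_def using N_gt_1 by (subst Max_le_iff) auto
  then show "lam * up x + Ham_Gam e N A f l x (\<lambda>i. grad e i \<phi> x) \<le> 0" by simp
qed

section \<open>The value function is a supersolution\<close>

text \<open>\<open>J\<close> lists the half-planes met near \<open>x\<close>: one of them off
  \<Gamma>, all of them on \<Gamma>. The function \<open>\<psi>\<close> only has to lie below the
  linearised test function, which leaves room for lowering its normal slopes.\<close>

lemma supersolution_abstract:
  assumes x: "x \<in> S" and \<phi>: "\<phi> \<in> test_functions e N"
    and min: "\<forall>\<^sub>F z in at x within S. lo z - \<phi> z \<ge> lo x - \<phi> x"
    and J: "J \<subseteq> {1..N}" "J \<noteq> {}" "\<And>i. i \<in> J \<Longrightarrow> x \<in> P i"
    and r0: "0 < r0" "\<And>i z. i \<in> {1..N} \<Longrightarrow> z \<in> P i \<Longrightarrow> norm (z - x) < r0 \<Longrightarrow> i \<in> J"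
    and dominated: "\<And>i z. i \<in> J \<Longrightarrow> z \<in> P i \<Longrightarrow> \<psi> p b z - \<psi> p b x \<le> grad e i \<phi> x \<bullet> (z - x)"
    and H: "\<And>i a. i \<in> J \<Longrightarrow> a \<in> A i \<Longrightarrow> - H \<le> d\<psi> p b i x a + l i x a"
  shows "0 \<le> lam * lo x + H"
proof -
  have "- (lam * lo x + H) \<le> 0 + \<kappa>" if \<kappa>: "0 < \<kappa>" for \<kappa>
  proof -
    \<comment> \<open>One half of \<kappa> pays for the expansion of the test function, the other
      for the variation of the running cost.\<close>
    define \<epsilon> where "\<epsilon> = \<kappa> / (2 * M)"
    have \<epsilon>: "0 < \<epsilon>" using \<kappa> M_pos by (simp add: \<epsilon>_def)
    obtain r1 where r1: "r1 > 0" "\<And>z. z \<in> S \<Longrightarrow> z \<noteq> x \<Longrightarrow> norm (z - x) < r1 \<Longrightarrow> lo z - \<phi> z \<ge> lo x - \<phi> x"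
      using min unfolding eventually_at_within_iff by blast
    have "\<forall>i\<in>J. \<exists>d>0. \<forall>z\<in>P i. norm (z - x) < d \<longrightarrow>
        \<bar>\<phi> z - \<phi> x - grad e i \<phi> x \<bullet> (z - x)\<bar> \<le> \<epsilon> * norm (z - x)"
    proof
      fix i assume iJ: "i \<in> J"
      then have iN: "i \<in> {1..N}" using J(1) by blast
      show "\<exists>d>0. \<forall>z\<in>P i. norm (z - x) < d \<longrightarrow>
        \<bar>\<phi> z - \<phi> x - grad e i \<phi> x \<bullet> (z - x)\<bar> \<le> \<epsilon> * norm (z - x)"
        by (rule test_function_expansion[OF \<phi> iN J(3)[OF iJ] \<epsilon>]) (intro exI conjI ballI impI)
    qed
    from bchoice[OF this] obtain d where d: "\<And>i. i \<in> J \<Longrightarrow> d i > 0"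
      "\<And>i z. i \<in> J \<Longrightarrow> z \<in> P i \<Longrightarrow> norm (z - x) < d i \<Longrightarrow>
        \<bar>\<phi> z - \<phi> x - grad e i \<phi> x \<bullet> (z - x)\<bar> \<le> \<epsilon> * norm (z - x)" by blast
    obtain d' where d': "d' > 0" "\<And>i z x a. i \<in> {1..N} \<Longrightarrow> z \<in> P i \<Longrightarrow> x \<in> P i \<Longrightarrow> a \<in> A i \<Longrightarrow> norm (z - x) < d' \<Longrightarrow>
      d\<psi> p b i x a + l i x a - \<kappa> / 2 \<le> d\<psi> p b i z a + l i z a"
      using running_cost_near[of "\<kappa> / 2" p b] \<kappa> by auto
    have finJ: "finite J" using J(1) finite_subset by blast
    define r where "r = Min ({r0, r1, d'} \<union> d ` J)"
    have r: "0 < r" unfolding r_def using r0 r1 d' d(1) finJ by (subst Min_gr_iff) auto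
    have rle: "r \<le> r0" "r \<le> r1" "r \<le> d'" "\<And>i. i \<in> J \<Longrightarrow> r \<le> d i"
      unfolding r_def by (rule Min_le; use finJ in simp)+
    have "0 \<le> lam * lo x + (H + \<kappa> / 2) + \<epsilon> * M"
    proof (rule supersolution_inequality[OF x value_lower_envelope(2) value_lower_envelope(3)[OF x] r])
      fix z assume z: "z \<in> S" "norm (z - x) < r"
      obtain i where i: "i \<in> {1..N}" "z \<in> P i" using S_cases[OF z(1)] by blast
      then have iJ: "i \<in> J" using r0(2) z rle(1) by auto
      have "lo z - \<phi> z \<ge> lo x - \<phi> x" using r1(2)[of z] z rle(2) by (cases "z = x") auto
      then show "lo x + (\<psi> p b z - \<psi> p b x) - \<epsilon> * norm (z - x) \<le> lo z"
        using d(2)[OF iJ i(2)] dominated[OF iJ i(2)] z rle(4)[OF iJ] by (simp add: abs_le_iff)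
    next
      fix i z a assume *: "i \<in> {1..N}" "z \<in> P i" "norm (z - x) < r" "a \<in> A i"
      then have iJ: "i \<in> J" using r0(2) rle(1) by auto
      show "- (H + \<kappa> / 2) \<le> d\<psi> p b i z a + l i z a"
        using d'(2)[OF *(1,2) J(3)[OF iJ] *(4)] H[OF iJ *(4)] * rle(3) by simp
    qed (use \<epsilon> in auto)
    then show ?thesis using M_pos by (simp add: \<epsilon>_def)
  qed
  then have "- (lam * lo x + H) \<le> 0" by (rule field_le_epsilon)
  then show ?thesis by simp
qed

text \<open>A Lagrange multiplier for the constraint \<open>f i x a \<bullet> e i \<ge> 0\<close>: convexity of \<open>FL\<close> gives duality and the
  control with normal velocity \<open>\<delta>\<close> is a Slater point. Lowering the normal slope of the test function
  by \<open>\<mu>\<close> keeps it below the value function and turns \<open>H\<^sub>i\<^sup>+\<close> into \<open>H\<^sub>i\<close>.\<close>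

lemma normal_multiplier:
  assumes i: "i \<in> {1..N}" and x: "x \<in> \<Gamma>"
    and H: "\<And>a. a \<in> A i \<Longrightarrow> 0 \<le> f i x a \<bullet> e i \<Longrightarrow> - H \<le> q \<bullet> f i x a + l i x a"
  obtains \<mu> where "0 \<le> \<mu>" "\<And>a. a \<in> A i \<Longrightarrow> - H \<le> q \<bullet> f i x a + l i x a - \<mu> * (f i x a \<bullet> e i)"
proof -
  have xP: "x \<in> P i" using G_sub_P[OF i x] .
  define n where "n a = f i x a \<bullet> e i" for a
  define v where "v a = q \<bullet> f i x a + l i x a + H" for a
  \<comment> \<open>A multiplier \<mu> must satisfy \<mu> \<ge> v / n where n < 0 and \<mu> \<le> v
    / n where n > 0. \<open>Q\<close> collects the lower bounds, and 0 forces the sign; its supremum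
    is the multiplier.\<close>
  define Q where "Q = insert 0 ((\<lambda>a. v a / n a) ` {a \<in> A i. n a < 0})"
  have v: "0 \<le> v a" if "a \<in> A i" "0 \<le> n a" for a
    using H[OF that(1) that(2)[unfolded n_def]] unfolding v_def by linarith
  have cmp: "v a / n a \<le> v a' / n a'" if a: "a \<in> A i" "n a < 0" and a': "a' \<in> A i" "0 < n a'" for a a'
  proof -
    \<comment> \<open>The weight for which the combined normal velocity vanishes, so that the
      hypothesis applies to the combined control.\<close>
    define \<theta> where "\<theta> = - n a / (n a' - n a)"
    have \<theta>: "0 \<le> \<theta>" "\<theta> \<le> 1" using a a' by (auto simp: \<theta>_def divide_simps)
    obtain a'' where a'': "a'' \<in> A i" "f i x a'' = (1 - \<theta>) *\<^sub>R f i x a + \<theta> *\<^sub>R f i x a'"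
      "l i x a'' = (1 - \<theta>) * l i x a + \<theta> * l i x a'"
      using FL_convex_combination[OF i xP a(1) a'(1) \<theta>] by blast
    have th1: "1 - \<theta> = n a' / (n a' - n a)" using a a' by (simp add: \<theta>_def field_simps)
    have "n a'' = (1 - \<theta>) * n a + \<theta> * n a'" by (simp add: n_def a'' inner_add_left)
    also have "\<dots> = 0" unfolding th1 by (simp add: \<theta>_def)
    finally have "0 \<le> v a''" using v[OF a''(1)] by simp
    also have "v a'' = (1 - \<theta>) * v a + \<theta> * v a'" by (simp add: v_def a'' inner_add_right algebra_simps)
    also have "\<dots> = (n a' * v a - n a * v a') / (n a' - n a)"
      unfolding th1 by (simp add: \<theta>_def diff_divide_distrib)
    finally have "0 \<le> n a' * v a - n a * v a'" using a a' by (simp add: zero_le_divide_iff)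
    then show ?thesis using a a' by (simp add: divide_simps mult.commute)
  qed
  obtain a0 where a0: "a0 \<in> A i" "n a0 = \<delta>" using normal_ctrl[OF i x, of \<delta>] \<delta>_pos by (auto simp: n_def)
  have Qle: "q' \<le> v a' / n a'" if "q' \<in> Q" "a' \<in> A i" "0 < n a'" for q' a'
    using that cmp v[of a'] by (auto simp: Q_def)
  \<comment> \<open>The Slater point: the control with normal velocity \<delta> bounds all lower
    bounds from above.\<close>
  have bdd: "bdd_above Q" using Qle[OF _ a0(1)] a0(2) \<delta>_pos by (intro bdd_aboveI) auto
  show ?thesis
  proof (rule that)
    show "0 \<le> Sup Q" using bdd by (intro cSup_upper) (auto simp: Q_def)
    fix a assume a: "a \<in> A i"
    have "Sup Q * n a \<le> v a"
    proof -
      consider "n a < 0" | "n a = 0" | "0 < n a" by linarith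
      then show ?thesis
      proof cases
        case 1
        then have "v a / n a \<le> Sup Q" using a bdd by (intro cSup_upper) (auto simp: Q_def)
        then show ?thesis using 1 by (simp add: neg_divide_le_eq)
      next
        case 2
        then show ?thesis using v[OF a] by simp
      next
        case 3
        have "Sup Q \<le> v a / n a" using Qle[OF _ a 3] by (intro cSup_least) (auto simp: Q_def)
        then show ?thesis using 3 by (simp add: pos_le_divide_eq)
      qed
    qed
    then show "- H \<le> q \<bullet> f i x a + l i x a - Sup Q * (f i x a \<bullet> e i)" by (simp add: v_def n_def)
  qed
qed

lemma lower_envelope_supersolution: "viscosity_supersolution e N A f l lam lo"
  unfolding viscosity_supersolution_def
proof (intro conjI ballI impI value_lower_envelope(1))
  fix x \<phi> i assume x: "x \<in> S" and \<phi>: "\<phi> \<in> test_functions e N"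
    and min: "\<forall>\<^sub>F z in at x within S. lo z - \<phi> z \<ge> lo x - \<phi> x"
    and i: "i \<in> {1..N}" and xi: "x \<in> P i - \<Gamma>"
  let ?q = "grad e i \<phi> x"
  obtain d where d: "d > 0" "\<And>z. z \<in> S \<Longrightarrow> norm (z - x) < d \<Longrightarrow> z \<in> P i \<and> z \<notin> \<Gamma>"
    using near_interior[OF i, of x] xi by blast
  show "0 \<le> lam * lo x + Ham A f l i x ?q"
  proof (rule supersolution_abstract[OF x \<phi> min, where J = "{i}" and p = "?q \<bullet> e 0" and b = "\<lambda>_. ?q \<bullet> e i"])
    show "j \<in> {i}" if "j \<in> {1..N}" "z \<in> P j" "norm (z - x) < d" for j z
      using P_iff_of_notin_G[OF i that(1)] d(2)[OF P_sub_S[OF that(1,2)] that(3)] that(2) by blast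
    show "\<psi> (?q \<bullet> e 0) (\<lambda>_. ?q \<bullet> e i) z - \<psi> (?q \<bullet> e 0) (\<lambda>_. ?q \<bullet> e i) x \<le> grad e j \<phi> x \<bullet> (z - x)"
      if "j \<in> {i}" "z \<in> P j" for j z
    proof -
      have j: "j = i" "z \<in> P i" "x \<in> P i" using that xi by auto
      have "?q \<bullet> (z - x) = (?q \<bullet> e 0) * ((z - x) \<bullet> e 0) + (?q \<bullet> e i) * ((z - x) \<bullet> e i)"
        using inner_plane[OF i plane_diff[OF P_plane[OF i j(2)] P_plane[OF i j(3)]]] .
      then show ?thesis unfolding j(1) \<psi>_eq[OF i j(2)] \<psi>_eq[OF i j(3)] by (simp add: inner_diff_left algebra_simps)
    qed
    fix j a assume "j \<in> {i}" "a \<in> A j"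
    then have j: "j = i" "a \<in> A i" by auto
    have "- (?q \<bullet> f i x a) - l i x a \<le> Ham A f l i x ?q"
      unfolding Ham_def using xi by (intro cSUP_upper[OF j(2)] Ham_bdd_above[OF i]) auto
    then show "- Ham A f l i x ?q \<le> d\<psi> (?q \<bullet> e 0) (\<lambda>_. ?q \<bullet> e i) j x a + l j x a"
      unfolding j(1) d\<psi>_def using inner_f[OF i _ j(2), of x ?q] xi by simp
  qed (use d i xi in auto)
next
  fix x \<phi> assume \<phi>: "\<phi> \<in> test_functions e N"
    and min: "\<forall>\<^sub>F z in at x within S. lo z - \<phi> z \<ge> lo x - \<phi> x" and x: "x \<in> \<Gamma>"
  let ?q = "\<lambda>i. grad e i \<phi> x"
  define H where "H = Ham_Gam e N A f l x ?q"
  have Hle: "- H \<le> ?q i \<bullet> f i x a + l i x a" if i: "i \<in> {1..N}" and a: "a \<in> A i" "0 \<le> f i x a \<bullet> e i" for i a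
  proof -
    have "- (?q i \<bullet> f i x a) - l i x a \<le> Ham_plus e A f l i x (?q i)"
      unfolding Ham_plus_def using a
      by (intro cSUP_upper bdd_above_mono[OF Ham_bdd_above[OF i G_sub_P[OF i x]]]) auto
    also have "\<dots> \<le> H" unfolding H_def Ham_Gam_def using i by (intro Max_ge) auto
    finally show ?thesis by simp
  qed
  have "\<forall>i\<in>{1..N}. \<exists>\<mu>\<ge>0. \<forall>a\<in>A i. - H \<le> ?q i \<bullet> f i x a + l i x a - \<mu> * (f i x a \<bullet> e i)"
  proof
    fix i assume i: "i \<in> {1..N}"
    show "\<exists>\<mu>\<ge>0. \<forall>a\<in>A i. - H \<le> ?q i \<bullet> f i x a + l i x a - \<mu> * (f i x a \<bullet> e i)"
      by (rule normal_multiplier[OF i x Hle[OF i]]) (assumption | intro exI conjI ballI)+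
  qed
  from bchoice[OF this] obtain \<mu> where \<mu>: "\<And>i. i \<in> {1..N} \<Longrightarrow> 0 \<le> \<mu> i"
    "\<And>i a. i \<in> {1..N} \<Longrightarrow> a \<in> A i \<Longrightarrow> - H \<le> ?q i \<bullet> f i x a + l i x a - \<mu> i * (f i x a \<bullet> e i)" by blast
  define p where "p = ?q 1 \<bullet> e 0"
  have p: "?q i \<bullet> e 0 = p" if "i \<in> {1..N}" for i
    unfolding p_def using N_gt_1 by (intro grad_tangential[OF \<phi> that _ x]) auto
  \<comment> \<open>The normal coordinate vanishes at x and is nonnegative on \<open>P i\<close>, so
    subtracting \<open>\<mu> i\<close> from the slope can only decrease the increment from
    x.\<close>
  define b where "b i = ?q i \<bullet> e i - \<mu> i" for i
  have "0 \<le> lam * lo x + H"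
  \<comment> \<open>Any radius would do, since \<open>J\<close> already contains every
    index.\<close>
  proof (rule supersolution_abstract[OF G_sub_S[OF x] \<phi> min, where J = "{1..N}" and p = p and b = b and ?r0.0 = 1])
    fix i z assume i: "i \<in> {1..N}" and z: "z \<in> P i"
    have xP: "x \<in> P i" using G_sub_P[OF i x] .
    have x0: "x \<bullet> e i = 0" using G_P_iff[OF i xP] x by simp
    have "?q i \<bullet> (z - x) = p * ((z - x) \<bullet> e 0) + (?q i \<bullet> e i) * ((z - x) \<bullet> e i)"
      using inner_plane[OF i plane_diff[OF P_plane[OF i z] P_plane[OF i xP]]] p[OF i] by simp
    moreover have "0 \<le> \<mu> i * (z \<bullet> e i)" using \<mu>(1)[OF i] z P_iff[OF i] by simp
    ultimately show "\<psi> p b z - \<psi> p b x \<le> ?q i \<bullet> (z - x)"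
      unfolding \<psi>_eq[OF i z] \<psi>_eq[OF i xP] b_def by (simp add: inner_diff_left algebra_simps x0)
  next
    fix i a assume i: "i \<in> {1..N}" and a: "a \<in> A i"
    show "- H \<le> d\<psi> p b i x a + l i x a"
      using \<mu>(2)[OF i a] inner_f[OF i G_sub_P[OF i x] a, of "?q i"] p[OF i]
      unfolding d\<psi>_def b_def by (simp add: algebra_simps)
  qed (use N_gt_1 G_sub_P x in auto)
  then show "0 \<le> lam * lo x + Ham_Gam e N A f l x ?q" by (simp add: H_def)
qed

end

theorem theorem3p2:
  fixes e :: "nat \<Rightarrow> real ^ 3" and N :: nat and lam :: real
    and A :: "nat \<Rightarrow> 'a::metric_space set"
    and f :: "nat \<Rightarrow> real ^ 3 \<Rightarrow> 'a \<Rightarrow> real ^ 3"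
    and l :: "nat \<Rightarrow> real ^ 3 \<Rightarrow> 'a \<Rightarrow> real"
  assumes "N > 1"
    and "inj_on e {0..N}"
    and "\<forall>i\<in>{0..N}. norm (e i) = 1"
    and "\<forall>i\<in>{1..N}. e i \<bullet> e 0 = 0"
    and "lam > 0"
    and "H0 e N A f"
    and "H1 e N A l"
    and "H2 e N A f l"
    and "H3_normal e N A f"
  shows "(\<exists>C::real. \<forall>x\<in>junction e N. \<bar>value_function e N A f l lam x\<bar> \<le> ereal C) \<and>
    viscosity_subsolution e N A f l lam
      (upper_envelope (junction e N) (value_function e N A f l lam)) \<and>
    viscosity_supersolution e N A f l lam
      (lower_envelope (junction e N) (value_function e N A f l lam))"
proof -
  have uniform_bound: "\<exists>K>0. \<forall>i\<in>{1..N}. \<forall>x\<in>half_plane e i. \<forall>a\<in>A i. norm (g i x a) \<le> K"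
    if g: "\<forall>i\<in>{1..N}. bounded ((\<lambda>(x, a). g i x a) ` (half_plane e i \<times> A i))"
    for g :: "nat \<Rightarrow> real ^ 3 \<Rightarrow> 'a \<Rightarrow> 'b::real_normed_vector"
  proof -
    have "bounded (\<Union>i\<in>{1..N}. (\<lambda>(x, a). g i x a) ` (half_plane e i \<times> A i))"
      using g by (intro bounded_UN) auto
    then obtain K where "K > 0" "\<And>v. v \<in> (\<Union>i\<in>{1..N}. (\<lambda>(x, a). g i x a) ` (half_plane e i \<times> A i)) \<Longrightarrow> norm v \<le> K"
      unfolding bounded_pos by blast
    then show ?thesis by (intro exI[of _ K]) fastforce
  qed
  have f_bd: "\<forall>i\<in>{1..N}. bounded ((\<lambda>(x, a). f i x a) ` (half_plane e i \<times> A i))"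
    using assms(6) unfolding H0_def by simp
  have l_bd: "\<forall>i\<in>{1..N}. bounded ((\<lambda>(x, a). l i x a) ` (half_plane e i \<times> A i))"
    using assms(7) unfolding H1_def by simp
  obtain M where M: "M > 0" "\<And>i x a. i \<in> {1..N} \<Longrightarrow> x \<in> half_plane e i \<Longrightarrow> a \<in> A i \<Longrightarrow> norm (f i x a) \<le> M"
    using uniform_bound[OF f_bd] by blast
  obtain B where B: "B > 0" "\<And>i x a. i \<in> {1..N} \<Longrightarrow> x \<in> half_plane e i \<Longrightarrow> a \<in> A i \<Longrightarrow> \<bar>l i x a\<bar> \<le> B"
    using uniform_bound[OF l_bd] unfolding real_norm_def by blast
  obtain L where L: "L > 0" "\<And>i x y a. i \<in> {1..N} \<Longrightarrow> x \<in> half_plane e i \<Longrightarrow> y \<in> half_plane e i \<Longrightarrow>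
      a \<in> A i \<Longrightarrow> norm (f i x a - f i y a) \<le> L * norm (x - y)"
    using assms(6) unfolding H0_def by blast
  obtain \<delta> where \<delta>: "\<delta> > 0" "\<And>i x. i \<in> {1..N} \<Longrightarrow> x \<in> Gam e \<Longrightarrow> {-\<delta>..\<delta>} \<subseteq> (\<lambda>a. f i x a \<bullet> e i) ` A i"
    using assms(9) unfolding H3_normal_def by blast
  obtain \<omega> where \<omega>: "modulus_of_continuity \<omega>" "\<And>i x y a. i \<in> {1..N} \<Longrightarrow> x \<in> half_plane e i \<Longrightarrow>
      y \<in> half_plane e i \<Longrightarrow> a \<in> A i \<Longrightarrow> \<bar>l i x a - l i y a\<bar> \<le> \<omega> (norm (x - y))"
    using assms(7) unfolding H1_def by blast
  have unif: "\<exists>d>0. \<forall>i\<in>{1..N}. \<forall>x\<in>half_plane e i. \<forall>y\<in>half_plane e i. \<forall>a\<in>A i.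
      norm (x - y) < d \<longrightarrow> \<bar>l i x a - l i y a\<bar> \<le> \<epsilon>" if \<epsilon>: "0 < \<epsilon>" for \<epsilon>
  proof -
    have "\<forall>\<^sub>F s in at_right 0. \<omega> s < \<epsilon>"
      using \<omega>(1) \<epsilon> unfolding modulus_of_continuity_def by (auto intro: order_tendstoD(2))
    then obtain d where d: "d > 0" "\<And>s. 0 < s \<Longrightarrow> s < d \<Longrightarrow> \<omega> s < \<epsilon>"
      unfolding eventually_at_right_field by auto
    \<comment> \<open>The limit at 0 concerns positive arguments; the value at 0 itself is zero by
      definition of a modulus.\<close>
    have "\<omega> s \<le> \<epsilon>" if "0 \<le> s" "s < d" for s
      using \<omega>(1) d(2)[of s] that \<epsilon> by (cases "s = 0") (auto simp: modulus_of_continuity_def)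
    then have "\<bar>l i x a - l i y a\<bar> \<le> \<epsilon>" if "i \<in> {1..N}" "x \<in> half_plane e i" "y \<in> half_plane e i" "a \<in> A i"
        "norm (x - y) < d" for i x y a
      using \<omega>(2)[OF that(1-4)] that(5) norm_ge_zero[of "x - y"] order_trans by blast
    then show ?thesis using d(1) by blast
  qed
  interpret junction_control e N A f l lam M B L \<delta>
  proof unfold_locales
    show "\<exists>a\<in>A i. f i x a \<bullet> e i = r" if "i \<in> {1..N}" "x \<in> Gam e" "\<bar>r\<bar> \<le> \<delta>" for i x r
    proof -
      have "r \<in> {-\<delta>..\<delta>}" using that(3) by (simp add: abs_le_iff)
      then have "r \<in> (\<lambda>a. f i x a \<bullet> e i) ` A i" using \<delta>(2)[OF that(1,2)] by blast
      then show ?thesis by blast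
    qed
    show "norm (e i) = 1" if "i \<in> {0..N}" for i using assms(3) that by blast
    show "e i \<bullet> e 0 = 0" if "i \<in> {1..N}" for i using assms(4) that by blast
    show "A i \<noteq> {}" "compact (A i)" if "i \<in> {1..N}" for i
      using assms(6) that unfolding H0_def by simp_all
    show "A i \<inter> A j = {}" if "i \<in> {1..N}" "j \<in> {1..N}" "i \<noteq> j" for i j
      using assms(6) that unfolding H0_def by simp
    show "f i x a \<in> plane e i" if "i \<in> {1..N}" "x \<in> half_plane e i" "a \<in> A i" for i x a
      using assms(6) that unfolding H0_def by simp
    show "continuous_on (half_plane e i \<times> A i) (\<lambda>(x, a). f i x a)" if "i \<in> {1..N}" for i
      using assms(6) that unfolding H0_def by simp
    show "continuous_on (half_plane e i \<times> A i) (\<lambda>(x, a). l i x a)" if "i \<in> {1..N}" for i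
      using assms(7) that unfolding H1_def by simp
    show "convex (FL A f l i x)" if "i \<in> {1..N}" "x \<in> half_plane e i" for i x
      using assms(8) that unfolding H2_def by simp
  qed (fact assms M B L \<delta> unif)+
  have "\<bar>vf x\<bar> \<le> ereal (B / lam)" if "x \<in> S" for x using vr(1,2)[OF that] by simp
  then show ?thesis using upper_envelope_subsolution lower_envelope_supersolution by blast
qed

end
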